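(* Let $(M,Z)$ be a manifold with a (positive-definite) conic Zermelo metric with navigation data $(F,W)$ and let $\nu_{BH}$ be the Busemann-Hausdorff volume form associated with $Z$. If $L\subset M$ is a hypersurface and $\xi$ is an admissible unit normal vector field along $L$ with respect to $Z$, then $\xi-W$ is a unit normal vector field along $L$ with respect to $F$, and the mean curvature for $(M,Z,\nu_{BH})$ of $L$ in the direction of $\xi$ is $$\Pi^Z_{\xi}=\Pi^F_{\xi-W}+\operatorname{div}W,$$ where $\Pi^F_{\xi-W}$ is the mean curvature for $(M,F,\nu_{BH})$ of $L$ in the direction of $\xi-W$.
   Context: $M$ is a smooth connected $n$-dimensional manifold, $\pi:TM\to M$ its tangent bundle. A conic Finsler metric on $M$ is a continuous function $F:A\to[0,\infty)$, where $A\subset TM$ is open, conic ($rv\in A$ for $v\in A$, $r>0$), $\pi(A)=M$, each $A_p=A\cap T_pM$ is connected, $F$ is smooth on $A\setminus 0$, $F(rv)=rF(v)$ for $r>0$, and for each $v\in A\setminus 0$ the fundamental tensor $g_v(u_1,u_2)=\frac12\frac{\partial^2}{\partial t_2\partial t_1}F^2(v+t_1u_1+t_2u_2)|_{t_1=t_2=0}$ is positive-definite on $T_{\pi(v)}M$. It is a (regular) Finsler metric if $A=TM$. Conic Zermelo metric. Let $F:TM\to[0,\infty)$ be a Finsler metric with indicatrix $\Sigma^F=F^{-1}(1)$ and fundamental tensor $g^F$, and $W$ a smooth vector field on $M$. Let $\Sigma=\{u+W: u\in\Sigma^F,\ g^F_u(u,-W)<1\}$, $A\setminus0=\{rv: v\in\Sigma,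 r>0\}$, and define $Z:A\to[0,\infty)$ by $Z(v)=r>0$ iff $r^{-1}v\in\Sigma$, $Z(v)=0$ iff $v=0$. Then $F(v/Z(v)-W)=1$ for $v\in A\setminus0$, and $Z$ is a conic Finsler metric, called the conic Zermelo metric with navigation data $(F,W)$. Busemann-Hausdorff volume form. For a regular Finsler metric $F$: for a basis $\{e_i\}$ of $T_pM$ (oriented if $M$ is oriented) with dual basis $\{\theta^i\}$, $(\nu_{BH})_p=\frac{\operatorname{vol}(\mathbb B^n)}{\operatorname{vol}\{(y^i)\in\mathbb R^n: F(y^ie_i)<1\}}\,\theta^1\wedge\cdots\wedge\theta^n$, where $\mathbb B^n$ is the open Euclidean unit ball and $\operatorname{vol}$ is Euclidean volume. By convention, the Busemann-Hausdorff volume form associated with the conic Zermelo metric $Z$ is that of $F$ (for $F(-W)<1$ the two agree). Divergence: $(\operatorname{div}X)\nu_{BH}=\mathcal L_X\nu_{BH}$. Mean curvature, for a conic Finsler metric $F$ with a volume form $\nu$: a vector field is admissible if it takes values in $A\setminus0$. A unit normal field along a hypersurface $L$ is a smooth admissible $\xi$ along $L$ with $F(\xi)=1$ and $g_\xi(\xi,u)=0$ for all $u\in TL$. A smooth function $f$ is admissible if on $\{df\ne0\}$ there is an admissible vector field $\nabla f$ (the gradient) with $g_{\nabla f}(\nabla f,\cdot)=df$; it is a distance function if $F(\nabla f)=1$ at regular points. Given $L$, $\xi$ and $p\in L$, there is a distance function $\rho$ near $p$, unique up to a constant, such that $L$ is locally a regular level set of $\rho$ and $\nabla\rho=\xi$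 along $L$ near $p$; the (nonlinear) mean curvature of $L$ at $p$ in the direction $\xi$ is $\Pi_{\xi(p)}=\triangle\rho(p)=\operatorname{div}(\nabla\rho)(p)$, with the divergence taken with respect to $\nu$. Superscripts $Z,F$ indicate the metric used. *)

theory Defs
  imports "HOL-Analysis.Analysis" "HOL-Library.Function_Algebras"
begin

section \<open>Smooth maps on open subsets of normed spaces\<close>

text \<open>
  Continuous differentiability of order \<open>k\<close>, by iterated directional derivatives. It is
  used for open subsets of finite-dimensional spaces, where it is the usual notion.
\<close>

primrec Ck_on :: "nat \<Rightarrow> 'a set \<Rightarrow> ('a::real_normed_vector \<Rightarrow> 'b::real_normed_vector) \<Rightarrow> bool" where
  "Ck_on 0 S f \<longleftrightarrow> continuous_on S f"
| "Ck_on (Suc k) S f \<longleftrightarrow>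
     (\<forall>x\<in>S. f differentiable (at x)) \<and> (\<forall>v. Ck_on k S (\<lambda>x. frechet_derivative f (at x) v))"

definition smooth_on :: "'a set \<Rightarrow> ('a::real_normed_vector \<Rightarrow> 'b::real_normed_vector) \<Rightarrow> bool" where
  "smooth_on S f \<longleftrightarrow> (\<forall>k. Ck_on k S f)"

section \<open>Pointwise scalar multiplication of functions\<close>

instantiation "fun" :: (type, real_vector) real_vector
begin

definition scaleR_fun :: "real \<Rightarrow> ('a \<Rightarrow> 'b) \<Rightarrow> 'a \<Rightarrow> 'b" where
  "scaleR_fun r f = (\<lambda>x. r *\<^sub>R f x)"

instance
  by standard (simp_all add: scaleR_fun_def fun_eq_iff algebra_simps)

end

section \<open>Smooth manifolds\<close>

text \<open>
  A manifold of dimension \<open>n = CARD('n)\<close> is given by a topology \<open>M\<close> on the points (the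
  underlying set is \<open>topspace M\<close>) and a smooth atlas \<open>\<A>\<close>. A chart is a pair of its
  domain and its coordinate map.
\<close>

type_synonym ('a, 'n) chart = "'a set \<times> ('a \<Rightarrow> real^'n)"

definition chart_inv :: "('a, 'n::finite) chart \<Rightarrow> real^'n \<Rightarrow> 'a" where
  "chart_inv c = inv_into (fst c) (snd c)"

definition is_chart :: "'a topology \<Rightarrow> ('a, 'n::finite) chart \<Rightarrow> bool" where
  "is_chart M c \<longleftrightarrow> openin M (fst c) \<and> open (snd c ` fst c) \<and>
     homeomorphic_map (subtopology M (fst c)) (top_of_set (snd c ` fst c)) (snd c)"

definition has_countable_base :: "'a topology \<Rightarrow> bool" where
  "has_countable_base M \<longleftrightarrow> (\<exists>B. countable B \<and> (\<forall>V\<in>B. openin M V) \<and>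
     (\<forall>U x. openin M U \<and> x \<in> U \<longrightarrow> (\<exists>V\<in>B. x \<in> V \<and> V \<subseteq> U)))"

definition smooth_manifold :: "'a topology \<Rightarrow> ('a, 'n::finite) chart set \<Rightarrow> bool" where
  "smooth_manifold M \<A> \<longleftrightarrow>
     Hausdorff_space M \<and> has_countable_base M \<and>
     (\<forall>c\<in>\<A>. is_chart M c) \<and> (\<Union>c\<in>\<A>. fst c) = topspace M \<and>
     (\<forall>c\<in>\<A>. \<forall>d\<in>\<A>. smooth_on (snd c ` (fst c \<inter> fst d)) (snd d \<circ> chart_inv c))"

text \<open>A fixed choice of a chart around each point; whatever is computed below in this chart
  does not depend on the choice.\<close>

definition chart_at :: "('a, 'n::finite) chart set \<Rightarrow> 'a \<Rightarrow> ('a, 'n) chart" where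
  "chart_at \<A> p = (SOME c. c \<in> \<A> \<and> p \<in> fst c)"

text \<open>
  A tangent vector at \<open>p\<close> is the family of its coordinate vectors in all charts around \<open>p\<close>,
  related by the differentials of the coordinate changes (and set to \<open>0\<close> at the charts
  whose domain does not contain \<open>p\<close>, so that equality of vectors is equality of functions).
  The vector space operations are the pointwise ones.
\<close>

type_synonym ('a, 'n) tvec = "('a, 'n) chart \<Rightarrow> real^'n"

definition tangent_space :: "('a, 'n::finite) chart set \<Rightarrow> 'a \<Rightarrow> ('a, 'n) tvec set" where
  "tangent_space \<A> p =
     {v. (\<forall>c\<in>\<A>. \<forall>d\<in>\<A>. p \<in> fst c \<and> p \<in> fst d \<longrightarrow>
            v d = frechet_derivative (snd d \<circ> chart_inv c) (at (snd c p)) (v c)) \<and>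
         (\<forall>c. \<not> (c \<in> \<A> \<and> p \<in> fst c) \<longrightarrow> v c = 0)}"

definition tangent_bundle :: "'a topology \<Rightarrow> ('a, 'n::finite) chart set \<Rightarrow> ('a \<times> ('a, 'n) tvec) set" where
  "tangent_bundle M \<A> = {(p, v). p \<in> topspace M \<and> v \<in> tangent_space \<A> p}"

text \<open>The tangent vector at \<open>p\<close> whose coordinates in the chart \<open>c\<close> are \<open>y\<close>.\<close>

definition vec_of_coords :: "('a, 'n::finite) chart set \<Rightarrow> ('a, 'n) chart \<Rightarrow> 'a \<Rightarrow> real^'n \<Rightarrow> ('a, 'n) tvec" where
  "vec_of_coords \<A> c p y =
     (\<lambda>d. if d \<in> \<A> \<and> p \<in> fst d then frechet_derivative (snd d \<circ> chart_inv c) (at (snd c p)) y else 0)"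

text \<open>The inverse of the chart of the tangent bundle induced by \<open>c\<close>, and the corresponding
  coordinate image of a subset of the tangent bundle.\<close>

definition bundle_point :: "('a, 'n::finite) chart set \<Rightarrow> ('a, 'n) chart \<Rightarrow> (real^'n) \<times> (real^'n) \<Rightarrow> 'a \<times> ('a, 'n) tvec" where
  "bundle_point \<A> c = (\<lambda>(x, y). (chart_inv c x, vec_of_coords \<A> c (chart_inv c x) y))"

definition bundle_image :: "('a, 'n::finite) chart set \<Rightarrow> ('a, 'n) chart \<Rightarrow> ('a \<times> ('a, 'n) tvec) set \<Rightarrow> ((real^'n) \<times> (real^'n)) set" where
  "bundle_image \<A> c A = {z \<in> (snd c ` fst c) \<times> UNIV. bundle_point \<A> c z \<in> A}"

definition smooth_fun :: "('a, 'n::finite) chart set \<Rightarrow> 'a set \<Rightarrow> ('a \<Rightarrow> real) \<Rightarrow> bool" where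
  "smooth_fun \<A> U f \<longleftrightarrow> (\<forall>c\<in>\<A>. smooth_on (snd c ` (U \<inter> fst c)) (f \<circ> chart_inv c))"

definition smooth_vector_field :: "('a, 'n::finite) chart set \<Rightarrow> 'a set \<Rightarrow> ('a \<Rightarrow> ('a, 'n) tvec) \<Rightarrow> bool" where
  "smooth_vector_field \<A> U X \<longleftrightarrow>
     (\<forall>p\<in>U. X p \<in> tangent_space \<A> p) \<and>
     (\<forall>c\<in>\<A>. smooth_on (snd c ` (U \<inter> fst c)) (\<lambda>x. X (chart_inv c x) c))"

definition differential :: "('a, 'n::finite) chart set \<Rightarrow> ('a \<Rightarrow> real) \<Rightarrow> 'a \<Rightarrow> ('a, 'n) tvec \<Rightarrow> real" where
  "differential \<A> f p v =
     (let c = chart_at \<A> p in frechet_derivative (f \<circ> chart_inv c) (at (snd c p)) (v c))"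

definition regular_at :: "('a, 'n::finite) chart set \<Rightarrow> ('a \<Rightarrow> real) \<Rightarrow> 'a \<Rightarrow> bool" where
  "regular_at \<A> f p \<longleftrightarrow> (\<exists>v\<in>tangent_space \<A> p. differential \<A> f p v \<noteq> 0)"

definition lie_bracket :: "('a, 'n::finite) chart set \<Rightarrow> ('a \<Rightarrow> ('a, 'n) tvec) \<Rightarrow> ('a \<Rightarrow> ('a, 'n) tvec) \<Rightarrow> 'a \<Rightarrow> ('a, 'n) tvec" where
  "lie_bracket \<A> X Y p =
     (let c = chart_at \<A> p;
          X' = (\<lambda>x. X (chart_inv c x) c);
          Y' = (\<lambda>x. Y (chart_inv c x) c)
      in vec_of_coords \<A> c p
           (frechet_derivative Y' (at (snd c p)) (X p c) - frechet_derivative X' (at (snd c p)) (Y p c)))"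

section \<open>Hypersurfaces\<close>

text \<open>Embedded hypersurfaces, described locally as regular level sets.\<close>

definition local_equation :: "'a topology \<Rightarrow> ('a, 'n::finite) chart set \<Rightarrow> 'a set \<Rightarrow> 'a set \<Rightarrow> ('a \<Rightarrow> real) \<Rightarrow> bool" where
  "local_equation M \<A> L U f \<longleftrightarrow> openin M U \<and> smooth_fun \<A> U f \<and>
     L \<inter> U = {q\<in>U. f q = 0} \<and> (\<forall>q\<in>L \<inter> U. regular_at \<A> f q)"

definition hypersurface :: "'a topology \<Rightarrow> ('a, 'n::finite) chart set \<Rightarrow> 'a set \<Rightarrow> bool" where
  "hypersurface M \<A> L \<longleftrightarrow> L \<subseteq> topspace M \<and> (\<forall>p\<in>L. \<exists>U f. p \<in> U \<and> local_equation M \<A> L U f)"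

text \<open>All local equations of \<open>L\<close> around \<open>p\<close> have proportional differentials at \<open>p\<close>.\<close>

definition hypersurface_tangent :: "'a topology \<Rightarrow> ('a, 'n::finite) chart set \<Rightarrow> 'a set \<Rightarrow> 'a \<Rightarrow> ('a, 'n) tvec set" where
  "hypersurface_tangent M \<A> L p =
     {v\<in>tangent_space \<A> p. \<forall>U f. p \<in> U \<and> local_equation M \<A> L U f \<longrightarrow> differential \<A> f p v = 0}"

text \<open>Smoothness along an embedded hypersurface means local smooth extendability.\<close>

definition smooth_along :: "('a, 'n::finite) chart set \<Rightarrow> 'a set \<Rightarrow> ('a \<Rightarrow> ('a, 'n) tvec) \<Rightarrow> bool" where
  "smooth_along \<A> L \<xi> \<longleftrightarrow>
     (\<forall>q\<in>L. \<xi> q \<in> tangent_space \<A> q) \<and>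
     (\<forall>c\<in>\<A>. \<forall>q\<in>L \<inter> fst c. \<exists>S V. open S \<and> snd c q \<in> S \<and> smooth_on S V \<and>
        (\<forall>x\<in>L \<inter> fst c. snd c x \<in> S \<longrightarrow> V (snd c x) = \<xi> x c))"

section \<open>Conic Finsler metrics\<close>

text \<open>Metrics are real functions on pairs (base point, tangent vector); their values outside of
  the domain \<open>A\<close> are irrelevant.\<close>

definition fundamental_tensor :: "('a \<times> ('a, 'n::finite) tvec \<Rightarrow> real) \<Rightarrow> 'a \<Rightarrow> ('a, 'n) tvec \<Rightarrow> ('a, 'n) tvec \<Rightarrow> ('a, 'n) tvec \<Rightarrow> real" where
  "fundamental_tensor F p v u1 u2 =
     1/2 * deriv (\<lambda>t2. deriv (\<lambda>t1. (F (p, v + t1 *\<^sub>R u1 + t2 *\<^sub>R u2))\<^sup>2) 0) 0"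

definition conic_finsler :: "'a topology \<Rightarrow> ('a, 'n::finite) chart set \<Rightarrow> ('a \<times> ('a, 'n) tvec) set \<Rightarrow> ('a \<times> ('a, 'n) tvec \<Rightarrow> real) \<Rightarrow> bool" where
  "conic_finsler M \<A> A F \<longleftrightarrow>
     A \<subseteq> tangent_bundle M \<A> \<and>
     (\<forall>c\<in>\<A>. open (bundle_image \<A> c A)) \<and>
     (\<forall>p v r. (p, v) \<in> A \<and> r > 0 \<longrightarrow> (p, r *\<^sub>R v) \<in> A) \<and>
     fst ` A = topspace M \<and>
     (\<forall>c\<in>\<A>. \<forall>p\<in>fst c. connected {y. (p, vec_of_coords \<A> c p y) \<in> A}) \<and>
     (\<forall>z\<in>A. F z \<ge> 0) \<and>
     (\<forall>c\<in>\<A>. continuous_on (bundle_image \<A> c A) (F \<circ> bundle_point \<A> c)) \<and>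
     (\<forall>c\<in>\<A>. smooth_on (bundle_image \<A> c {(p, v)\<in>A. v \<noteq> 0}) (F \<circ> bundle_point \<A> c)) \<and>
     (\<forall>p v r. (p, v) \<in> A \<and> r > 0 \<longrightarrow> F (p, r *\<^sub>R v) = r * F (p, v)) \<and>
     (\<forall>p v u. (p, v) \<in> A \<and> v \<noteq> 0 \<and> u \<in> tangent_space \<A> p \<and> u \<noteq> 0 \<longrightarrow>
        fundamental_tensor F p v u u > 0)"

definition finsler :: "'a topology \<Rightarrow> ('a, 'n::finite) chart set \<Rightarrow> ('a \<times> ('a, 'n) tvec \<Rightarrow> real) \<Rightarrow> bool" where
  "finsler M \<A> F \<longleftrightarrow> conic_finsler M \<A> (tangent_bundle M \<A>) F"

section \<open>Conic Zermelo metrics\<close>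

definition zermelo_indicatrix :: "'a topology \<Rightarrow> ('a, 'n::finite) chart set \<Rightarrow> ('a \<times> ('a, 'n) tvec \<Rightarrow> real) \<Rightarrow> ('a \<Rightarrow> ('a, 'n) tvec) \<Rightarrow> ('a \<times> ('a, 'n) tvec) set" where
  "zermelo_indicatrix M \<A> F W =
     {(p, u + W p) | p u. (p, u) \<in> tangent_bundle M \<A> \<and> F (p, u) = 1 \<and>
                          fundamental_tensor F p u u (- W p) < 1}"

text \<open>
  The domain of the Zermelo metric away from the zero section is the cone over the
  indicatrix. The zero vector at \<open>p\<close> belongs to the (open) domain exactly where the wind is mild,
  that is, where \<open>F (- W p) < 1\<close> and hence the cone consists of all the nonzero vectors.
\<close>

definition zermelo_domain :: "'a topology \<Rightarrow> ('a, 'n::finite) chart set \<Rightarrow> ('a \<times> ('a, 'n) tvec \<Rightarrow> real) \<Rightarrow> ('a \<Rightarrow> ('a, 'n) tvec) \<Rightarrow> ('a \<times> ('a, 'n) tvec) set" where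
  "zermelo_domain M \<A> F W =
     {(p, r *\<^sub>R v) | p r v. (p, v) \<in> zermelo_indicatrix M \<A> F W \<and> r > 0} \<union>
     {(p, 0) | p. p \<in> topspace M \<and> F (p, - W p) < 1}"

definition zermelo_metric :: "'a topology \<Rightarrow> ('a, 'n::finite) chart set \<Rightarrow> ('a \<times> ('a, 'n) tvec \<Rightarrow> real) \<Rightarrow> ('a \<Rightarrow> ('a, 'n) tvec) \<Rightarrow> 'a \<times> ('a, 'n) tvec \<Rightarrow> real" where
  "zermelo_metric M \<A> F W = (\<lambda>(p, v).
     if v = 0 then 0
     else (THE r. r > 0 \<and> (p, inverse r *\<^sub>R v) \<in> zermelo_indicatrix M \<A> F W))"

section \<open>Volume forms and divergence\<close>

text \<open>
  As \<open>M\<close> need not be orientable, a volume form \<open>\<nu>\<close> is represented by the local forms \<open>\<nu> c\<close>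
  on the domains of the charts \<open>c\<close>, each being the one that is positive on the coordinate
  frame of \<open>c\<close>; on overlaps they agree up to sign. A top-degree form takes a point and a
  family of \<open>n\<close> tangent vectors indexed by \<open>'n\<close>.
\<close>

type_synonym ('a, 'n) top_form = "'a \<Rightarrow> ('n \<Rightarrow> ('a, 'n) tvec) \<Rightarrow> real"
type_synonym ('a, 'n) vol_form = "('a, 'n) chart \<Rightarrow> ('a, 'n) top_form"

definition coord_frame :: "('a, 'n::finite) chart set \<Rightarrow> ('a, 'n) chart \<Rightarrow> 'a \<Rightarrow> 'n \<Rightarrow> ('a, 'n) tvec" where
  "coord_frame \<A> c p i = vec_of_coords \<A> c p (axis i 1)"

text \<open>
  The Busemann-Hausdorff form, with respect to the coordinate basis of \<open>c\<close>; the dual basis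
  sends \<open>v\<close> to the components of \<open>v c\<close>. By convention this form of \<open>F\<close> is also the
  Busemann-Hausdorff form associated with every conic Zermelo metric with navigation data \<open>(F, W)\<close>.
\<close>

definition busemann_hausdorff :: "('a, 'n::finite) chart set \<Rightarrow> ('a \<times> ('a, 'n) tvec \<Rightarrow> real) \<Rightarrow> ('a, 'n) vol_form" where
  "busemann_hausdorff \<A> F c p vs =
     measure lborel (ball (0 :: real^'n) 1) /
     measure lborel {y :: real^'n. F (p, \<Sum>i\<in>UNIV. (y $ i) *\<^sub>R coord_frame \<A> c p i) < 1} *
     det (\<chi> i j. vs j c $ i)"

definition zermelo_busemann_hausdorff :: "('a, 'n::finite) chart set \<Rightarrow> ('a \<times> ('a, 'n) tvec \<Rightarrow> real) \<Rightarrow> ('a \<Rightarrow> ('a, 'n) tvec) \<Rightarrow> ('a, 'n) vol_form" where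
  "zermelo_busemann_hausdorff \<A> F W = busemann_hausdorff \<A> F"

text \<open>
  The Lie derivative of a top-degree form,
  \<open>(L\<^sub>X \<omega>)(Y\<^sub>1, \<dots>, Y\<^sub>n) = X (\<omega>(Y\<^sub>1, \<dots>, Y\<^sub>n)) - (\<Sum>j. \<omega>(Y\<^sub>1, \<dots>, [X, Y\<^sub>j], \<dots>, Y\<^sub>n))\<close>,
  evaluated at vectors \<open>vs j\<close> at \<open>p\<close> through their extensions \<open>Y j\<close> with constant coordinates.
\<close>

definition lie_derivative :: "('a, 'n::finite) chart set \<Rightarrow> ('a \<Rightarrow> ('a, 'n) tvec) \<Rightarrow> ('a, 'n) top_form \<Rightarrow> ('a, 'n) top_form" where
  "lie_derivative \<A> X \<omega> p vs =
     (let c = chart_at \<A> p;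
          Y = (\<lambda>j q. vec_of_coords \<A> c q (vs j c))
      in differential \<A> (\<lambda>q. \<omega> q (\<lambda>j. Y j q)) p (X p)
         - (\<Sum>j\<in>UNIV. \<omega> p (vs(j := lie_bracket \<A> X (Y j) p))))"

definition divergence :: "('a, 'n::finite) chart set \<Rightarrow> ('a, 'n) vol_form \<Rightarrow> ('a \<Rightarrow> ('a, 'n) tvec) \<Rightarrow> 'a \<Rightarrow> real" where
  "divergence \<A> \<nu> X p =
     (let \<omega> = \<nu> (chart_at \<A> p)
      in THE h. \<forall>vs. (\<forall>j. vs j \<in> tangent_space \<A> p) \<longrightarrow> lie_derivative \<A> X \<omega> p vs = h * \<omega> p vs)"

section \<open>Mean curvature\<close>

definition admissible_field :: "('a, 'n::finite) chart set \<Rightarrow> ('a \<times> ('a, 'n) tvec) set \<Rightarrow> 'a set \<Rightarrow> ('a \<Rightarrow> ('a, 'n) tvec) \<Rightarrow> bool" where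
  "admissible_field \<A> A U X \<longleftrightarrow> smooth_vector_field \<A> U X \<and> (\<forall>q\<in>U. (q, X q) \<in> A \<and> X q \<noteq> 0)"

definition unit_normal :: "'a topology \<Rightarrow> ('a, 'n::finite) chart set \<Rightarrow> ('a \<times> ('a, 'n) tvec) set \<Rightarrow> ('a \<times> ('a, 'n) tvec \<Rightarrow> real) \<Rightarrow> 'a set \<Rightarrow> ('a \<Rightarrow> ('a, 'n) tvec) \<Rightarrow> bool" where
  "unit_normal M \<A> A F L \<xi> \<longleftrightarrow> smooth_along \<A> L \<xi> \<and>
     (\<forall>q\<in>L. (q, \<xi> q) \<in> A \<and> \<xi> q \<noteq> 0 \<and> F (q, \<xi> q) = 1 \<and>
        (\<forall>u\<in>hypersurface_tangent M \<A> L q. fundamental_tensor F q (\<xi> q) (\<xi> q) u = 0))"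

text \<open>\<open>X\<close> is a gradient of \<open>f\<close> on \<open>U\<close>; it is only constrained at the regular points of \<open>f\<close>.\<close>

definition is_gradient :: "('a, 'n::finite) chart set \<Rightarrow> ('a \<times> ('a, 'n) tvec) set \<Rightarrow> ('a \<times> ('a, 'n) tvec \<Rightarrow> real) \<Rightarrow> 'a set \<Rightarrow> ('a \<Rightarrow> real) \<Rightarrow> ('a \<Rightarrow> ('a, 'n) tvec) \<Rightarrow> bool" where
  "is_gradient \<A> A F U f X \<longleftrightarrow>
     admissible_field \<A> A {q\<in>U. regular_at \<A> f q} X \<and>
     (\<forall>q\<in>{q\<in>U. regular_at \<A> f q}. \<forall>u\<in>tangent_space \<A> q.
        fundamental_tensor F q (X q) (X q) u = differential \<A> f q u)"

text \<open>\<open>\<rho>\<close> is a distance function on the open set \<open>U\<close>, with gradient \<open>X\<close>.\<close>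

definition distance_function :: "'a topology \<Rightarrow> ('a, 'n::finite) chart set \<Rightarrow> ('a \<times> ('a, 'n) tvec) set \<Rightarrow> ('a \<times> ('a, 'n) tvec \<Rightarrow> real) \<Rightarrow> 'a set \<Rightarrow> ('a \<Rightarrow> real) \<Rightarrow> ('a \<Rightarrow> ('a, 'n) tvec) \<Rightarrow> bool" where
  "distance_function M \<A> A F U \<rho> X \<longleftrightarrow>
     openin M U \<and> smooth_fun \<A> U \<rho> \<and> is_gradient \<A> A F U \<rho> X \<and>
     (\<forall>q\<in>U. regular_at \<A> \<rho> q \<longrightarrow> F (q, X q) = 1)"

definition mean_curvature :: "'a topology \<Rightarrow> ('a, 'n::finite) chart set \<Rightarrow> ('a \<times> ('a, 'n) tvec) set \<Rightarrow> ('a \<times> ('a, 'n) tvec \<Rightarrow> real) \<Rightarrow> ('a, 'n) vol_form \<Rightarrow> 'a set \<Rightarrow> ('a \<Rightarrow> ('a, 'n) tvec) \<Rightarrow> 'a \<Rightarrow> real" where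
  "mean_curvature M \<A> A F \<nu> L \<xi> p =
     (THE h. \<exists>U \<rho> X. p \<in> U \<and> distance_function M \<A> A F U \<rho> X \<and>
        L \<inter> U = {q\<in>U. \<rho> q = \<rho> p} \<and>
        (\<forall>q\<in>L \<inter> U. regular_at \<A> \<rho> q \<and> X q = \<xi> q) \<and>
        h = divergence \<A> \<nu> X p)"

end

theory Submission
  imports Defs
begin

text \<open>In a chart, the divergence of a field \<open>X\<close> is the logarithmic derivative of the density along
  \<open>X\<close> plus the Euclidean trace of \<open>DX\<close>. If \<open>X\<close> is the \<open>Z\<close>-gradient of a distance function, then
  \<open>Y = X - W\<close> satisfies \<open>F (Y) = 1\<close> and extends the unit normal \<open>\<xi> - W\<close>. The trace of \<open>DY\<close> at a
  point of \<open>L\<close> does not depend on the extension: two extensions differ by \<open>f * R\<close> for a local equation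
  \<open>f\<close> of \<open>L\<close>, the difference of the traces is \<open>df (R)\<close>, and differentiating \<open>F (Y) = 1\<close> shows that
  \<open>R\<close> is \<open>F\<close>-orthogonal to the normal, hence tangent to \<open>L\<close>. So both mean curvatures have the same
  trace term, and they differ by \<open>div W\<close>.

  That the mean curvatures are defined at all requires distance functions for \<open>F\<close> and for \<open>Z\<close>, which
  solve a Hamilton--Jacobi equation by the method of characteristics, and the differentiability of
  the Busemann-Hausdorff density.\<close>

section \<open>Calculus of smooth maps\<close>

text \<open>\<open>mean_curvature\<close> and \<open>divergence\<close> are definite descriptions,
  so every equation between them needs existence and uniqueness of the described number. That number
  is pinned by a first-order argument at \<open>p\<close> for an arbitrary distance function, not
  through uniqueness of the distance function. The two metrics are linked by one formula: for
  \<open>v = u + W\<close> the functional \<open>g^Z_v(v, .)\<close> is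
  \<open>dF_u / (1 + dF_u(W))\<close>, a positive multiple of \<open>g^F_u(u, .)\<close>. The
  condition that defines the Zermelo indicatrix says exactly that this denominator is positive. So
  both normals have the same orthogonal hyperplane. The same denominator rescales the initial
  momenta of the Hamilton-Jacobi problem, and therefore one existence theorem with a drift
  \<open>V\<close> serves \<open>F\<close> (drift \<open>0\<close>) and \<open>Z\<close> (drift
  \<open>W\<close>). The other obstacle is regularity: \<open>F\<close> is not smooth on the zero
  section, and the volume in the Busemann-Hausdorff form is the measure of a moving set. Both are
  avoided by integrating a profile of \<open>F\<close> that vanishes near the zero section and far
  away; one derivative of the density is enough, since the divergence differentiates it
  once.\<close>

lemma Ck_on_cong:
  assumes "open S" "\<And>x. x \<in> S \<Longrightarrow> f x = g x"
  shows "Ck_on k S f \<longleftrightarrow> Ck_on k S g"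
  using assms(2)
proof (induction k arbitrary: f g)
  case 0
  then show ?case by simp
next
  case (Suc k)
  have d: "(f has_derivative D) (at x) \<longleftrightarrow> (g has_derivative D) (at x)" if "x \<in> S" for x D
    using Suc.prems that \<open>open S\<close>
    by (metis has_derivative_transform_within_open)
  have "frechet_derivative f (at x) = frechet_derivative g (at x)" if "x \<in> S" for x
    using d[OF that] by (simp add: frechet_derivative_def)
  then have "Ck_on k S (\<lambda>x. frechet_derivative f (at x) v) \<longleftrightarrow> Ck_on k S (\<lambda>x. frechet_derivative g (at x) v)" for v
    by (intro Suc.IH) simp
  then show ?case
    using d by (simp add: differentiable_def)
qed

text \<open>\<open>frechet_derivative\<close> is a choice operator, and this rule spares every later
  proof from computing it: by uniqueness any explicit derivative \<open>f'\<close> may stand in.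
  Openness of \<open>S\<close> lets the replacement survive further differentiation.\<close>

lemma Ck_on_SucI:
  assumes "open S" "\<And>x. x \<in> S \<Longrightarrow> (f has_derivative f' x) (at x)" "\<And>v. Ck_on k S (\<lambda>x. f' x v)"
  shows "Ck_on (Suc k) S f"
proof -
  have "frechet_derivative f (at x) = f' x" if "x \<in> S" for x
    using assms(2)[OF that] by (metis frechet_derivative_at)
  then have "Ck_on k S (\<lambda>x. frechet_derivative f (at x) v)" for v
    using Ck_on_cong[OF assms(1), of "\<lambda>x. frechet_derivative f (at x) v" "\<lambda>x. f' x v"] assms(3) by simp
  then show ?thesis using assms(2) by (auto simp: differentiable_def)
qed

lemma Ck_on_Suc_derivative:
  assumes "Ck_on (Suc k) S f" "x \<in> S"
  shows "(f has_derivative frechet_derivative f (at x)) (at x)"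
  using assms by (auto simp: frechet_derivative_works)

lemma Ck_on_Suc_imp: "Ck_on (Suc k) S f \<Longrightarrow> Ck_on k S f"
proof (induction k arbitrary: f)
  case 0
  then show ?case
    by (auto intro!: continuous_at_imp_continuous_on differentiable_imp_continuous_within)
next
  case (Suc k)
  then show ?case by (auto simp: Ck_on.simps(2)[of _ S f] simp del: Ck_on.simps)
qed

lemma Ck_on_mono: "Ck_on k S f \<Longrightarrow> j \<le> k \<Longrightarrow> Ck_on j S f"
  by (induction k) (auto simp: le_Suc_eq dest: Ck_on_Suc_imp simp del: Ck_on.simps)

lemma Ck_on_subset: "Ck_on k S f \<Longrightarrow> T \<subseteq> S \<Longrightarrow> Ck_on k T f"
proof (induction k arbitrary: f)
  case 0
  then show ?case using continuous_on_subset by auto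
next
  case (Suc k)
  then show ?case by auto
qed

lemma Ck_on_const: "open S \<Longrightarrow> Ck_on k S (\<lambda>x. c)"
proof (induction k arbitrary: c)
  case (Suc k)
  show ?case by (rule Ck_on_SucI[where f'="\<lambda>x v. 0"]) (use Suc in auto)
qed simp

lemma Ck_on_bounded_linear:
  assumes "bounded_linear L" "open S" shows "Ck_on k S L"
proof (cases k)
  case 0
  then show ?thesis using assms by (simp add: linear_continuous_on)
next
  case (Suc j)
  show ?thesis unfolding Suc
    by (rule Ck_on_SucI[where f'="\<lambda>x. L"])
       (use assms in \<open>auto intro: Ck_on_const bounded_linear_imp_has_derivative\<close>)
qed

lemma Ck_on_bounded_linear_comp:
  assumes "bounded_linear L" "open S" "Ck_on k S f" shows "Ck_on k S (\<lambda>x. L (f x))"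
  using assms(3)
proof (induction k arbitrary: f)
  case 0
  then show ?case using assms(1) by (auto intro: bounded_linear.continuous_on)
next
  case (Suc k)
  show ?case
  proof (rule Ck_on_SucI[where f'="\<lambda>x v. L (frechet_derivative f (at x) v)"])
    show "((\<lambda>x. L (f x)) has_derivative (\<lambda>v. L (frechet_derivative f (at x) v))) (at x)" if "x \<in> S" for x
      by (rule bounded_linear.has_derivative[OF assms(1) Ck_on_Suc_derivative[OF Suc.prems that]])
    show "Ck_on k S (\<lambda>x. L (frechet_derivative f (at x) v))" for v
      using Suc by auto
  qed fact
qed

lemma Ck_on_add:
  assumes "open S" "Ck_on k S f" "Ck_on k S g" shows "Ck_on k S (\<lambda>x. f x + g x)"
  using assms(2,3)
proof (induction k arbitrary: f g)
  case 0
  then show ?case by (auto intro: continuous_on_add)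
next
  case (Suc k)
  show ?case
  proof (rule Ck_on_SucI[where f'="\<lambda>x v. frechet_derivative f (at x) v + frechet_derivative g (at x) v"])
    show "((\<lambda>x. f x + g x) has_derivative (\<lambda>v. frechet_derivative f (at x) v + frechet_derivative g (at x) v)) (at x)"
      if "x \<in> S" for x
      by (intro has_derivative_add Ck_on_Suc_derivative[OF _ that]) (use Suc in auto)
    show "Ck_on k S (\<lambda>x. frechet_derivative f (at x) v + frechet_derivative g (at x) v)" for v
      using Suc by auto
  qed fact
qed

lemma Ck_on_bilinear:
  assumes "bounded_bilinear h" "open S" "Ck_on k S f" "Ck_on k S g"
  shows "Ck_on k S (\<lambda>x. h (f x) (g x))"
  using assms(3,4)
proof (induction k arbitrary: f g)
  case 0
  then show ?case using assms(1) by (auto intro: bounded_bilinear.continuous_on)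
next
  case (Suc k)
  show ?case
  proof (rule Ck_on_SucI[where f'="\<lambda>x v. h (f x) (frechet_derivative g (at x) v) + h (frechet_derivative f (at x) v) (g x)"])
    show "((\<lambda>x. h (f x) (g x)) has_derivative (\<lambda>v. h (f x) (frechet_derivative g (at x) v) + h (frechet_derivative f (at x) v) (g x))) (at x)"
      if "x \<in> S" for x
      by (intro bounded_bilinear.FDERIV[OF assms(1)] Ck_on_Suc_derivative[OF _ that]) (use Suc in auto)
    show "Ck_on k S (\<lambda>x. h (f x) (frechet_derivative g (at x) v) + h (frechet_derivative f (at x) v) (g x))" for v
      using Suc.prems Ck_on_Suc_imp[OF Suc.prems(1)] Ck_on_Suc_imp[OF Suc.prems(2)]
      by (intro Ck_on_add assms Suc.IH) auto
  qed fact
qed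

lemmas Ck_on_scaleR = Ck_on_bilinear[OF bounded_bilinear_scaleR]
lemmas Ck_on_inner = Ck_on_bilinear[OF bounded_bilinear_inner]
lemmas Ck_on_mult = Ck_on_bilinear[OF bounded_bilinear_mult]

lemma Ck_on_sum:
  assumes "open S" "\<And>i. i \<in> I \<Longrightarrow> Ck_on k S (f i)" shows "Ck_on k S (\<lambda>x. \<Sum>i\<in>I. f i x)"
  using assms(2)
  by (induction I rule: infinite_finite_induct) (auto intro: Ck_on_const[OF assms(1)] Ck_on_add[OF assms(1)])

lemma Ck_on_Pair:
  assumes "open S" "Ck_on k S f" "Ck_on k S g" shows "Ck_on k S (\<lambda>x. (f x, g x))"
proof -
  have "Ck_on k S (\<lambda>x. (f x, 0) + (0, g x))"
    by (intro Ck_on_add assms Ck_on_bounded_linear_comp[of "\<lambda>y. (y, 0)"] Ck_on_bounded_linear_comp[of "\<lambda>y. (0, y)"])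
       (auto intro!: bounded_linear_intros)
  then show ?thesis by simp
qed

lemma linear_euclidean_expand:
  fixes f :: "'a::euclidean_space \<Rightarrow> 'b::real_vector"
  assumes "linear f"
  shows "f v = (\<Sum>b\<in>Basis. (v \<bullet> b) *\<^sub>R f b)"
  by (subst euclidean_representation[of v, symmetric])
     (simp only: linear_sum[OF assms] linear_scale[OF assms])

text \<open>\<open>Ck_on\<close> controls derivatives in a fixed direction only, whereas the chain
  rule produces derivatives applied to a moving vector. Expanding that vector in
  \<open>Basis\<close> leaves a finite sum of products with fixed directions.\<close>

lemma Ck_on_linear_family:
  fixes A :: "'a::real_normed_vector \<Rightarrow> 'b::euclidean_space \<Rightarrow> 'c::real_normed_vector"
  assumes "open S" "\<And>x. x \<in> S \<Longrightarrow> linear (A x)" "\<And>v. Ck_on k S (\<lambda>x. A x v)" "Ck_on k S w"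
  shows "Ck_on k S (\<lambda>x. A x (w x))"
proof -
  have "Ck_on k S (\<lambda>x. \<Sum>b\<in>Basis. (w x \<bullet> b) *\<^sub>R A x b)"
    by (intro Ck_on_sum Ck_on_scaleR Ck_on_inner Ck_on_const assms)
  then show ?thesis
    using Ck_on_cong[OF assms(1), of "\<lambda>x. A x (w x)" "\<lambda>x. \<Sum>b\<in>Basis. (w x \<bullet> b) *\<^sub>R A x b"]
      linear_euclidean_expand[OF assms(2)] by blast
qed

text \<open>The derivative of a composition contains derivatives of \<open>g\<close> composed with
  the same \<open>f\<close>, so the induction generalizes over \<open>g\<close> and keeps
  \<open>f\<close>.\<close>

lemma Ck_on_compose:
  fixes f :: "'a::real_normed_vector \<Rightarrow> 'b::euclidean_space" and g :: "'b \<Rightarrow> 'c::real_normed_vector"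
  assumes "open S" "open T" "Ck_on k S f" "Ck_on k T g" "\<And>x. x \<in> S \<Longrightarrow> f x \<in> T"
  shows "Ck_on k S (\<lambda>x. g (f x))"
  using assms(3,4)
proof (induction k arbitrary: g)
  case 0
  then show ?case using assms(5) by (auto intro: continuous_on_compose2)
next
  case (Suc k)
  note g' = Ck_on_Suc_derivative[OF Suc.prems(2) assms(5)]
  note f' = Ck_on_Suc_derivative[OF Suc.prems(1)]
  show ?case
  proof (rule Ck_on_SucI[where f'="\<lambda>x v. frechet_derivative g (at (f x)) (frechet_derivative f (at x) v)"])
    show "((\<lambda>x. g (f x)) has_derivative (\<lambda>v. frechet_derivative g (at (f x)) (frechet_derivative f (at x) v))) (at x)"
      if "x \<in> S" for x
      using has_derivative_compose[OF f'[OF that] g'[OF that]] .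
    show "Ck_on k S (\<lambda>x. frechet_derivative g (at (f x)) (frechet_derivative f (at x) v))" for v
      apply (rule Ck_on_linear_family[OF \<open>open S\<close>])
      subgoal for x using g'[of x] has_derivative_linear by blast
      subgoal for w using Suc.IH[of "\<lambda>y. frechet_derivative g (at y) w"] Suc.prems Ck_on_Suc_imp by auto
      subgoal using Suc.prems by auto
      done
  qed fact
qed

lemma Ck_on_inverse: "Ck_on k (- {0}) (inverse :: real \<Rightarrow> real)"
proof (induction k)
  case 0
  then show ?case by (auto intro: continuous_on_inverse)
next
  case (Suc k)
  show ?case
    by (rule Ck_on_SucI[where f'="\<lambda>x v. - (inverse x * v * inverse x)"])
       (auto intro!: has_derivative_inverse' Ck_on_mult Suc Ck_on_const Ck_on_bounded_linear_comp[of uminus]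
         bounded_linear_minus bounded_linear_ident simp: open_Compl)
qed

section \<open>Smooth maps: the closure rules for all orders at once\<close>

lemma smooth_on_cong:
  assumes "open S" "\<And>x. x \<in> S \<Longrightarrow> f x = g x"
  shows "smooth_on S f \<longleftrightarrow> smooth_on S g"
  using Ck_on_cong[OF assms] by (auto simp: smooth_on_def)

lemma smooth_on_subset: "smooth_on S f \<Longrightarrow> T \<subseteq> S \<Longrightarrow> smooth_on T f"
  unfolding smooth_on_def using Ck_on_subset by blast

lemma smooth_on_const: "open S \<Longrightarrow> smooth_on S (\<lambda>x. c)"
  by (simp add: smooth_on_def Ck_on_const)

lemma smooth_on_bounded_linear: "bounded_linear L \<Longrightarrow> open S \<Longrightarrow> smooth_on S L"
  by (simp add: smooth_on_def Ck_on_bounded_linear)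

lemmas smooth_on_ident = smooth_on_bounded_linear[OF bounded_linear_ident]
lemmas smooth_on_fst = smooth_on_bounded_linear[OF bounded_linear_fst]
lemmas smooth_on_snd = smooth_on_bounded_linear[OF bounded_linear_snd]

lemma smooth_on_bounded_linear_comp:
  "bounded_linear L \<Longrightarrow> open S \<Longrightarrow> smooth_on S f \<Longrightarrow> smooth_on S (\<lambda>x. L (f x))"
  by (simp add: smooth_on_def Ck_on_bounded_linear_comp)

lemmas smooth_on_minus = smooth_on_bounded_linear_comp[OF bounded_linear_minus[OF bounded_linear_ident]]

lemma smooth_on_add: "open S \<Longrightarrow> smooth_on S f \<Longrightarrow> smooth_on S g \<Longrightarrow> smooth_on S (\<lambda>x. f x + g x)"
  by (simp add: smooth_on_def Ck_on_add)

lemma smooth_on_diff: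
  assumes "open S" "smooth_on S f" "smooth_on S g" shows "smooth_on S (\<lambda>x. f x - g x)"
  using smooth_on_add[OF assms(1,2) smooth_on_minus[OF assms(1,3)]] by simp

lemma smooth_on_bilinear:
  "bounded_bilinear h \<Longrightarrow> open S \<Longrightarrow> smooth_on S f \<Longrightarrow> smooth_on S g \<Longrightarrow> smooth_on S (\<lambda>x. h (f x) (g x))"
  by (simp add: smooth_on_def Ck_on_bilinear)

lemmas smooth_on_scaleR = smooth_on_bilinear[OF bounded_bilinear_scaleR]
lemmas smooth_on_inner = smooth_on_bilinear[OF bounded_bilinear_inner]
lemmas smooth_on_mult = smooth_on_bilinear[OF bounded_bilinear_mult]

lemma smooth_on_sum:
  "open S \<Longrightarrow> (\<And>i. i \<in> I \<Longrightarrow> smooth_on S (f i)) \<Longrightarrow> smooth_on S (\<lambda>x. \<Sum>i\<in>I. f i x)"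
  by (simp add: smooth_on_def Ck_on_sum)

lemma smooth_on_Pair:
  "open S \<Longrightarrow> smooth_on S f \<Longrightarrow> smooth_on S g \<Longrightarrow> smooth_on S (\<lambda>x. (f x, g x))"
  by (simp add: smooth_on_def Ck_on_Pair)

lemma smooth_on_compose:
  fixes f :: "'a::real_normed_vector \<Rightarrow> 'b::euclidean_space" and g :: "'b \<Rightarrow> 'c::real_normed_vector"
  assumes "open S" "open T" "smooth_on S f" "smooth_on T g" "\<And>x. x \<in> S \<Longrightarrow> f x \<in> T"
  shows "smooth_on S (\<lambda>x. g (f x))"
  using assms unfolding smooth_on_def by (blast intro: Ck_on_compose)

lemma smooth_on_inverse:
  fixes f :: "'a::real_normed_vector \<Rightarrow> real"
  assumes "open S" "smooth_on S f" "\<And>x. x \<in> S \<Longrightarrow> f x \<noteq> 0"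
  shows "smooth_on S (\<lambda>x. inverse (f x))"
  using assms smooth_on_compose[of S "- {0}" f inverse] Ck_on_inverse by (auto simp: smooth_on_def open_Compl)

lemma smooth_on_power2:
  fixes f :: "'a::real_normed_vector \<Rightarrow> real"
  assumes "open S" "smooth_on S f" shows "smooth_on S (\<lambda>x. (f x)\<^sup>2)"
  using smooth_on_mult[OF assms assms(2)] by (simp add: power2_eq_square)

lemma smooth_on_has_derivative:
  "smooth_on S f \<Longrightarrow> x \<in> S \<Longrightarrow> (f has_derivative frechet_derivative f (at x)) (at x)"
  by (meson Ck_on_Suc_derivative smooth_on_def)

lemma smooth_on_differentiable: "smooth_on S f \<Longrightarrow> x \<in> S \<Longrightarrow> f differentiable (at x)"
  using smooth_on_has_derivative differentiable_def by blast

lemma smooth_on_continuous_on: "smooth_on S f \<Longrightarrow> continuous_on S f"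
  by (metis Ck_on.simps(1) smooth_on_def)

lemma smooth_on_linear_family:
  fixes A :: "'a::real_normed_vector \<Rightarrow> 'b::euclidean_space \<Rightarrow> 'c::real_normed_vector"
  assumes "open S" "\<And>x. x \<in> S \<Longrightarrow> linear (A x)" "\<And>v. smooth_on S (\<lambda>x. A x v)" "smooth_on S w"
  shows "smooth_on S (\<lambda>x. A x (w x))"
  using assms Ck_on_linear_family[OF assms(1,2)] by (auto simp: smooth_on_def)

lemma smooth_on_frechet_derivative:
  "smooth_on S f \<Longrightarrow> smooth_on S (\<lambda>x. frechet_derivative f (at x) v)"
  unfolding smooth_on_def using Ck_on.simps(2) by blast

lemma linear_frechet_derivative: "f differentiable (at x) \<Longrightarrow> linear (frechet_derivative f (at x))"
  using frechet_derivative_works has_derivative_linear by blast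

lemma smooth_on_derivative_comp:
  fixes f :: "'b::euclidean_space \<Rightarrow> 'c::real_normed_vector" and h w :: "'a::real_normed_vector \<Rightarrow> 'b"
  assumes "open S" "open T" "smooth_on T f" "smooth_on S h" "smooth_on S w" "\<And>x. x \<in> S \<Longrightarrow> h x \<in> T"
  shows "smooth_on S (\<lambda>x. frechet_derivative f (at (h x)) (w x))"
proof (rule smooth_on_linear_family[OF assms(1) _ _ assms(5)])
  show "linear (frechet_derivative f (at (h x)))" if "x \<in> S" for x
    using linear_frechet_derivative smooth_on_differentiable assms(3,6) that by blast
  show "smooth_on S (\<lambda>x. frechet_derivative f (at (h x)) v)" for v
    by (rule smooth_on_compose[OF assms(1,2,4) smooth_on_frechet_derivative[OF assms(3)] assms(6)])
qed

section \<open>The inverse function theorem for smooth maps\<close>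

lemma C1_blinfun_derivative:
  fixes f :: "'a::euclidean_space \<Rightarrow> 'b::real_normed_vector"
  assumes "Ck_on (Suc 0) S f"
  obtains f' :: "'a \<Rightarrow> 'a \<Rightarrow>\<^sub>L 'b"
  where "\<And>x. x \<in> S \<Longrightarrow> (f has_derivative blinfun_apply (f' x)) (at x)" "continuous_on S f'"
    "\<And>x. x \<in> S \<Longrightarrow> blinfun_apply (f' x) = frechet_derivative f (at x)"
proof -
  define f' where "f' = (\<lambda>x. Blinfun (frechet_derivative f (at x)))"
  have f'_apply: "blinfun_apply (f' x) = frechet_derivative f (at x)" if "x \<in> S" for x
    unfolding f'_def using Ck_on_Suc_derivative[OF assms that]
    by (simp add: bounded_linear_Blinfun_apply has_derivative_bounded_linear)
  show ?thesis
  proof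
    show "(f has_derivative blinfun_apply (f' x)) (at x)" if "x \<in> S" for x
      using Ck_on_Suc_derivative[OF assms that] f'_apply[OF that] by simp
    \<comment> \<open>In finite dimension, continuity in every fixed direction gives continuity in
      operator norm, which is the form required by the inverse function theorem and by the
      compactness arguments for differential equations.\<close>
    have "continuous_on S (\<lambda>x. frechet_derivative f (at x) v)" for v
      using assms by simp
    then have "continuous_on S (\<lambda>x. blinfun_apply (f' x) v)" for v
      by (rule continuous_on_eq) (simp add: f'_apply)
    then show "continuous_on S f'"
      by (intro continuous_on_blinfun_componentwise)
    show "\<And>x. x \<in> S \<Longrightarrow> blinfun_apply (f' x) = frechet_derivative f (at x)" by (rule f'_apply)
  qed
qed

text \<open>A product rule at a zero of one factor: there the increment of \<open>c\<close> is
  multiplied by something small, so continuity of \<open>c\<close> replaces its differentiability.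
  It serves where the derivative of the second factor is itself what is being established.\<close>

lemma has_derivative_scaleR_zero:
  fixes c :: "'a::real_normed_vector \<Rightarrow> 'b::real_normed_vector"
  assumes "(\<phi> has_derivative \<phi>') (at y)" "\<phi> y = 0" "isCont c y"
  shows "((\<lambda>y'. \<phi> y' *\<^sub>R c y') has_derivative (\<lambda>w. \<phi>' w *\<^sub>R c y)) (at y)"
proof -
  have bl: "bounded_linear \<phi>'" using assms(1) by (rule has_derivative_bounded_linear)
  obtain K where K: "K > 0" "\<And>h. \<bar>\<phi>' h\<bar> \<le> norm h * K" using bounded_linear.pos_bounded[OF bl] by auto
  have lim: "((\<lambda>h. (\<phi> (y + h) - \<phi>' h) /\<^sub>R norm h) \<longlongrightarrow> 0) (at 0)"
    by (rule tendsto_norm_zero_cancel)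
       (use assms(1,2) in \<open>simp add: has_derivative_at divide_inverse_commute abs_mult\<close>)
  have c: "((\<lambda>h. c (y + h)) \<longlongrightarrow> c y) (at 0)"
    using assms(3) by (simp add: isCont_iff)
  \<comment> \<open>The quotient splits into the linearization error of \<open>\<phi>\<close> times
    \<open>c (y + h)\<close>, treated here, and the bounded quotient
    \<open>\<phi>' h / norm h\<close> times the increment of \<open>c\<close>, treated in
    \<open>2\<close>.\<close>
  have 1: "((\<lambda>h. ((\<phi> (y + h) - \<phi>' h) /\<^sub>R norm h) *\<^sub>R c (y + h)) \<longlongrightarrow> 0) (at 0)"
    using tendsto_scaleR[OF lim c] by simp
  have 2: "((\<lambda>h. (\<phi>' h /\<^sub>R norm h) *\<^sub>R (c (y + h) - c y)) \<longlongrightarrow> 0) (at 0)"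
  proof (rule Lim_null_comparison)
    show "\<forall>\<^sub>F h in at 0. norm ((\<phi>' h /\<^sub>R norm h) *\<^sub>R (c (y + h) - c y)) \<le> K * norm (c (y + h) - c y)"
    proof (rule always_eventually, rule allI)
      fix h
      have "norm (\<phi>' h /\<^sub>R norm h) \<le> K"
        using K(1) K(2)[of h] by (cases "h = 0") (auto simp: divide_simps mult.commute)
      then show "norm ((\<phi>' h /\<^sub>R norm h) *\<^sub>R (c (y + h) - c y)) \<le> K * norm (c (y + h) - c y)"
        unfolding norm_scaleR[of "\<phi>' h /\<^sub>R norm h"] by (intro mult_right_mono) auto
    qed
    show "((\<lambda>h. K * norm (c (y + h) - c y)) \<longlongrightarrow> 0) (at 0)"
      using tendsto_mult_right_zero[OF tendsto_norm_zero[OF Lim_null[THEN iffD1, OF c]]] by simp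
  qed
  have "((\<lambda>h. ((\<phi> (y + h) *\<^sub>R c (y + h)) - \<phi>' h *\<^sub>R c y) /\<^sub>R norm h) \<longlongrightarrow> 0) (at 0)"
    using tendsto_add[OF 1 2] by (simp add: scaleR_right_diff_distrib scaleR_left_diff_distrib right_diff_distrib left_diff_distrib mult.commute)
  then show ?thesis
    unfolding has_derivative_at
    using bounded_linear_compose[OF bounded_linear_scaleR_left bl, of "c y"] assms(2)
    by (auto dest: tendsto_norm_zero simp: divide_inverse_commute)
qed

lemma linear_blinfun_apply: "linear (blinfun_apply A)"
  by (simp add: blinfun.bounded_linear_right bounded_linear.linear)

text \<open>The derivative of the inverse satisfies \<open>g' y' v - g' y v = - g' y' (A y' u - A y u)\<close> for
  \<open>A = f' \<circ> g\<close> and \<open>u = g' y v\<close>, which gives first its continuity and then its derivatives.\<close>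

theorem smooth_inverse_function:
  fixes f :: "'a::euclidean_space \<Rightarrow> 'a"
  assumes "open U" and sm: "smooth_on U f" and "x0 \<in> U"
    and inj: "\<And>v. frechet_derivative f (at x0) v = 0 \<Longrightarrow> v = 0"
  obtains U' V g where "open U'" "U' \<subseteq> U" "x0 \<in> U'" "open V" "f x0 \<in> V" "homeomorphism U' V f g"
    "smooth_on V g" "\<And>y v. y \<in> V \<Longrightarrow> frechet_derivative f (at (g y)) (frechet_derivative g (at y) v) = v"
proof -
  have "Ck_on (Suc 0) U f" using sm by (simp add: smooth_on_def del: Ck_on.simps)
  then obtain f' :: "'a \<Rightarrow> 'a \<Rightarrow>\<^sub>L 'a" where f': "\<And>x. x \<in> U \<Longrightarrow> (f has_derivative blinfun_apply (f' x)) (at x)"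
    "continuous_on U f'" "\<And>x. x \<in> U \<Longrightarrow> blinfun_apply (f' x) = frechet_derivative f (at x)"
    by (rule C1_blinfun_derivative) blast
  have "inj (blinfun_apply (f' x0))"
    using inj f'(3)[OF \<open>x0 \<in> U\<close>] by (metis linear_injective_0 linear_blinfun_apply)
  then obtain h where h: "linear h" "h \<circ> blinfun_apply (f' x0) = id"
    using linear_injective_left_inverse[of "blinfun_apply (f' x0)"] linear_blinfun_apply by blast
  have "blinfun_apply (Blinfun h) = h"
    using h(1) by (simp add: bounded_linear_Blinfun_apply linear_conv_bounded_linear)
  then have "Blinfun h o\<^sub>L f' x0 = id_blinfun"
    using h(2) by (intro blinfun_eqI) (simp add: o_def id_def fun_eq_iff)
  from inverse_function_theorem[OF \<open>open U\<close> f'(1,2) \<open>x0 \<in> U\<close> this]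
  obtain U' V g g' where U': "open U'" "U' \<subseteq> U" "x0 \<in> U'" "open V" "f x0 \<in> V" "homeomorphism U' V f g"
    and g: "\<And>y. y \<in> V \<Longrightarrow> (g has_derivative g' y) (at y)"
    and g': "\<And>y. y \<in> V \<Longrightarrow> g' y = inv (blinfun_apply (f'(g y)))"
    and bij: "\<And>y. y \<in> V \<Longrightarrow> bij (blinfun_apply (f'(g y)))"
    by blast
  define A where "A = (\<lambda>y. f' (g y))"
  have gU: "g y \<in> U" if "y \<in> V" for y
    using U' that unfolding homeomorphism_def by blast
  have contg: "continuous_on V g" using U'(6) by (simp add: homeomorphism_def)
  have AB: "blinfun_apply (A y) (g' y v) = v" if "y \<in> V" for y v
    using g'[OF that] bij[OF that] unfolding A_def by (simp add: bij_is_surj surj_f_inv_f)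
  have BA: "g' y (blinfun_apply (A y) v) = v" if "y \<in> V" for y v
    using g'[OF that] bij[OF that] unfolding A_def by (simp add: bij_is_inj)
  have ling': "linear (g' y)" if "y \<in> V" for y
    using g[OF that] has_derivative_linear by blast
  have key: "g' y' v = g' y v - g' y' (A y' (g' y v) - A y (g' y v))" if "y \<in> V" "y' \<in> V" for y y' v
    using AB[OF that(1)] BA[OF that(2)] by (simp add: linear_diff[OF ling'[OF that(2)]])
  have contA: "continuous_on V A"
    unfolding A_def using f'(2) contg gU by (auto intro: continuous_on_compose2)
  have cont: "isCont (\<lambda>y. g' y v) y" if y: "y \<in> V" for y v
  proof -
    obtain K where K: "K > 0" "\<And>v. norm (g' y v) \<le> norm v * K"
      using bounded_linear.pos_bounded[OF has_derivative_bounded_linear[OF g[OF y]]] by auto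
    have isA: "isCont A y" using contA y \<open>open V\<close> by (simp add: continuous_on_eq_continuous_at)
    then obtain d where d: "d > 0" "\<And>y'. dist y' y < d \<Longrightarrow> dist (A y') (A y) < 1 / (2*K)"
      using K(1) unfolding continuous_at_eps_delta by (metis divide_pos_pos mult_pos_pos zero_less_numeral zero_less_one)
    \<comment> \<open>Since \<open>K\<close> bounds \<open>g' y\<close>, moving \<open>A\<close> by
      less than \<open>1 / (2*K)\<close> costs at most half of \<open>norm z\<close>. That half is
      absorbed on the left, so \<open>2 * K\<close> bounds the inverses near
      \<open>y\<close>.\<close>
    have bnd: "norm (g' y' w) \<le> 2 * K * norm w" if y': "y' \<in> V" "dist y' y < d" for y' w
    proof -
      define z where "z = g' y' w"
      have w: "w = A y' z" using AB y' z_def by simp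
      have "norm z = norm (g' y (A y z))" using BA[OF y] by simp
      also have "\<dots> \<le> norm (A y z) * K" by (rule K)
      also have "\<dots> \<le> (norm (A y' z) + norm ((A y' - A y) z)) * K"
        using norm_triangle_sub[of "A y z" "A y' z"] K(1)
        by (intro mult_right_mono) (auto simp: blinfun.diff_left norm_minus_commute)
      also have "\<dots> \<le> (norm w + (1 / (2*K)) * norm z) * K"
        using d(2)[OF y'(2)] K(1) unfolding w
        by (intro mult_right_mono add_left_mono order_trans[OF norm_blinfun]) (auto simp: dist_norm intro!: mult_right_mono)
      also have "\<dots> = norm w * K + norm z / 2" using K(1) by (simp add: field_simps)
      finally have "norm z \<le> 2 * (K * norm w)" by (simp add: mult.commute)
      then show ?thesis unfolding z_def by (simp add: mult.assoc)
    qed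
    have "((\<lambda>y'. 2 * K * norm (A y' (g' y v) - A y (g' y v))) \<longlongrightarrow> 2 * K * norm (A y (g' y v) - A y (g' y v))) (at y)"
      using isA by (intro tendsto_intros) (auto simp: isCont_def intro!: tendsto_intros)
    then have lim: "((\<lambda>y'. 2 * K * norm (A y' (g' y v) - A y (g' y v))) \<longlongrightarrow> 0) (at y)" by simp
    have "((\<lambda>y'. g' y' v - g' y v) \<longlongrightarrow> 0) (at y)"
    proof (rule Lim_null_comparison[OF _ lim])
      have "\<forall>\<^sub>F y' in at y. y' \<in> V \<and> dist y' y < d"
        using eventually_at_in_open'[OF \<open>open V\<close> y] eventually_at[of "\<lambda>y'. dist y' y < d" y UNIV] d(1)
        by (auto simp: eventually_conj_iff)
      then show "\<forall>\<^sub>F y' in at y. norm (g' y' v - g' y v) \<le> 2 * K * norm (A y' (g' y v) - A y (g' y v))"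
      proof (rule eventually_mono)
        fix y' assume y': "y' \<in> V \<and> dist y' y < d"
        have "g' y' v - g' y v = - g' y' (A y' (g' y v) - A y (g' y v))"
          using key[OF y, of y' v] y' by (simp add: algebra_simps)
        then show "norm (g' y' v - g' y v) \<le> 2 * K * norm (A y' (g' y v) - A y (g' y v))"
          using bnd[of y'] y' by (simp only: norm_minus_cancel)
      qed
    qed
    then show ?thesis by (simp add: isCont_def Lim_null[symmetric])
  qed
  define A' where "A' = (\<lambda>y u w. frechet_derivative (\<lambda>x. frechet_derivative f (at x) u) (at (g y)) (g' y w))"
  have derA: "((\<lambda>y. A y u) has_derivative A' y u) (at y)" if "y \<in> V" for y u
  proof -
    have "((\<lambda>y. frechet_derivative f (at (g y)) u) has_derivative A' y u) (at y)"
      unfolding A'_def using has_derivative_compose[OF g[OF that]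
        smooth_on_has_derivative[OF smooth_on_frechet_derivative[OF sm] gU[OF that]]] .
    then show ?thesis
      by (rule has_derivative_transform_within_open[OF _ \<open>open V\<close> that]) (simp add: A_def f'(3) gU)
  qed
  have derB: "((\<lambda>y. g' y v) has_derivative (\<lambda>w. - g' y (A' y (g' y v) w))) (at y)" if y: "y \<in> V" for y v
  proof -
    let ?u = "g' y v"
    \<comment> \<open>In \<open>key\<close> the coefficients \<open>A y' u - A y u\<close> vanish at
      \<open>y' = y\<close>, so knowing \<open>g' y' b\<close> to be continuous in \<open>y'\<close>
      is enough to differentiate the product.\<close>
    have 1: "((\<lambda>y'. \<Sum>b\<in>Basis. ((A y' ?u - A y ?u) \<bullet> b) *\<^sub>R g' y' b) has_derivative
        (\<lambda>w. \<Sum>b\<in>Basis. (A' y ?u w \<bullet> b) *\<^sub>R g' y b)) (at y)"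
      by (intro has_derivative_sum has_derivative_scaleR_zero cont y)
         (auto intro!: derivative_eq_intros derA[OF y, THEN has_derivative_eq_rhs])
    have 2: "((\<lambda>y'. g' y v - (\<Sum>b\<in>Basis. ((A y' ?u - A y ?u) \<bullet> b) *\<^sub>R g' y' b)) has_derivative
        (\<lambda>w. 0 - (\<Sum>b\<in>Basis. (A' y ?u w \<bullet> b) *\<^sub>R g' y b))) (at y)"
      by (intro has_derivative_diff 1 has_derivative_const)
    have "((\<lambda>y'. g' y' v) has_derivative (\<lambda>w. 0 - (\<Sum>b\<in>Basis. (A' y ?u w \<bullet> b) *\<^sub>R g' y b))) (at y)"
    proof (rule has_derivative_transform_within_open[OF 2 \<open>open V\<close> y])
      fix y' assume y': "y' \<in> V"
      show "g' y v - (\<Sum>b\<in>Basis. ((A y' ?u - A y ?u) \<bullet> b) *\<^sub>R g' y' b) = g' y' v"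
        unfolding linear_euclidean_expand[OF ling'[OF y'], of "A y' ?u - A y ?u", symmetric]
        by (rule key[OF y y', symmetric])
    qed
    moreover have "(\<lambda>w. 0 - (\<Sum>b\<in>Basis. (A' y ?u w \<bullet> b) *\<^sub>R g' y b)) = (\<lambda>w. - g' y (A' y ?u w))"
    proof
      show "0 - (\<Sum>b\<in>Basis. (A' y ?u w \<bullet> b) *\<^sub>R g' y b) = - g' y (A' y ?u w)" for w
        unfolding linear_euclidean_expand[OF ling'[OF y], of "A' y ?u w", symmetric] by simp
    qed
    ultimately show ?thesis by simp
  qed
  \<comment> \<open>The two claims are raised together: the derivative of \<open>g\<close> is
    \<open>g'\<close>, and that of \<open>g'\<close> is built from \<open>g'\<close> and from second
    derivatives of \<open>f\<close> at \<open>g y\<close>, all of which already have order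
    \<open>k\<close>.\<close>
  have Ck: "Ck_on k V g \<and> (\<forall>v. Ck_on k V (\<lambda>y. g' y v))" for k
  proof (induction k)
    case 0
    then show ?case using contg cont by (auto intro: continuous_at_imp_continuous_on)
  next
    case (Suc k)
    have "Ck_on (Suc k) V g"
      by (rule Ck_on_SucI[OF \<open>open V\<close> g]) (use Suc in auto)
    moreover have "Ck_on (Suc k) V (\<lambda>y. g' y v)" for v
    proof (rule Ck_on_SucI[OF \<open>open V\<close> derB])
      fix w
      have CA: "Ck_on k V (\<lambda>y. A' y u w)" for u
        unfolding A'_def
      proof (rule Ck_on_linear_family[where A="\<lambda>y. frechet_derivative (\<lambda>x. frechet_derivative f (at x) u) (at (g y))", OF \<open>open V\<close>])
        show "linear (frechet_derivative (\<lambda>x. frechet_derivative f (at x) u) (at (g y)))" if "y \<in> V" for y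
          by (intro linear_frechet_derivative smooth_on_differentiable[OF smooth_on_frechet_derivative[OF sm] gU[OF that]])
        show "Ck_on k V (\<lambda>y. frechet_derivative (\<lambda>x. frechet_derivative f (at x) u) (at (g y)) v)" for v
          by (rule Ck_on_compose[OF \<open>open V\<close> \<open>open U\<close>])
             (use Suc gU smooth_on_frechet_derivative[OF smooth_on_frechet_derivative[OF sm]] in \<open>auto simp: smooth_on_def\<close>)
      qed (use Suc in auto)
      \<comment> \<open>Linearity in the slot that is differentiated second is read off from
        uniqueness of the derivative of \<open>A y (u1 + u2)\<close> and of
        \<open>A y (r *\<^sub>R u)\<close>.\<close>
      have LA: "linear (\<lambda>u. A' y u w)" if "y \<in> V" for y
      proof (rule linearI)
        note D = smooth_on_differentiable[OF smooth_on_frechet_derivative[OF sm] gU[OF that]]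
        have L: "linear (\<lambda>v. A y v)" for y by (simp add: linear_blinfun_apply)
        show "A' y (u1 + u2) w = A' y u1 w + A' y u2 w" for u1 u2
        proof -
          have "((\<lambda>y. A y (u1 + u2)) has_derivative (\<lambda>w. A' y u1 w + A' y u2 w)) (at y)"
            unfolding blinfun.add_right by (intro has_derivative_add derA that)
          from has_derivative_unique[OF derA[OF that] this] show ?thesis by simp
        qed
        show "A' y (r *\<^sub>R u) w = r *\<^sub>R A' y u w" for r u
        proof -
          have "((\<lambda>y. A y (r *\<^sub>R u)) has_derivative (\<lambda>w. r *\<^sub>R A' y u w)) (at y)"
            unfolding blinfun.scaleR_right by (intro has_derivative_scaleR_right derA that)
          from has_derivative_unique[OF derA[OF that] this] show ?thesis by simp
        qed
      qed
      have "Ck_on k V (\<lambda>y. g' y v)" using Suc by blast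
      from Ck_on_linear_family[where A="\<lambda>y u. A' y u w", OF \<open>open V\<close> LA CA this]
      have "Ck_on k V (\<lambda>y. A' y (g' y v) w)" by simp
      from Ck_on_linear_family[where A=g', OF \<open>open V\<close> ling' _ this]
      have "Ck_on k V (\<lambda>y. g' y (A' y (g' y v) w))" using Suc by blast
      then show "Ck_on k V (\<lambda>y. - g' y (A' y (g' y v) w))"
        by (intro Ck_on_bounded_linear_comp[OF bounded_linear_minus[OF bounded_linear_ident] \<open>open V\<close>])
    qed
    ultimately show ?case by blast
  qed
  show ?thesis
  proof
    show "smooth_on V g" using Ck by (simp add: smooth_on_def)
    show "frechet_derivative f (at (g y)) (frechet_derivative g (at y) v) = v" if "y \<in> V" for y v
      using AB[OF that, of v] f'(3)[OF gU[OF that]] frechet_derivative_at[OF g[OF that]] by (simp add: A_def)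
  qed (use U' in auto)
qed

section \<open>Smooth dependence of solutions of differential equations\<close>

lemma has_vector_derivative_norm_bound:
  fixes u :: "real \<Rightarrow> 'a::real_normed_vector"
  assumes "\<And>t. \<bar>t\<bar> \<le> r \<Longrightarrow> (u has_vector_derivative u' t) (at t within {-r..r})"
    and "\<And>t. \<bar>t\<bar> \<le> r \<Longrightarrow> norm (u' t) \<le> B" and "\<bar>t\<bar> \<le> r"
  shows "norm (u t - u 0) \<le> B * \<bar>t\<bar>"
proof -
  have "norm (u t - u 0) \<le> B * norm (t - 0)"
  proof (rule differentiable_bound[of "{-r..r}" u "\<lambda>t h. h *\<^sub>R u' t"])
    show "(u has_derivative (\<lambda>h. h *\<^sub>R u' x)) (at x within {-r..r})" if "x \<in> {-r..r}" for x
      using assms(1)[of x] that by (simp add: has_vector_derivative_def abs_le_iff)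
    show "onorm (\<lambda>h. h *\<^sub>R u' x) \<le> B" if "x \<in> {-r..r}" for x
      using assms(2)[of x] that onorm_scaleR_left[of "\<lambda>h::real. h" "u' x"]
      by (simp add: onorm_id[where 'a=real, unfolded] bounded_linear_ident abs_le_iff)
  qed (use assms(3) in auto)
  then show ?thesis by simp
qed

text \<open>On short time intervals the maximum of a solution replaces Gronwall's lemma.\<close>

lemma short_time_bound:
  fixes u :: "real \<Rightarrow> 'a::real_normed_vector"
  assumes u: "\<And>t. \<bar>t\<bar> < T \<Longrightarrow> (u has_vector_derivative u' t) (at t)"
    and u': "\<And>t. \<bar>t\<bar> < T \<Longrightarrow> norm (u' t) \<le> L * norm (u t) + e"
    and L: "0 \<le> L" "L * T \<le> 3/4" and e: "0 \<le> e" and t: "\<bar>t\<bar> < T"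
  shows "norm (u t) \<le> 4 * (norm (u 0) + T * e)"
proof -
  define r where "r = \<bar>t\<bar>"
  have r: "0 \<le> r" "r < T" using t by (auto simp: r_def)
  have "continuous_on {-r..r} (\<lambda>t. norm (u t))"
    using u r by (intro continuous_on_norm continuous_at_imp_continuous_on ballI)
      (rule has_vector_derivative_continuous[OF u], auto)
  then obtain s where s: "s \<in> {-r..r}" "\<And>t. t \<in> {-r..r} \<Longrightarrow> norm (u t) \<le> norm (u s)"
    using continuous_attains_sup[of "{-r..r}" "\<lambda>t. norm (u t)"] r(1) by auto
  have "norm (u s - u 0) \<le> (L * norm (u s) + e) * \<bar>s\<bar>"
  proof (rule has_vector_derivative_norm_bound[where r=r])
    fix x assume "\<bar>x\<bar> \<le> r"
    then show "(u has_vector_derivative u' x) (at x within {- r..r})"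
      using u r(2) by (auto intro: has_vector_derivative_at_within)
    show "norm (u' x) \<le> L * norm (u s) + e"
      using u'[of x] s(2)[of x] \<open>\<bar>x\<bar> \<le> r\<close> r(2) mult_left_mono[OF _ L(1), of "norm (u x)" "norm (u s)"]
      by (auto simp: abs_le_iff)
  qed (use s in auto)
  also have "\<dots> \<le> (L * norm (u s) + e) * T"
    using s(1) r L(1) e by (intro mult_left_mono) auto
  also have "\<dots> \<le> 3/4 * norm (u s) + T * e"
    using mult_right_mono[OF L(2), of "norm (u s)"] by (simp add: algebra_simps)
  \<comment> \<open>Absorbing \<open>3/4 * norm (u s)\<close> leaves a quarter, hence the factor 4.
    The bound \<open>3/4\<close> instead of \<open>1/2\<close> leaves room for a small perturbation
    of the Lipschitz constant later.\<close>
  finally have "norm (u s) \<le> 4 * (norm (u 0) + T * e)"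
    using norm_triangle_sub[of "u s" "u 0"] by (simp add: algebra_simps)
  moreover have "norm (u t) \<le> norm (u s)" by (rule s(2)) (auto simp: r_def intro: minus_le_iff[THEN iffD1, OF abs_ge_minus_self])
  ultimately show ?thesis by simp
qed

text \<open>Picard iteration: \<open>B * T \<le> R\<close> keeps the iterates in the ball and
  \<open>L * T \<le> 1/2\<close> makes the integral operator a contraction. The fixed point is
  sought among bounded continuous functions on the whole line, a complete space.\<close>

lemma ode_solution:
  fixes f :: "real \<Rightarrow> 'a::euclidean_space \<Rightarrow> 'a"
  assumes T: "0 < T" and cont: "continuous_on ({-T..T} \<times> cball c R) (\<lambda>(t, y). f t y)"
    and lip: "\<And>t y z. \<bar>t\<bar> \<le> T \<Longrightarrow> y \<in> cball c R \<Longrightarrow> z \<in> cball c R \<Longrightarrow> norm (f t y - f t z) \<le> L * norm (y - z)"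
    and L: "0 \<le> L" "L * T \<le> 1/2"
    and B: "\<And>t y. \<bar>t\<bar> \<le> T \<Longrightarrow> y \<in> cball c R \<Longrightarrow> norm (f t y) \<le> B" and BT: "B * T \<le> R" and R0: "0 \<le> R"
  obtains y where "y 0 = c" "\<And>t. \<bar>t\<bar> < T \<Longrightarrow> (y has_vector_derivative f t (y t)) (at t)"
    "\<And>t. \<bar>t\<bar> < T \<Longrightarrow> y t \<in> cball c R"
proof -
  \<comment> \<open>The integral starts at \<open>-T\<close>, and \<open>\<Phi>\<close> subtracts
    its value at \<open>0\<close>; one antiderivative thus serves positive and negative
    times.\<close>
  define G where "G = (\<lambda>(u :: real \<Rightarrow>\<^sub>C 'a) t. integral {-T..t} (\<lambda>s. f s (u s)))"
  \<comment> \<open>Time is clamped to \<open>{-T..T}\<close>, so that an iterate defined on the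
    interval becomes a bounded continuous function on the line.\<close>
  define cl where "cl = (\<lambda>t. max (-T) (min T t))"
  have cl: "\<bar>cl t\<bar> \<le> T" "\<bar>t\<bar> \<le> T \<Longrightarrow> cl t = t" for t using T by (auto simp: cl_def)
  define X where "X = PiC (UNIV :: real set) (\<lambda>_. cball c R)"
  have X: "u \<in> X \<longleftrightarrow> (\<forall>t. u t \<in> cball c R)" for u by (auto simp: X_def mem_PiC_iff)
  define \<Phi> where "\<Phi> = (\<lambda>u t. c + (G u (cl t) - G u 0))"
  have B0: "0 \<le> B" using order_trans[OF norm_ge_zero B[of 0 c]] T R0 by simp
  have cf: "continuous_on {-T..T} (\<lambda>s. f s (u s))" if "u \<in> X" for u
  proof -
    have "continuous_on {-T..T} (\<lambda>s. (s, u s))"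
      by (intro continuous_on_Pair continuous_on_id continuous_on_apply_bcontfun)
    moreover have "(\<lambda>s. (s, u s)) ` {-T..T} \<subseteq> {-T..T} \<times> cball c R"
      using that unfolding X by blast
    ultimately show ?thesis using continuous_on_compose2[OF cont] by fastforce
  qed
  have G: "(G u has_vector_derivative f t (u t)) (at t within {-T..T})" if "u \<in> X" "\<bar>t\<bar> \<le> T" for u t
    unfolding G_def by (rule integral_has_vector_derivative[OF cf[OF that(1)]]) (use that(2) in auto)
  have \<Phi>_diff: "norm (\<Phi> u t - c) \<le> R" if "u \<in> X" for u t
  proof -
    have "norm (G u (cl t) - G u 0) \<le> B * \<bar>cl t\<bar>"
      by (rule has_vector_derivative_norm_bound[where r=T]) (use G[OF that] that B cl in \<open>auto simp: X\<close>)
    also have "\<dots> \<le> B * T" using B0 cl by (intro mult_left_mono)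
    finally show ?thesis using BT by (simp add: \<Phi>_def)
  qed
  have \<Phi>_cont: "continuous_on UNIV (\<Phi> u)" if "u \<in> X" for u
  proof -
    have "continuous_on {-T..T} (G u)"
      unfolding G_def using cf[OF that] by (intro indefinite_integral_continuous_1 integrable_continuous_real)
    moreover have "continuous_on UNIV cl" unfolding cl_def by (intro continuous_intros)
    ultimately have "continuous_on UNIV (\<lambda>t. G u (cl t))"
      using T by (rule_tac continuous_on_compose2[where s=UNIV and f=cl and g="G u" and t="{-T..T}"]) (auto simp: cl_def)
    then show ?thesis unfolding \<Phi>_def by (intro continuous_intros)
  qed
  have \<Phi>_bc: "apply_bcontfun (Bcontfun (\<Phi> u)) = \<Phi> u" if "u \<in> X" for u
  proof (rule Bcontfun_inverse)
    have "range (\<Phi> u) \<subseteq> cball c R" using \<Phi>_diff[OF that] by (auto simp: dist_norm norm_minus_commute)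
    then show "\<Phi> u \<in> bcontfun"
      using \<Phi>_cont[OF that] bounded_subset[OF bounded_cball] by (auto simp: bcontfun_def)
  qed
  have "\<exists>!u. u \<in> X \<and> Bcontfun (\<Phi> u) = u"
  proof (rule Banach_fix)
    show "complete X" unfolding X_def by (simp add: complete_eq_closed closed_PiC)
    have "apply_bcontfun (const_bcontfun c) t \<in> cball c R" for t :: real using R0 by (simp add: const_bcontfun.rep_eq)
    then show "X \<noteq> {}" using X by blast
    show "(\<lambda>u. Bcontfun (\<Phi> u)) ` X \<subseteq> X"
      using \<Phi>_diff by (auto simp: X \<Phi>_bc dist_norm norm_minus_commute)
    show "dist (Bcontfun (\<Phi> u)) (Bcontfun (\<Phi> v)) \<le> 1/2 * dist u v" if uv: "u \<in> X" "v \<in> X" for u v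
    proof (rule dist_bound)
      fix t
      have "norm ((G u (cl t) - G v (cl t)) - (G u 0 - G v 0)) \<le> (L * dist u v) * \<bar>cl t\<bar>"
      proof (rule has_vector_derivative_norm_bound[where r=T])
        fix s assume s: "\<bar>s\<bar> \<le> T"
        show "((\<lambda>t. G u t - G v t) has_vector_derivative f s (u s) - f s (v s)) (at s within {-T..T})"
          by (intro has_vector_derivative_diff G uv s)
        have "norm (f s (u s) - f s (v s)) \<le> L * norm (u s - v s)"
          using uv s by (intro lip) (auto simp: X)
        also have "\<dots> \<le> L * dist u v"
          using dist_bounded[of u s v] L(1) by (intro mult_left_mono) (auto simp: dist_norm)
        finally show "norm (f s (u s) - f s (v s)) \<le> L * dist u v" .
      qed (rule cl)
      also have "\<dots> \<le> (L * dist u v) * T" using L(1) cl by (intro mult_left_mono) auto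
      also have "\<dots> \<le> 1/2 * dist u v" using mult_right_mono[OF L(2), of "dist u v"] by (simp add: ac_simps)
      finally show "dist (Bcontfun (\<Phi> u) t) (Bcontfun (\<Phi> v) t) \<le> 1/2 * dist u v"
        unfolding \<Phi>_bc[OF uv(1)] \<Phi>_bc[OF uv(2)] by (simp add: \<Phi>_def dist_norm algebra_simps)
    qed
  qed auto
  then obtain u where u: "u \<in> X" "Bcontfun (\<Phi> u) = u" by blast
  have fixp: "u t = c + (G u (cl t) - G u 0)" for t
    using \<Phi>_bc[OF u(1)] u(2) by (simp add: \<Phi>_def)
  show ?thesis
  proof
    show "u 0 = c" using fixp[of 0] cl(2)[of 0] T by simp
    fix t assume t: "\<bar>t\<bar> < T"
    show "u t \<in> cball c R" using u(1) X by blast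
    have "(G u has_vector_derivative f t (u t)) (at t within {-T<..<T})"
      by (rule has_vector_derivative_within_subset[OF G[OF u(1)]]) (use t in auto)
    then have "(G u has_vector_derivative f t (u t)) (at t)"
      using t by (subst (asm) has_vector_derivative_within_open) auto
    then have "((\<lambda>t. c + (G u t - G u 0)) has_vector_derivative f t (u t)) (at t)"
      by (auto intro!: derivative_eq_intros)
    then show "(u has_vector_derivative f t (u t)) (at t)"
    proof (rule has_vector_derivative_transform_within_open)
      show "c + (G u s - G u 0) = u s" if "s \<in> {-T<..<T}" for s using fixp[of s] cl(2)[of s] that by auto
    qed (use t in auto)
  qed
qed

text \<open>The solution \<open>y\<close> is a parameter and not a construction, because the locale
  is instantiated again with the derivative of \<open>y\<close> in place of \<open>y\<close>. That
  derivative solves an equation whose right-hand side depends on time and parameter even if the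
  original one does not, hence the three arguments of \<open>f\<close>.\<close>

locale ode_family =
  fixes f :: "real \<times> 'p::euclidean_space \<times> 'e::euclidean_space \<Rightarrow> 'e"
    and c :: "'p \<Rightarrow> 'e" and y :: "real \<times> 'p \<Rightarrow> 'e" and T L :: real and U :: "'p set" and S :: "'e set"
  assumes T: "0 < T" and L: "0 \<le> L" "L * T \<le> 1/2" and openU: "open U" and openS: "open S"
    and lip: "\<And>t x v w. \<bar>t\<bar> < T \<Longrightarrow> x \<in> U \<Longrightarrow> v \<in> S \<Longrightarrow> w \<in> S \<Longrightarrow> norm (f (t, x, v) - f (t, x, w)) \<le> L * norm (v - w)"
    and y_in: "\<And>t x. \<bar>t\<bar> < T \<Longrightarrow> x \<in> U \<Longrightarrow> y (t, x) \<in> S"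
    and y_deriv: "\<And>t x. \<bar>t\<bar> < T \<Longrightarrow> x \<in> U \<Longrightarrow> ((\<lambda>t. y (t, x)) has_vector_derivative f (t, x, y (t, x))) (at t)"
    and y_0: "\<And>x. x \<in> U \<Longrightarrow> y (0, x) = c x"
begin

section \<open>Continuity of the solutions in time and parameter\<close>

lemma L_le: "r \<le> T \<Longrightarrow> L * r \<le> 1/2"
  using mult_left_mono[OF _ L(1)] L(2) order_trans by blast

lemma y_continuous_time: "x \<in> U \<Longrightarrow> r < T \<Longrightarrow> continuous_on {-r..r} (\<lambda>t. y (t, x))"
  by (intro continuous_at_imp_continuous_on ballI) (rule has_vector_derivative_continuous[OF y_deriv], auto)

text \<open>The difference of two solutions obeys the inequality of \<open>short_time_bound\<close>.
  Its error term is the variation of \<open>f\<close> in the parameter along the fixed curve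
  \<open>y (t, x0)\<close>, which is uniformly small over a compact time interval.\<close>

lemma y_continuous_param:
  assumes f: "continuous_on ({-T<..<T} \<times> U \<times> S) f" and c: "continuous_on U c"
    and x0: "x0 \<in> U" and r: "0 < r" "r < T" and e: "0 < e"
  obtains d where "0 < d"
    "\<And>x. dist x x0 < d \<Longrightarrow> x \<in> U" "\<And>x t. dist x x0 < d \<Longrightarrow> \<bar>t\<bar> < r \<Longrightarrow> norm (y (t, x) - y (t, x0)) \<le> e"
proof -
  have "continuous_on (U \<times> {-r..r}) (\<lambda>z. (snd z, fst z, y (snd z, x0)))"
    by (intro continuous_intros continuous_on_compose2[OF y_continuous_time[OF x0 r(2)]]) auto
  moreover have "(\<lambda>z. (snd z, fst z, y (snd z, x0))) ` (U \<times> {-r..r}) \<subseteq> {-T<..<T} \<times> U \<times> S"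
    using r y_in[OF _ x0] by auto
  ultimately have "continuous_on (U \<times> {-r..r}) (\<lambda>z. f (snd z, fst z, y (snd z, x0)))"
    using continuous_on_compose2[OF f] by blast
  \<comment> \<open>The tolerance \<open>e / (8 * T)\<close> for \<open>f\<close>, with
    \<open>e / 8\<close> for the initial values, makes the factor 4 of
    \<open>short_time_bound\<close> return exactly \<open>e\<close>.\<close>
  then obtain X0 where X0: "x0 \<in> X0" "open X0"
    "\<forall>x\<in>X0 \<inter> U. \<forall>t\<in>{-r..r}. dist (f (t, x, y (t, x0))) (f (t, x0, y (t, x0))) \<le> e / (8 * T)"
    using continuous_on_prod_compactE[of U "{-r..r}" "\<lambda>z. f (snd z, fst z, y (snd z, x0))" x0 "e / (8*T)"] x0 e T by auto
  have "open (X0 \<inter> U)" using X0(2) openU by blast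
  then obtain d1 where d1: "0 < d1" "ball x0 d1 \<subseteq> X0 \<inter> U"
    using X0(1) x0 by (meson IntI openE)
  have "isCont c x0" using c openU x0 by (simp add: continuous_on_eq_continuous_at)
  then obtain d2 where d2: "0 < d2" "\<And>x. dist x x0 < d2 \<Longrightarrow> dist (c x) (c x0) < e / 8"
    using e unfolding continuous_at_eps_delta by (metis divide_pos_pos zero_less_numeral)
  show ?thesis
  proof (rule that[of "min d1 d2"])
    show "x \<in> U" if "dist x x0 < min d1 d2" for x
      using d1 that by (auto simp: dist_commute subset_iff)
    fix x t assume x: "dist x x0 < min d1 d2" and t: "\<bar>t\<bar> < r"
    have xU: "x \<in> U" "x \<in> X0" using d1 x by (auto simp: dist_commute subset_iff)
    have "norm (y (t, x) - y (t, x0)) \<le> 4 * (norm (y (0, x) - y (0, x0)) + r * (e / (8*T)))"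
    proof (rule short_time_bound[where T=r and L=L])
      fix s assume s: "\<bar>s\<bar> < r"
      then have sT: "\<bar>s\<bar> < T" using r by simp
      show "((\<lambda>t. y (t, x) - y (t, x0)) has_vector_derivative f (s, x, y (s, x)) - f (s, x0, y (s, x0))) (at s)"
        by (intro has_vector_derivative_diff y_deriv sT xU x0)
      have "norm (f (s, x, y (s, x)) - f (s, x, y (s, x0))) \<le> L * norm (y (s, x) - y (s, x0))"
        by (intro lip sT xU y_in x0)
      moreover have "norm (f (s, x, y (s, x0)) - f (s, x0, y (s, x0))) \<le> e / (8 * T)"
        using X0(3)[rule_format, of x s] xU s by (simp add: dist_norm abs_less_iff)
      ultimately show "norm (f (s, x, y (s, x)) - f (s, x0, y (s, x0))) \<le> L * norm (y (s, x) - y (s, x0)) + e / (8 * T)"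
        using norm_triangle_le_diff norm_diff_triangle_le by blast
    qed (use L_le[of r] L e T r t in auto)
    also have "\<dots> \<le> 4 * (e / 8 + T * (e / (8*T)))"
      using d2(2)[of x] x y_0[OF xU(1)] y_0[OF x0] r T e
      by (intro mult_left_mono add_mono mult_right_mono) (auto simp: dist_norm)
    also have "\<dots> = e" using T by simp
    finally show "norm (y (t, x) - y (t, x0)) \<le> e" .
  qed (use d1 d2 in auto)
qed

lemma y_continuous:
  assumes f: "continuous_on ({-T<..<T} \<times> U \<times> S) f" and c: "continuous_on U c"
  shows "continuous_on ({-T<..<T} \<times> U) y"
proof (intro continuous_at_imp_continuous_on ballI)
  fix z assume "z \<in> {-T<..<T} \<times> U"
  then obtain t0 x0 where z: "z = (t0, x0)" and t0: "\<bar>t0\<bar> < T" and x0: "x0 \<in> U" by auto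
  show "isCont y z"
    unfolding z continuous_at_eps_delta
  proof (intro allI impI)
    fix e :: real assume e: "0 < e"
    define r where "r = (\<bar>t0\<bar> + T) / 2"
    have r: "0 < r" "r < T" "\<bar>t0\<bar> < r" using t0 T by (auto simp: r_def)
    obtain d1 where d1: "0 < d1" "\<And>x t. dist x x0 < d1 \<Longrightarrow> \<bar>t\<bar> < r \<Longrightarrow> norm (y (t, x) - y (t, x0)) \<le> e/3"
      by (rule y_continuous_param[OF f c x0 r(1,2), of "e/3"]) (use e in auto)
    have "isCont (\<lambda>t. y (t, x0)) t0" by (rule has_vector_derivative_continuous[OF y_deriv[OF t0 x0]])
    then obtain d2 where d2: "0 < d2" "\<And>t. dist t t0 < d2 \<Longrightarrow> dist (y (t, x0)) (y (t0, x0)) < e/3"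
      using e unfolding continuous_at_eps_delta by (metis divide_pos_pos zero_less_numeral)
    show "\<exists>d>0. \<forall>z'. dist z' (t0, x0) < d \<longrightarrow> dist (y z') (y (t0, x0)) < e"
    proof (intro exI[of _ "min (min d1 d2) (r - \<bar>t0\<bar>)"] conjI allI impI)
      fix z' assume "dist z' (t0, x0) < min (min d1 d2) (r - \<bar>t0\<bar>)"
      then have *: "dist (fst z') t0 < min (min d1 d2) (r - \<bar>t0\<bar>)" "dist (snd z') x0 < min (min d1 d2) (r - \<bar>t0\<bar>)"
        using dist_fst_le[of z' "(t0,x0)"] dist_snd_le[of z' "(t0,x0)"] by auto
      then have "\<bar>fst z'\<bar> < r" by (auto simp: dist_real_def)
      then have "norm (y z' - y (fst z', x0)) \<le> e/3" using d1(2)[of "snd z'" "fst z'"] * by auto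
      moreover have "dist (y (fst z', x0)) (y (t0, x0)) < e/3" using d2(2) * by auto
      ultimately show "dist (y z') (y (t0, x0)) < e"
        using e dist_triangle[of "y z'" "y (t0, x0)" "y (fst z', x0)"] by (simp add: dist_norm)
    qed (use d1 d2 r in auto)
  qed
qed

end

section \<open>Differentiability of the solutions in the parameter\<close>

context ode_family
begin

text \<open>Consequently the linearized equation has the same Lipschitz constant \<open>L\<close>.
  This is why a single time \<open>T\<close> serves derivatives of every order.\<close>

lemma lip_derivative:
  assumes t: "\<bar>t\<bar> < T" and x: "x \<in> U" and v: "v \<in> S" and D: "(f has_derivative D) (at (t, x, v))"
  shows "norm (D (0, 0, w)) \<le> L * norm w"
proof -
  have "((\<lambda>h. (t, x, v + h *\<^sub>R w)) has_derivative (\<lambda>h. (0, 0, h *\<^sub>R w))) (at 0)"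
    by (auto intro!: derivative_eq_intros)
  moreover have "(f has_derivative D) (at (t, x, v + 0 *\<^sub>R w))" using D by simp
  ultimately have "((\<lambda>h. f (t, x, v + h *\<^sub>R w)) has_derivative (\<lambda>h. D (0, 0, h *\<^sub>R w))) (at 0)"
    by (rule has_derivative_compose)
  moreover have "D (0, 0, h *\<^sub>R w) = h *\<^sub>R D (0, 0, w)" for h
    using linear_scale[OF has_derivative_linear[OF D], of h "(0, 0, w)"] by simp
  ultimately have "((\<lambda>h. (f (t, x, v + h *\<^sub>R w) - f (t, x, v) - h *\<^sub>R D (0, 0, w)) /\<^sub>R norm h) \<longlongrightarrow> 0) (at 0)"
    unfolding has_derivative_at
    by (auto intro: tendsto_norm_zero_cancel simp: divide_inverse_commute)
  then have lim: "((\<lambda>h. norm ((f (t, x, v + h *\<^sub>R w) - f (t, x, v) - h *\<^sub>R D (0, 0, w)) /\<^sub>R norm h) + L * norm w) \<longlongrightarrow> 0 + L * norm w) (at 0)"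
    by (intro tendsto_add tendsto_norm_zero tendsto_const)
  have "\<forall>\<^sub>F h in at 0. v + h *\<^sub>R w \<in> S"
  proof -
    have "((\<lambda>h. v + h *\<^sub>R w) \<longlongrightarrow> v + 0 *\<^sub>R w) (at 0)" by (intro tendsto_intros)
    then show ?thesis using topological_tendstoD[OF _ openS] v by simp
  qed
  moreover have "\<forall>\<^sub>F h::real in at 0. h \<noteq> 0" by (simp add: eventually_at_filter)
  ultimately have "\<forall>\<^sub>F h in at 0. norm (D (0, 0, w)) \<le>
      norm ((f (t, x, v + h *\<^sub>R w) - f (t, x, v) - h *\<^sub>R D (0, 0, w)) /\<^sub>R norm h) + L * norm w"
  proof eventually_elim
    case (elim h)
    let ?d = "f (t, x, v + h *\<^sub>R w) - f (t, x, v)"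
    have "norm ?d \<le> \<bar>h\<bar> * (L * norm w)"
      using lip[OF t x elim(1) v] by (simp add: algebra_simps)
    moreover have "\<bar>h\<bar> * norm (D (0, 0, w)) \<le> norm (?d - h *\<^sub>R D (0, 0, w)) + norm ?d"
      using norm_triangle_sub[of "h *\<^sub>R D (0, 0, w)" ?d] by (simp add: norm_minus_commute)
    ultimately have "\<bar>h\<bar> * norm (D (0, 0, w)) \<le> norm (?d - h *\<^sub>R D (0, 0, w)) + \<bar>h\<bar> * (L * norm w)" by simp
    then have "norm (D (0, 0, w)) \<le> norm (?d - h *\<^sub>R D (0, 0, w)) / \<bar>h\<bar> + L * norm w"
      using elim(2) by (simp add: divide_simps mult.commute)
    then show ?case unfolding norm_scaleR by (simp add: divide_inverse_commute)
  qed
  from tendsto_lowerbound[OF lim this] show ?thesis by simp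
qed

text \<open>The linearization along \<open>y (t, x0)\<close> in the parameter direction
  \<open>w\<close>. Passing to \<open>r < T\<close> makes the time interval compact, so that the
  inhomogeneous term is bounded; the linear part is bounded by
  \<open>lip_derivative\<close>.\<close>

lemma variational_solution:
  assumes f': "\<And>z. z \<in> {-T<..<T} \<times> U \<times> S \<Longrightarrow> (f has_derivative blinfun_apply (f' z)) (at z)"
    and contf': "continuous_on ({-T<..<T} \<times> U \<times> S) f'"
    and x0: "x0 \<in> U" and r: "0 < r" "r < T"
  obtains \<eta> where "\<eta> 0 = v0"
    "\<And>t. \<bar>t\<bar> < r \<Longrightarrow> (\<eta> has_vector_derivative f' (t, x0, y (t, x0)) (0, w, \<eta> t)) (at t)"
proof -
  have mem: "(t, x0, y (t, x0)) \<in> {-T<..<T} \<times> U \<times> S" if "\<bar>t\<bar> \<le> r" for t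
    using y_in[OF _ x0] x0 r that by auto
  have "continuous_on {-r..r} (\<lambda>t. (t, x0, y (t, x0)))"
    by (intro continuous_intros y_continuous_time x0 r)
  moreover have "(\<lambda>t. (t, x0, y (t, x0))) ` {-r..r} \<subseteq> {-T<..<T} \<times> U \<times> S"
    by (intro image_subsetI mem) (simp add: abs_le_iff)
  ultimately have cf: "continuous_on {-r..r} (\<lambda>t. f' (t, x0, y (t, x0)))"
    using continuous_on_compose2[OF contf'] by blast
  then have "compact ((\<lambda>t. f' (t, x0, y (t, x0)) (0, w, 0)) ` {-r..r})"
    by (intro compact_continuous_image blinfun.continuous_on continuous_intros) auto
  then obtain B where B: "0 < B" "\<And>t. t \<in> {-r..r} \<Longrightarrow> norm (f' (t, x0, y (t, x0)) (0, w, 0)) \<le> B"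
    unfolding bounded_pos[of "_ ` _"] by (metis (no_types, lifting) bounded_pos compact_imp_bounded image_eqI)
  have split: "f' z (0, w, u) - f' z (0, w, v) = f' z (0, 0, u - v)" for z u v
    by (simp flip: blinfun.diff_right)
  have fL: "norm (f' (t, x0, y (t, x0)) (0, 0, u)) \<le> L * norm u" if "\<bar>t\<bar> \<le> r" for t u
    by (rule lip_derivative[OF _ x0 y_in[OF _ x0] f'[OF mem[OF that]]]) (use that r in auto)
  \<comment> \<open>With \<open>L * r \<le> 1/2\<close> the invariance condition
    \<open>(L * (norm v0 + R) + B) * r \<le> R\<close> follows from
    \<open>(norm v0 + R) / 2 + r * B \<le> R\<close>, and this value of \<open>R\<close> gives
    equality there.\<close>
  define R where "R = norm v0 + 2 * r * B"
  have R: "0 \<le> R" "0 \<le> r" "(L * (norm v0 + R) + B) * r \<le> R"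
  proof -
    have "L * r * (norm v0 + R) \<le> 1/2 * (norm v0 + R)"
      using L_le[of r] r B(1) by (intro mult_right_mono) (auto simp: R_def)
    then show "(L * (norm v0 + R) + B) * r \<le> R"
      using r(1) B(1) by (simp add: R_def algebra_simps)
  qed (use B r in \<open>auto simp: R_def\<close>)
  note main = that
  show ?thesis
  proof (rule ode_solution[of r v0 R "\<lambda>t v. f' (t, x0, y (t, x0)) (0, w, v)" L "L * (norm v0 + R) + B"])
    show "continuous_on ({-r..r} \<times> cball v0 R) (\<lambda>(t, v). f' (t, x0, y (t, x0)) (0, w, v))"
      unfolding case_prod_beta
      by (intro blinfun.continuous_on continuous_on_compose2[OF cf] continuous_intros) auto
    show "norm (f' (t, x0, y (t, x0)) (0, w, u) - f' (t, x0, y (t, x0)) (0, w, v)) \<le> L * norm (u - v)" if "\<bar>t\<bar> \<le> r" for t u v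
      unfolding split by (rule fL[OF that])
    show "norm (f' (t, x0, y (t, x0)) (0, w, v)) \<le> L * (norm v0 + R) + B" if "\<bar>t\<bar> \<le> r" "v \<in> cball v0 R" for t v
    proof -
      have "norm v \<le> norm v0 + R" using that(2) norm_triangle_sub[of v v0] by (simp add: dist_norm norm_minus_commute)
      then have "norm (f' (t, x0, y (t, x0)) (0, 0, v)) \<le> L * (norm v0 + R)"
        using fL[OF that(1), of v] mult_left_mono[OF _ L(1)] order_trans by blast
      moreover have "norm (f' (t, x0, y (t, x0)) (0, w, 0)) \<le> B" using B(2) that(1) by (auto simp: abs_le_iff)
      moreover have "f' (t, x0, y (t, x0)) (0, w, v) = f' (t, x0, y (t, x0)) (0, 0, v) + f' (t, x0, y (t, x0)) (0, w, 0)"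
        by (simp flip: blinfun.add_right)
      ultimately show ?thesis using norm_triangle_mono by metis
    qed
    show thesis if "\<eta> 0 = v0" "\<And>t. \<bar>t\<bar> < r \<Longrightarrow> (\<eta> has_vector_derivative f' (t, x0, y (t, x0)) (0, w, \<eta> t)) (at t)" for \<eta>
      using that(1,2) by (rule main)
  qed (use R r L L_le[of r] in auto)
qed

text \<open>The remainder \<open>y (t, x) - y (t, x0) - \<eta> (x - x0) t\<close> satisfies a
  differential inequality with constant \<open>L + \<epsilon>\<close>, an initial value of order
  \<open>o(norm (x - x0))\<close> and an error proportional to
  \<open>\<epsilon> * norm (x - x0)\<close>. So \<open>short_time_bound\<close> makes it small of
  first order.\<close>

lemma y_has_derivative_param:
  assumes f': "\<And>z. z \<in> {-T<..<T} \<times> U \<times> S \<Longrightarrow> (f has_derivative blinfun_apply (f' z)) (at z)"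
    and contf': "continuous_on ({-T<..<T} \<times> U \<times> S) f'" and contc: "continuous_on U c"
    and x0: "x0 \<in> U" and r: "0 < r" "r < T" and c': "(c has_derivative c') (at x0)"
    and \<eta>: "\<And>w. \<eta> w 0 = c' w"
      "\<And>w t. \<bar>t\<bar> < r \<Longrightarrow> (\<eta> w has_vector_derivative f' (t, x0, y (t, x0)) (0, w, \<eta> w t)) (at t)"
    and t: "\<bar>t\<bar> < r"
  shows "((\<lambda>x. y (t, x)) has_derivative (\<lambda>w. \<eta> w t)) (at x0)"
proof -
  have mem: "(t, x0, y (t, x0)) \<in> {-T<..<T} \<times> U \<times> S" if "\<bar>t\<bar> \<le> r" for t
    using y_in[OF _ x0] x0 r that by auto
  have fL: "norm (f' (t, x0, y (t, x0)) (0, 0, u)) \<le> L * norm u" if "\<bar>t\<bar> \<le> r" for t u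
    by (rule lip_derivative[OF _ x0 y_in[OF _ x0] f'[OF mem[OF that]]]) (use that r in auto)
  have Lr: "L * r \<le> 3/4" using L_le[of r] r by simp
  have linc': "linear c'" using c' has_derivative_linear by blast
  \<comment> \<open>Linearity in \<open>w\<close> is uniqueness for the linearized equation: the
    defect solves the homogeneous equation with initial value \<open>0\<close>, and the bound with
    \<open>e = 0\<close> annihilates it.\<close>
  have lin: "linear (\<lambda>w. \<eta> w t)"
  proof (rule linearI)
    fix v w
    have "norm (\<eta> (v + w) t - (\<eta> v t + \<eta> w t)) \<le> 4 * (norm (\<eta> (v + w) 0 - (\<eta> v 0 + \<eta> w 0)) + r * 0)"
    proof (rule short_time_bound[where T=r and L=L])
      fix s assume s: "\<bar>s\<bar> < r"
      show "((\<lambda>t. \<eta> (v + w) t - (\<eta> v t + \<eta> w t)) has_vector_derivative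
        f' (s, x0, y (s, x0)) (0, v + w, \<eta> (v + w) s) - (f' (s, x0, y (s, x0)) (0, v, \<eta> v s) + f' (s, x0, y (s, x0)) (0, w, \<eta> w s))) (at s)"
        by (intro has_vector_derivative_diff has_vector_derivative_add \<eta>(2)[OF s])
      have "f' (s, x0, y (s, x0)) (0, v + w, \<eta> (v + w) s) - (f' (s, x0, y (s, x0)) (0, v, \<eta> v s) + f' (s, x0, y (s, x0)) (0, w, \<eta> w s))
        = f' (s, x0, y (s, x0)) (0, 0, \<eta> (v + w) s - (\<eta> v s + \<eta> w s))"
        by (simp flip: blinfun.diff_right blinfun.add_right)
      then show "norm (f' (s, x0, y (s, x0)) (0, v + w, \<eta> (v + w) s) - (f' (s, x0, y (s, x0)) (0, v, \<eta> v s) + f' (s, x0, y (s, x0)) (0, w, \<eta> w s)))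
        \<le> L * norm (\<eta> (v + w) s - (\<eta> v s + \<eta> w s)) + 0"
        using fL[of s] s by simp
    qed (use L Lr t in auto)
    then show "\<eta> (v + w) t = \<eta> v t + \<eta> w t" by (simp add: \<eta>(1) linear_add[OF linc'])
  next
    fix k w
    have "norm (\<eta> (k *\<^sub>R w) t - k *\<^sub>R \<eta> w t) \<le> 4 * (norm (\<eta> (k *\<^sub>R w) 0 - k *\<^sub>R \<eta> w 0) + r * 0)"
    proof (rule short_time_bound[where T=r and L=L])
      fix s assume s: "\<bar>s\<bar> < r"
      show "((\<lambda>t. \<eta> (k *\<^sub>R w) t - k *\<^sub>R \<eta> w t) has_vector_derivative
        f' (s, x0, y (s, x0)) (0, k *\<^sub>R w, \<eta> (k *\<^sub>R w) s) - k *\<^sub>R f' (s, x0, y (s, x0)) (0, w, \<eta> w s)) (at s)"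
        using has_vector_derivative_scaleR[OF DERIV_const \<eta>(2)[OF s], of k w]
        by (intro has_vector_derivative_diff \<eta>(2)[OF s]) simp
      have "f' (s, x0, y (s, x0)) (0, k *\<^sub>R w, \<eta> (k *\<^sub>R w) s) - k *\<^sub>R f' (s, x0, y (s, x0)) (0, w, \<eta> w s)
        = f' (s, x0, y (s, x0)) (0, 0, \<eta> (k *\<^sub>R w) s - k *\<^sub>R \<eta> w s)"
        by (simp flip: blinfun.diff_right blinfun.scaleR_right)
      then show "norm (f' (s, x0, y (s, x0)) (0, k *\<^sub>R w, \<eta> (k *\<^sub>R w) s) - k *\<^sub>R f' (s, x0, y (s, x0)) (0, w, \<eta> w s))
        \<le> L * norm (\<eta> (k *\<^sub>R w) s - k *\<^sub>R \<eta> w s) + 0"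
        using fL[of s] s by simp
    qed (use L Lr t in auto)
    then show "\<eta> (k *\<^sub>R w) t = k *\<^sub>R \<eta> w t" by (simp add: \<eta>(1) linear_scale[OF linc'])
  qed
  have cont0: "continuous_on {-r..r} (\<lambda>t. (t, x0, y (t, x0)))"
    by (intro continuous_intros y_continuous_time x0 r)
  have mem0: "(\<lambda>t. (t, x0, y (t, x0))) ` {-r..r} \<subseteq> {-T<..<T} \<times> U \<times> S"
    by (intro image_subsetI mem) (simp add: abs_le_iff)
  obtain K1 where K1: "0 < K1" "\<And>t. \<bar>t\<bar> \<le> r \<Longrightarrow> norm (f' (t, x0, y (t, x0))) \<le> K1"
  proof -
    have "bounded ((\<lambda>t. f' (t, x0, y (t, x0))) ` {-r..r})"
      by (intro compact_imp_bounded compact_continuous_image continuous_on_compose2[OF contf' cont0 mem0]) auto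
    then obtain K where "0 < K" "\<forall>z\<in>(\<lambda>t. f' (t, x0, y (t, x0))) ` {-r..r}. norm z \<le> K"
      unfolding bounded_pos by blast
    then show ?thesis by (intro that[of K]) (auto simp: abs_le_iff)
  qed
  obtain K2 where K2: "0 < K2" "\<And>w. norm (c' w) \<le> norm w * K2"
    using bounded_linear.pos_bounded[OF has_derivative_bounded_linear[OF c']] by auto
  define K where "K = 4 * (K2 + r * K1)"
  have \<eta>K: "norm (\<eta> w s) \<le> K * norm w" if s: "\<bar>s\<bar> < r" for w s
  proof -
    have "norm (\<eta> w s) \<le> 4 * (norm (\<eta> w 0) + r * (K1 * norm w))"
    proof (rule short_time_bound[where T=r and L=L])
      fix s assume s: "\<bar>s\<bar> < r"
      show "(\<eta> w has_vector_derivative f' (s, x0, y (s, x0)) (0, w, \<eta> w s)) (at s)" by (rule \<eta>(2)[OF s])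
      have "f' (s, x0, y (s, x0)) (0, w, \<eta> w s) = f' (s, x0, y (s, x0)) (0, 0, \<eta> w s) + f' (s, x0, y (s, x0)) (0, w, 0)"
        by (simp flip: blinfun.add_right)
      moreover have "norm (f' (s, x0, y (s, x0)) (0, w, 0)) \<le> K1 * norm w"
        using norm_blinfun[of "f' (s, x0, y (s, x0))" "(0, w, 0)"] K1(2)[of s] s
          mult_right_mono[of "norm (f' (s, x0, y (s, x0)))" K1 "norm w"] by (simp add: norm_Pair)
      ultimately show "norm (f' (s, x0, y (s, x0)) (0, w, \<eta> w s)) \<le> L * norm (\<eta> w s) + K1 * norm w"
        using fL[of s "\<eta> w s"] s norm_triangle_mono by (metis less_imp_le)
    qed (use L Lr s K1 in auto)
    also have "\<dots> \<le> 4 * (norm w * K2 + r * (K1 * norm w))"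
      unfolding \<eta>(1) by (intro mult_left_mono add_right_mono K2) auto
    also have "\<dots> = K * norm w" by (simp add: K_def algebra_simps)
    finally show ?thesis .
  qed
  have K0: "0 < K" using K1(1) K2(1) r(1) by (simp add: K_def add_pos_pos)
  show ?thesis
    unfolding has_derivative_at_alt
  proof (intro conjI allI impI)
    show "bounded_linear (\<lambda>w. \<eta> w t)" using lin linear_conv_bounded_linear by blast
    fix e :: real assume e: "0 < e"
    \<comment> \<open>The first entry adds at most \<open>1/4\<close> to
      \<open>L * r \<le> 1/2\<close> and so respects the limit \<open>3/4\<close>; the second makes
      the error at most \<open>e/8\<close>, where \<open>K\<close> bounds \<open>\<eta>\<close>
      relative to \<open>norm w\<close>. With the initial error \<open>e/8\<close> the total is
      \<open>4 * (e/8 + e/8) = e\<close>.\<close>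
    define \<epsilon> where "\<epsilon> = min (1 / (4*T)) (e / (8 * r * (1 + K)))"
    have \<epsilon>: "0 < \<epsilon>" "\<epsilon> * T \<le> 1/4" "r * (\<epsilon> * (1 + K)) \<le> e/8"
    proof -
      show "0 < \<epsilon>" using e T r K0 by (simp add: \<epsilon>_def)
      show "\<epsilon> * T \<le> 1/4"
        using mult_right_mono[of \<epsilon> "1 / (4*T)" T] T by (simp add: \<epsilon>_def)
      show "r * (\<epsilon> * (1 + K)) \<le> e/8"
      proof -
        have "\<epsilon> * (r * (1 + K)) \<le> e / (8 * r * (1 + K)) * (r * (1 + K))"
          unfolding \<epsilon>_def using r K0 by (intro mult_right_mono) auto
        also have "\<dots> = e/8" using r K0 by (simp add: divide_simps)
        finally show ?thesis by (simp add: mult.left_commute)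
      qed
    qed
    obtain b1 where b1: "0 < b1" "ball x0 b1 \<subseteq> U" using openU x0 openE by blast
    have "compact ((\<lambda>t. y (t, x0)) ` {-r..r})"
      by (intro compact_continuous_image y_continuous_time x0 r compact_Icc)
    moreover have "(\<lambda>t. y (t, x0)) ` {-r..r} \<subseteq> S" using mem by (auto simp: abs_le_iff minus_le_iff)
    ultimately obtain b2 where b2: "0 < b2" "(\<Union>v\<in>(\<lambda>t. y (t, x0)) ` {-r..r}. ball v b2) \<subseteq> S"
      using compact_subset_open_imp_ball_epsilon_subset[OF _ openS] by metis
    define \<Omega> where "\<Omega> = ball (0::'p) b1 \<times> ball (0::'e) b2"
    have mem2: "(t, x0 + a, y (t, x0) + b) \<in> {-T<..<T} \<times> U \<times> S" if "(a, b) \<in> \<Omega>" "\<bar>t\<bar> \<le> r" for a b t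
    proof -
      have "x0 + a \<in> ball x0 b1" using that by (simp add: \<Omega>_def dist_norm)
      moreover have "y (t, x0) + b \<in> ball (y (t, x0)) b2" using that by (simp add: \<Omega>_def dist_norm)
      moreover have "y (t, x0) \<in> (\<lambda>t. y (t, x0)) ` {-r..r}" using that(2) by (auto simp: abs_le_iff)
      ultimately have "x0 + a \<in> U" "y (t, x0) + b \<in> S" using b1(2) b2(2) by blast+
      then show ?thesis using that(2) r by (simp add: abs_le_iff)
    qed
    \<comment> \<open>The derivative of \<open>f\<close> in a tube around the curve, written with
      the offset as parameter: uniformity over the compact time interval then yields one radius that
      is good for all times.\<close>
    let ?F = "\<lambda>z. f' (snd z, x0 + fst (fst z), y (snd z, x0) + snd (fst z))"
    have "continuous_on (\<Omega> \<times> {-r..r}) (\<lambda>z. (snd z, x0 + fst (fst z), y (snd z, x0) + snd (fst z)))"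
      by (intro continuous_intros continuous_on_compose2[OF y_continuous_time[OF x0 r(2)]]) auto
    moreover have "(\<lambda>z. (snd z, x0 + fst (fst z), y (snd z, x0) + snd (fst z))) ` (\<Omega> \<times> {-r..r}) \<subseteq> {-T<..<T} \<times> U \<times> S"
      by (intro image_subsetI mem2) (auto simp: abs_le_iff)
    ultimately have "continuous_on (\<Omega> \<times> {-r..r}) ?F"
      using continuous_on_compose2[OF contf'] by blast
    then obtain X0 where X0: "(0, 0) \<in> X0" "open X0"
      "\<forall>x\<in>X0 \<inter> \<Omega>. \<forall>t\<in>{-r..r}. dist (?F (x, t)) (?F ((0, 0), t)) \<le> \<epsilon>"
      using continuous_on_prod_compactE[of \<Omega> "{-r..r}" ?F "(0,0)" \<epsilon>] \<epsilon>(1) b1 b2 by (auto simp: \<Omega>_def)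
    have "open (X0 \<inter> \<Omega>)" unfolding \<Omega>_def by (intro open_Int X0 open_Times open_ball)
    moreover have "(0, 0) \<in> X0 \<inter> \<Omega>" using X0(1) b1 b2 by (simp add: \<Omega>_def)
    ultimately obtain \<delta> where \<delta>: "0 < \<delta>" "ball (0, 0) \<delta> \<subseteq> X0 \<inter> \<Omega>" using openE by blast
    define d0 where "d0 = \<delta> / 2"
    have d0: "0 < d0" using \<delta> by (simp add: d0_def)
    have inX: "(a, b) \<in> X0 \<inter> \<Omega>" if "norm a < d0" "norm b < d0" for a b
    proof -
      have "(a, b) \<in> ball 0 \<delta>" using norm_Pair_le[of a b] that by (simp add: d0_def)
      then show ?thesis using \<delta>(2) by (auto simp: zero_prod_def)
    qed
    have contf: "continuous_on ({-T<..<T} \<times> U \<times> S) f"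
      by (intro continuous_at_imp_continuous_on ballI) (rule has_derivative_continuous[OF f'])
    obtain d1 where d1: "0 < d1" "\<And>x. dist x x0 < d1 \<Longrightarrow> x \<in> U"
      "\<And>x t. dist x x0 < d1 \<Longrightarrow> \<bar>t\<bar> < r \<Longrightarrow> norm (y (t, x) - y (t, x0)) \<le> d0 / 2"
      by (rule y_continuous_param[OF contf contc x0 r, of "d0/2"]) (use d0 in auto)
    obtain d2 where d2: "0 < d2" "\<And>x. norm (x - x0) < d2 \<Longrightarrow> norm (c x - c x0 - c' (x - x0)) \<le> e/8 * norm (x - x0)"
      using c' e unfolding has_derivative_at_alt by (metis divide_pos_pos zero_less_numeral)
    show "\<exists>d>0. \<forall>x. norm (x - x0) < d \<longrightarrow> norm (y (t, x) - y (t, x0) - \<eta> (x - x0) t) \<le> e * norm (x - x0)"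
    proof (intro exI[of _ "min d0 (min d1 d2)"] conjI allI impI)
      fix x assume x: "norm (x - x0) < min d0 (min d1 d2)"
      define w where "w = x - x0"
      have xU: "x \<in> U" using d1(2)[of x] x by (simp add: dist_norm)
      have "norm (y (t, x) - y (t, x0) - \<eta> w t) \<le> 4 * (norm (y (0, x) - y (0, x0) - \<eta> w 0) + r * (\<epsilon> * (1 + K) * norm w))"
      proof (rule short_time_bound[where T=r and L="L + \<epsilon>"])
        fix s assume s: "\<bar>s\<bar> < r"
        then have sT: "\<bar>s\<bar> < T" using r by simp
        let ?z0 = "(s, x0, y (s, x0))" and ?z1 = "(s, x, y (s, x))"
        define u where "u = y (s, x) - y (s, x0) - \<eta> w s"
        show "((\<lambda>t. y (t, x) - y (t, x0) - \<eta> w t) has_vector_derivative f ?z1 - f ?z0 - f' ?z0 (0, w, \<eta> w s)) (at s)"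
          by (intro has_vector_derivative_diff y_deriv sT xU x0 \<eta>(2) s)
        have dy: "norm (y (s, x) - y (s, x0)) < d0" using d1(3)[of x s] x s d0 by (simp add: dist_norm)
        \<comment> \<open>The mean value inequality is applied with time frozen at \<open>s\<close>;
          the segment from \<open>?z0\<close> to \<open>?z1\<close> stays in a product of balls on
          which \<open>f'\<close> differs from \<open>f' ?z0\<close> by at most
          \<open>\<epsilon>\<close>.\<close>
        have "norm (f ?z1 - f ?z0 - f' ?z0 (?z1 - ?z0)) \<le> norm (?z1 - ?z0) * \<epsilon>"
        proof (rule differentiable_bound_linearization[where S="{s} \<times> ball x0 d0 \<times> ball (y (s, x0)) d0"])
          show "?z0 + h *\<^sub>R (?z1 - ?z0) \<in> {s} \<times> ball x0 d0 \<times> ball (y (s, x0)) d0" if "h \<in> {0..1}" for h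
          proof -
            have "norm (h *\<^sub>R (x - x0)) < d0" "norm (h *\<^sub>R (y (s, x) - y (s, x0))) < d0"
              using that x dy mult_left_le_one_le[of "norm (x - x0)" h] mult_left_le_one_le[of "norm (y (s, x) - y (s, x0))" h] by auto
            then show ?thesis by (simp add: dist_norm)
          qed
          fix z assume z: "z \<in> {s} \<times> ball x0 d0 \<times> ball (y (s, x0)) d0"
          obtain p q where pq: "z = (s, p, q)" "dist x0 p < d0" "dist (y (s, x0)) q < d0" using z by auto
          define a b where "a = p - x0" and "b = q - y (s, x0)"
          have z_eq: "z = (s, x0 + a, y (s, x0) + b)" by (simp add: pq a_def b_def)
          have ab: "(a, b) \<in> X0 \<inter> \<Omega>"
            by (rule inX) (use pq in \<open>simp_all add: a_def b_def dist_norm norm_minus_commute\<close>)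
          have "z \<in> {-T<..<T} \<times> U \<times> S" unfolding z_eq by (rule mem2) (use ab s in simp_all)
          then show "(f has_derivative blinfun_apply (f' z)) (at z within {s} \<times> ball x0 d0 \<times> ball (y (s, x0)) d0)"
            using has_derivative_at_withinI[OF f'] by blast
          have "s \<in> {-r..r}" using s by (auto simp: abs_less_iff)
          with X0(3) ab have "dist (?F ((a, b), s)) (?F ((0, 0), s)) \<le> \<epsilon>" by blast
          then have "norm (f' z - f' ?z0) \<le> \<epsilon>" by (simp add: dist_norm z_eq)
          moreover have "blinfun_apply (f' z) - blinfun_apply (f' ?z0) = blinfun_apply (f' z - f' ?z0)"
            by (auto simp: blinfun.diff_left)
          ultimately show "onorm (blinfun_apply (f' z) - blinfun_apply (f' ?z0)) \<le> \<epsilon>"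
            by (simp add: norm_blinfun.rep_eq)
        qed (use d0 in auto)
        also have "norm (?z1 - ?z0) * \<epsilon> \<le> (norm w + norm (y (s, x) - y (s, x0))) * \<epsilon>"
          using norm_Pair_le[of w "y (s, x) - y (s, x0)"] \<epsilon>(1) by (intro mult_right_mono) (auto simp: w_def norm_Pair)
        also have "norm (y (s, x) - y (s, x0)) \<le> norm u + K * norm w"
          using norm_triangle_sub[of "y (s, x) - y (s, x0)" "\<eta> w s"] \<eta>K[OF s, of w] by (simp add: u_def)
        finally have 1: "norm (f ?z1 - f ?z0 - f' ?z0 (?z1 - ?z0)) \<le> (norm w + (norm u + K * norm w)) * \<epsilon>"
          using \<epsilon>(1) by simp
        have "f ?z1 - f ?z0 - f' ?z0 (0, w, \<eta> w s) = (f ?z1 - f ?z0 - f' ?z0 (?z1 - ?z0)) + f' ?z0 (0, 0, u)"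
        proof -
          have "?z1 - ?z0 = (0, w, \<eta> w s) + (0, 0, u)" by (simp add: u_def w_def)
          then show ?thesis by (simp only: blinfun.add_right) simp
        qed
        then have "norm (f ?z1 - f ?z0 - f' ?z0 (0, w, \<eta> w s)) \<le> (norm w + (norm u + K * norm w)) * \<epsilon> + L * norm u"

          using norm_triangle_mono[OF 1 fL[of s u]] s by (simp only: less_imp_le)
        then show "norm (f ?z1 - f ?z0 - f' ?z0 (0, w, \<eta> w s)) \<le> (L + \<epsilon>) * norm (y (s, x) - y (s, x0) - \<eta> w s) + \<epsilon> * (1 + K) * norm w"
          by (simp add: u_def algebra_simps)
      next
        have "\<epsilon> * r \<le> \<epsilon> * T" using \<epsilon>(1) r by (intro mult_left_mono) auto
        then show "(L + \<epsilon>) * r \<le> 3/4" using \<epsilon>(2) L_le[of r] r by (simp add: algebra_simps)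
      qed (use L \<epsilon> K0 t in auto)
      also have "\<dots> \<le> 4 * (e/8 * norm w + e/8 * norm w)"
      proof -
        have "norm (y (0, x) - y (0, x0) - \<eta> w 0) \<le> e/8 * norm w"
          using d2(2)[of x] x by (simp add: y_0[OF xU] y_0[OF x0] \<eta>(1) w_def)
        moreover have "r * (\<epsilon> * (1 + K) * norm w) \<le> e/8 * norm w"
          using mult_right_mono[OF \<epsilon>(3), of "norm w"] by (simp add: mult.assoc)
        ultimately show ?thesis by simp
      qed
      finally show "norm (y (t, x) - y (t, x0) - \<eta> (x - x0) t) \<le> e * norm (x - x0)" by (simp add: w_def)
    qed (use d0 d1 d2 in auto)
  qed
qed

text \<open>The last two conclusions say that the derivative of \<open>y\<close> in a parameter
  direction again solves an equation with initial values; this is what lets the regularity argument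
  be iterated.\<close>

lemma y_has_derivative:
  assumes f: "Ck_on (Suc 0) ({-T<..<T} \<times> U \<times> S) f" and c: "Ck_on (Suc 0) U c"
    and t: "\<bar>t\<bar> < T" and x: "x \<in> U"
  shows "(y has_derivative (\<lambda>(\<tau>, w). \<tau> *\<^sub>R f (t, x, y (t, x)) + frechet_derivative y (at (t, x)) (0, w))) (at (t, x))"
    and "((\<lambda>t. frechet_derivative y (at (t, x)) (0, w)) has_vector_derivative
      frechet_derivative f (at (t, x, y (t, x))) (0, w, frechet_derivative y (at (t, x)) (0, w))) (at t)"
    and "frechet_derivative y (at (0, x)) (0, w) = frechet_derivative c (at x) w"
proof -
  obtain f' :: "real \<times> 'p \<times> 'e \<Rightarrow> (real \<times> 'p \<times> 'e) \<Rightarrow>\<^sub>L 'e"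
    where f': "\<And>z. z \<in> {-T<..<T} \<times> U \<times> S \<Longrightarrow> (f has_derivative blinfun_apply (f' z)) (at z)"
    and contf': "continuous_on ({-T<..<T} \<times> U \<times> S) f'"
    and f'_eq: "\<And>z. z \<in> {-T<..<T} \<times> U \<times> S \<Longrightarrow> blinfun_apply (f' z) = frechet_derivative f (at z)"
    using C1_blinfun_derivative[OF f] by metis
  have contf: "continuous_on ({-T<..<T} \<times> U \<times> S) f"
    by (intro continuous_at_imp_continuous_on ballI) (rule has_derivative_continuous[OF f'])
  have c': "(c has_derivative frechet_derivative c (at x)) (at x)" by (rule Ck_on_Suc_derivative[OF c x])
  have contc: "continuous_on U c" using Ck_on_Suc_imp[OF c] by simp
  have conty: "continuous_on ({-T<..<T} \<times> U) y" by (rule y_continuous[OF contf contc])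
  have contfy: "continuous_on (U \<times> {-T<..<T}) (\<lambda>z. f (snd z, fst z, y (snd z, fst z)))"
  proof -
    have "continuous_on (U \<times> {-T<..<T}) (\<lambda>z. (snd z, fst z, y (snd z, fst z)))"
      by (intro continuous_intros continuous_on_compose2[OF conty]) auto
    moreover have "(\<lambda>z. (snd z, fst z, y (snd z, fst z))) ` (U \<times> {-T<..<T}) \<subseteq> {-T<..<T} \<times> U \<times> S"
      using y_in by auto
    ultimately show ?thesis using continuous_on_compose2[OF contf] by blast
  qed
  define r where "r = (\<bar>t\<bar> + T) / 2"
  have r: "0 < r" "r < T" "\<bar>t\<bar> < r" using t T by (auto simp: r_def)
  have "\<exists>\<eta>. \<eta> 0 = frechet_derivative c (at x) w \<and>
    (\<forall>t. \<bar>t\<bar> < r \<longrightarrow> (\<eta> has_vector_derivative f' (t, x, y (t, x)) (0, w, \<eta> t)) (at t))" for w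
    using variational_solution[OF f' contf' x r(1,2)] by metis
  then obtain \<eta> where \<eta>: "\<And>w. \<eta> w 0 = frechet_derivative c (at x) w"
    "\<And>w t. \<bar>t\<bar> < r \<Longrightarrow> (\<eta> w has_vector_derivative f' (t, x, y (t, x)) (0, w, \<eta> w t)) (at t)"
    by metis
  have D: "(y has_derivative (\<lambda>(\<tau>, w). \<tau> *\<^sub>R f (s, x, y (s, x)) + \<eta> w s)) (at (s, x))" if s: "\<bar>s\<bar> < r" for s
  proof -
    have sT: "\<bar>s\<bar> < T" using s r by simp
    have open_UT: "open (U \<times> {-T<..<T})" by (intro open_Times openU) auto
    have xs: "(x, s) \<in> U \<times> {-T<..<T}" using x sT by auto
    \<comment> \<open>The criterion used needs continuity of the partial derivative in the second
      variable only. Time goes into that slot, because its partial derivative is \<open>f\<close>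
      along the solution and already known to be continuous.\<close>
    have "((\<lambda>(x, t). y (t, x)) has_derivative (\<lambda>(w, \<tau>). \<eta> w s + blinfun_scaleR_left (f (s, x, y (s, x))) \<tau>))
        (at (x, s) within U \<times> {-T<..<T})"
    proof (rule has_derivative_partialsI[where f="\<lambda>x t. y (t, x)" and fy="\<lambda>x t. blinfun_scaleR_left (f (t, x, y (t, x)))"])
      show "((\<lambda>x. y (s, x)) has_derivative (\<lambda>w. \<eta> w s)) (at x within U)"
        by (rule has_derivative_at_withinI[OF y_has_derivative_param[OF f' contf' contc x r(1,2) c' \<eta> s]])
      show "((\<lambda>t. y (t, x)) has_derivative blinfun_apply (blinfun_scaleR_left (f (t, x, y (t, x))))) (at t within {-T<..<T})"
        if "x \<in> U" "t \<in> {-T<..<T}" for x t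
        using has_derivative_at_withinI[OF y_deriv[of t x, unfolded has_vector_derivative_def]] that by auto
      have "continuous_on (U \<times> {-T<..<T}) (\<lambda>(x, t). blinfun_scaleR_left (f (t, x, y (t, x))))"
        using bounded_linear.continuous_on[OF bounded_linear_blinfun_scaleR_left contfy] by (simp add: case_prod_beta)
      then show "continuous (at (x, s) within U \<times> {-T<..<T}) (\<lambda>(x, t). blinfun_scaleR_left (f (t, x, y (t, x))))"
        using xs continuous_on_eq_continuous_within by blast
    qed (use sT in auto)
    then have "((\<lambda>(x, t). y (t, x)) has_derivative (\<lambda>v. \<eta> (fst v) s + snd v *\<^sub>R f (s, x, y (s, x)))) (at (x, s))"
      unfolding case_prod_beta using at_within_open[OF xs open_UT] by simp
    moreover have "((\<lambda>z. (snd z, fst z)) has_derivative (\<lambda>z. (snd z, fst z))) (at (s, x))"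
      by (intro derivative_intros has_derivative_ident)
    ultimately show ?thesis
      using has_derivative_compose[of "\<lambda>z. (snd z, fst z)" "\<lambda>z. (snd z, fst z)" "(s, x)" UNIV "\<lambda>(x, t). y (t, x)"
        "\<lambda>v. \<eta> (fst v) s + snd v *\<^sub>R f (s, x, y (s, x))"]
      by (simp add: case_prod_beta' add.commute)
  qed
  have \<eta>_eq: "frechet_derivative y (at (s, x)) (0, w) = \<eta> w s" if "\<bar>s\<bar> < r" for s w
    using frechet_derivative_at[OF D[OF that], symmetric] by simp
  show "(y has_derivative (\<lambda>(\<tau>, w). \<tau> *\<^sub>R f (t, x, y (t, x)) + frechet_derivative y (at (t, x)) (0, w))) (at (t, x))"
    using D[OF r(3)] by (simp add: \<eta>_eq r(3))
  show "frechet_derivative y (at (0, x)) (0, w) = frechet_derivative c (at x) w"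
    using \<eta>_eq[of 0 w] r \<eta>(1) by simp
  have "(t, x, y (t, x)) \<in> {-T<..<T} \<times> U \<times> S" using t x y_in[OF t x] by auto
  then have "(\<eta> w has_vector_derivative frechet_derivative f (at (t, x, y (t, x))) (0, w, frechet_derivative y (at (t, x)) (0, w))) (at t)"
    using \<eta>(2)[OF r(3), of w] f'_eq \<eta>_eq[OF r(3)] by simp
  then show "((\<lambda>t. frechet_derivative y (at (t, x)) (0, w)) has_vector_derivative
      frechet_derivative f (at (t, x, y (t, x))) (0, w, frechet_derivative y (at (t, x)) (0, w))) (at t)"
    by (rule has_vector_derivative_transform_within_open[where S="{-r<..<r}"]) (use r \<eta>_eq in auto)
qed

end

text \<open>The time derivative of \<open>y\<close> is \<open>f\<close> along \<open>y\<close>, of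
  order \<open>k\<close> by composition. A parameter derivative is the solution of another family
  with the same \<open>T\<close>, \<open>L\<close> and \<open>U\<close>, to which the induction
  hypothesis applies; therefore \<open>f\<close>, \<open>c\<close>, \<open>y\<close> and
  \<open>S\<close> are generalized.\<close>

theorem ode_family_Ck:
  fixes f :: "real \<times> 'a::euclidean_space \<times> 'b::euclidean_space \<Rightarrow> 'b"
  assumes "ode_family f c y T L U S" "Ck_on k ({-T<..<T} \<times> U \<times> S) f" "Ck_on k U c"
  shows "Ck_on k ({-T<..<T} \<times> U) y"
  using assms
proof (induction k arbitrary: f c y S)
  case 0
  then show ?case using ode_family.y_continuous[OF 0(1)] by simp
next
  case (Suc k)
  interpret ode_family f c y T L U S by fact
  have openD: "open ({-T<..<T} \<times> U)" "open ({-T<..<T} \<times> U \<times> S)" "open ({-T<..<T} \<times> U \<times> (UNIV :: 'b set))"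
    by (intro open_Times openU openS open_UNIV open_greaterThanLessThan)+
  have f1: "Ck_on (Suc 0) ({-T<..<T} \<times> U \<times> S) f" by (rule Ck_on_mono[OF Suc.prems(2)]) simp
  have c1: "Ck_on (Suc 0) U c" by (rule Ck_on_mono[OF Suc.prems(3)]) simp
  have yk: "Ck_on k ({-T<..<T} \<times> U) y"
    by (rule Suc.IH[OF Suc.prems(1) Ck_on_Suc_imp[OF Suc.prems(2)] Ck_on_Suc_imp[OF Suc.prems(3)]])
  have mem: "(fst z, snd z, y z) \<in> {-T<..<T} \<times> U \<times> S" if "z \<in> {-T<..<T} \<times> U" for z
    using that y_in[of "fst z" "snd z"] by auto
  have \<eta>k: "Ck_on k ({-T<..<T} \<times> U) (\<lambda>z. frechet_derivative y (at z) (0, w))" for w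
  proof -
    \<comment> \<open>The linearized right-hand side is linear in the state \<open>v\<close>, hence
      Lipschitz on all of \<open>UNIV\<close>, which takes the place of \<open>S\<close>. Having
      absorbed a derivative of \<open>f\<close> and the map \<open>y\<close>, it has order
      \<open>k\<close>.\<close>
    define g where "g = (\<lambda>(t, x, v). frechet_derivative f (at (t, x, y (t, x))) (0, w, v))"
    have "ode_family g (\<lambda>x. frechet_derivative c (at x) w) (\<lambda>z. frechet_derivative y (at z) (0, w)) T L U UNIV"
    proof
      fix t x v1 v2 assume tx: "\<bar>t\<bar> < T" "x \<in> U"
      have mem': "(t, x, y (t, x)) \<in> {-T<..<T} \<times> U \<times> S" using y_in[OF tx] tx by (simp add: abs_less_iff minus_less_iff)
      note D = Ck_on_Suc_derivative[OF f1 mem']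
      have "g (t, x, v1) - g (t, x, v2) = frechet_derivative f (at (t, x, y (t, x))) (0, 0, v1 - v2)"
        using linear_diff[OF has_derivative_linear[OF D], of "(0, w, v1)" "(0, w, v2)"] by (simp add: g_def)
      then show "norm (g (t, x, v1) - g (t, x, v2)) \<le> L * norm (v1 - v2)"
        using lip_derivative[OF tx y_in[OF tx] D] by simp
    next
      fix t x assume tx: "\<bar>t\<bar> < T" "x \<in> U"
      show "((\<lambda>t. frechet_derivative y (at (t, x)) (0, w)) has_vector_derivative g (t, x, frechet_derivative y (at (t, x)) (0, w))) (at t)"
        unfolding g_def using y_has_derivative(2)[OF f1 c1 tx] by simp
    next
      fix x assume "x \<in> U"
      then show "frechet_derivative y (at (0, x)) (0, w) = frechet_derivative c (at x) w"
        using y_has_derivative(3)[OF f1 c1, of 0] T by simp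
    qed (use T L openU in auto)
    moreover have "Ck_on k ({-T<..<T} \<times> U \<times> UNIV) g"
    proof -
      let ?h = "\<lambda>z :: real \<times> 'a \<times> 'b. (fst z, fst (snd z))"
      have hk: "Ck_on k ({-T<..<T} \<times> U \<times> UNIV) ?h"
        using openD(3) by (intro Ck_on_bounded_linear) (auto intro!: bounded_linear_intros)
      have yh: "Ck_on k ({-T<..<T} \<times> U \<times> UNIV) (\<lambda>z. y (?h z))"
        by (rule Ck_on_compose[OF openD(3,1) hk yk]) auto
      have Hk: "Ck_on k ({-T<..<T} \<times> U \<times> UNIV) (\<lambda>z. (fst z, fst (snd z), y (?h z)))"
        using openD(3) by (intro Ck_on_Pair yh Ck_on_bounded_linear) (auto intro!: bounded_linear_intros)
      have Hmem: "(fst z, fst (snd z), y (?h z)) \<in> {-T<..<T} \<times> U \<times> S" if "z \<in> {-T<..<T} \<times> U \<times> UNIV" for z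
        using mem[of "?h z"] that by auto
      have "Ck_on k ({-T<..<T} \<times> U \<times> UNIV) (\<lambda>z. frechet_derivative f (at (fst z, fst (snd z), y (?h z))) (0, w, snd (snd z)))"
      proof (rule Ck_on_linear_family[where A="\<lambda>z. frechet_derivative f (at (fst z, fst (snd z), y (?h z)))", OF openD(3)])
        show "linear (frechet_derivative f (at (fst z, fst (snd z), y (?h z))))" if "z \<in> {-T<..<T} \<times> U \<times> UNIV" for z
          by (rule has_derivative_linear[OF Ck_on_Suc_derivative[OF f1 Hmem[OF that]]])
        have "Ck_on k ({-T<..<T} \<times> U \<times> S) (\<lambda>z. frechet_derivative f (at z) v)" for v
          using Suc.prems(2) unfolding Ck_on.simps by blast
        then show "Ck_on k ({-T<..<T} \<times> U \<times> UNIV) (\<lambda>z. frechet_derivative f (at (fst z, fst (snd z), y (?h z))) v)" for v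
          by (rule Ck_on_compose[OF openD(3,2) Hk _ Hmem])
        show "Ck_on k ({-T<..<T} \<times> U \<times> UNIV) (\<lambda>z. (0, w, snd (snd z) :: 'b))"
          using openD(3) by (intro Ck_on_Pair Ck_on_const Ck_on_bounded_linear) (auto intro!: bounded_linear_intros)
      qed
      then show ?thesis by (simp add: g_def case_prod_beta')
    qed
    moreover have "Ck_on k U (\<lambda>x. frechet_derivative c (at x) w)" using Suc.prems(3) by simp
    ultimately show ?thesis by (rule Suc.IH)
  qed
  have fyk: "Ck_on k ({-T<..<T} \<times> U) (\<lambda>z. f (fst z, snd z, y z))"
    by (rule Ck_on_compose[OF openD(1,2) _ Ck_on_Suc_imp[OF Suc.prems(2)] mem])
       (intro Ck_on_Pair yk Ck_on_bounded_linear bounded_linear_fst bounded_linear_snd openD(1))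
  show ?case
  proof (rule Ck_on_SucI[OF openD(1)])
    fix z assume "z \<in> {-T<..<T} \<times> U"
    then show "(y has_derivative (\<lambda>v. fst v *\<^sub>R f (fst z, snd z, y z) + frechet_derivative y (at z) (0, snd v))) (at z)"
      using y_has_derivative(1)[OF f1 c1, of "fst z" "snd z"] by (auto simp: case_prod_beta' abs_less_iff)
  next
    fix v show "Ck_on k ({-T<..<T} \<times> U) (\<lambda>z. fst v *\<^sub>R f (fst z, snd z, y z) + frechet_derivative y (at z) (0, snd v))"
      by (intro Ck_on_add Ck_on_scaleR Ck_on_const openD(1) fyk \<eta>k)
  qed
qed

text \<open>The initial point is the parameter of the family. The variational equation and its
  initial value are exported as well, since the method of characteristics needs them for its
  conserved pairing.\<close>

theorem smooth_local_flow:
  fixes g :: "'e::euclidean_space \<Rightarrow> 'e"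
  assumes S: "open S" and g: "smooth_on S g" and x0: "x0 \<in> S"
  obtains T U \<phi> where "0 < T" "open U" "x0 \<in> U" "smooth_on ({-T<..<T} \<times> U) \<phi>"
    "\<And>t x. \<bar>t\<bar> < T \<Longrightarrow> x \<in> U \<Longrightarrow> \<phi> (t, x) \<in> S" "\<And>x. x \<in> U \<Longrightarrow> \<phi> (0, x) = x"
    "\<And>t x. \<bar>t\<bar> < T \<Longrightarrow> x \<in> U \<Longrightarrow> ((\<lambda>t. \<phi> (t, x)) has_vector_derivative g (\<phi> (t, x))) (at t)"
    "\<And>t x w. \<bar>t\<bar> < T \<Longrightarrow> x \<in> U \<Longrightarrow> ((\<lambda>t. frechet_derivative \<phi> (at (t, x)) (0, w)) has_vector_derivative
      frechet_derivative g (at (\<phi> (t, x))) (frechet_derivative \<phi> (at (t, x)) (0, w))) (at t)"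
    "\<And>x w. x \<in> U \<Longrightarrow> frechet_derivative \<phi> (at (0, x)) (0, w) = w"
proof -
  have "Ck_on (Suc 0) S g" using g by (simp add: smooth_on_def del: Ck_on.simps)
  then obtain g' :: "'e \<Rightarrow> 'e \<Rightarrow>\<^sub>L 'e" where g': "\<And>x. x \<in> S \<Longrightarrow> (g has_derivative blinfun_apply (g' x)) (at x)"
    "continuous_on S g'" "\<And>x. x \<in> S \<Longrightarrow> blinfun_apply (g' x) = frechet_derivative g (at x)"
    by (rule C1_blinfun_derivative) blast
  obtain R0 where "0 < R0" "cball x0 R0 \<subseteq> S" using S x0 open_contains_cball by blast
  \<comment> \<open>Flow lines start in the ball of radius \<open>R\<close> and move by at most
    \<open>R\<close>, so they stay where the bounds on the ball of radius \<open>2 * R\<close>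
    hold.\<close>
  then obtain R where R: "0 < R" "cball x0 (2 * R) \<subseteq> S" using that[of "R0 / 2"] by simp
  have "bounded (g' ` cball x0 (2 * R))" "bounded (g ` cball x0 (2 * R))"
    using R(2) g'(2) smooth_on_continuous_on[OF g]
    by (auto intro!: compact_imp_bounded compact_continuous_image intro: continuous_on_subset)
  then obtain L B where L: "0 < L" "\<And>x. x \<in> cball x0 (2 * R) \<Longrightarrow> norm (g' x) \<le> L"
    and B: "0 < B" "\<And>x. x \<in> cball x0 (2 * R) \<Longrightarrow> norm (g x) \<le> B"
    unfolding bounded_pos by (metis imageI)
  \<comment> \<open>The two entries secure the contraction condition \<open>L * T \<le> 1/2\<close>
    and the displacement bound \<open>B * T \<le> R\<close>.\<close>
  define T where "T = min (1 / (2 * L)) (R / B)"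
  have T: "0 < T" "L * T \<le> 1/2" "B * T \<le> R"
  proof -
    show "0 < T" using L B R by (simp add: T_def)
    show "L * T \<le> 1/2" using L mult_left_mono[of T "1 / (2 * L)" L] by (simp add: T_def)
    show "B * T \<le> R" using B mult_left_mono[of T "R / B" B] by (simp add: T_def)
  qed
  have lip: "norm (g u - g v) \<le> L * norm (u - v)" if "u \<in> cball x0 (2 * R)" "v \<in> cball x0 (2 * R)" for u v
  proof (rule differentiable_bound[of "cball x0 (2 * R)" g "\<lambda>x. blinfun_apply (g' x)"])
    show "(g has_derivative blinfun_apply (g' x)) (at x within cball x0 (2 * R))" if "x \<in> cball x0 (2 * R)" for x
      using that R(2) by (intro has_derivative_at_withinI[OF g'(1)]) blast
    show "onorm (blinfun_apply (g' x)) \<le> L" if "x \<in> cball x0 (2 * R)" for x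
      using L(2)[OF that] by (simp add: norm_blinfun.rep_eq)
  qed (use that in auto)
  have sub: "cball x R \<subseteq> ball x0 (2 * R)" if "x \<in> ball x0 R" for x
  proof
    fix z assume "z \<in> cball x R"
    then show "z \<in> ball x0 (2 * R)" using that dist_triangle[of x0 z x] by simp
  qed
  have sub2: "cball x R \<subseteq> cball x0 (2 * R)" and sub3: "cball x R \<subseteq> S" if "x \<in> ball x0 R" for x
    using sub[OF that] R(2) ball_subset_cball by blast+
  have "\<exists>y. y 0 = x \<and> (\<forall>t. \<bar>t\<bar> < T \<longrightarrow> (y has_vector_derivative g (y t)) (at t) \<and> y t \<in> cball x R)"
    if x: "x \<in> ball x0 R" for x
  proof (rule ode_solution[of T x R "\<lambda>t. g" L B])
    show "continuous_on ({-T..T} \<times> cball x R) (\<lambda>(t, y). g y)"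
      unfolding case_prod_beta'
      by (intro continuous_on_compose2[OF smooth_on_continuous_on[OF g]] continuous_intros)
         (use sub3[OF x] in auto)
  qed (use T L(1) R(1) B(2) sub2[OF x] lip in \<open>auto simp: subset_iff\<close>)
  then obtain Y where Y: "\<And>x. x \<in> ball x0 R \<Longrightarrow> Y x 0 = x"
    "\<And>x t. x \<in> ball x0 R \<Longrightarrow> \<bar>t\<bar> < T \<Longrightarrow> (Y x has_vector_derivative g (Y x t)) (at t)"
    "\<And>x t. x \<in> ball x0 R \<Longrightarrow> \<bar>t\<bar> < T \<Longrightarrow> Y x t \<in> cball x R"
    by metis
  define \<phi> where "\<phi> = (\<lambda>(t, x). Y x t)"
  define f where "f = (\<lambda>z :: real \<times> 'e \<times> 'e. g (snd (snd z)))"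
  have fam: "ode_family f (\<lambda>x. x) \<phi> T L (ball x0 R) (ball x0 (2 * R))"
  proof
    show "norm (f (t, x, v) - f (t, x, w)) \<le> L * norm (v - w)" if "v \<in> ball x0 (2 * R)" "w \<in> ball x0 (2 * R)" for t x v w
      using lip[of v w] that by (simp add: f_def)
    show "\<phi> (t, x) \<in> ball x0 (2 * R)" if "\<bar>t\<bar> < T" "x \<in> ball x0 R" for t x
      using Y(3)[OF that(2,1)] sub[OF that(2)] by (auto simp: \<phi>_def)
  qed (use T L R Y in \<open>auto simp: \<phi>_def f_def\<close>)
  have sm: "smooth_on ({-T<..<T} \<times> ball x0 R \<times> ball x0 (2 * R)) f"
    unfolding f_def
    by (rule smooth_on_compose[OF _ S _ g])
       (use R(2) in \<open>auto intro!: open_Times smooth_on_bounded_linear bounded_linear_intros\<close>)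
  have smc: "smooth_on (ball x0 R) (\<lambda>x. x)" by (rule smooth_on_ident) simp
  interpret ode_family f "\<lambda>x. x" \<phi> T L "ball x0 R" "ball x0 (2 * R)" by (rule fam)
  have C1: "Ck_on (Suc 0) ({-T<..<T} \<times> ball x0 R \<times> ball x0 (2 * R)) f" "Ck_on (Suc 0) (ball x0 R) (\<lambda>x. x)"
    using sm smc unfolding smooth_on_def by blast+
  have inS: "\<phi> (t, x) \<in> S" if "\<bar>t\<bar> < T" "x \<in> ball x0 R" for t x
    using y_in[OF that] R(2) by auto
  show ?thesis
  proof (rule that[of T "ball x0 R" \<phi>])
    show "smooth_on ({-T<..<T} \<times> ball x0 R) \<phi>"
      using ode_family_Ck[OF fam] sm smc unfolding smooth_on_def by blast
    show "((\<lambda>t. \<phi> (t, x)) has_vector_derivative g (\<phi> (t, x))) (at t)" if "\<bar>t\<bar> < T" "x \<in> ball x0 R" for t x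
      using y_deriv[OF that] by (simp add: f_def)
    show "((\<lambda>t. frechet_derivative \<phi> (at (t, x)) (0, w)) has_vector_derivative
      frechet_derivative g (at (\<phi> (t, x))) (frechet_derivative \<phi> (at (t, x)) (0, w))) (at t)"
      if tx: "\<bar>t\<bar> < T" "x \<in> ball x0 R" for t x w
    proof -
      let ?z = "(t, x, \<phi> (t, x))"
      have "((\<lambda>z. snd (snd z)) has_derivative (\<lambda>z. snd (snd z))) (at ?z)"
        by (intro derivative_intros has_derivative_ident)
      then have "(f has_derivative (\<lambda>z. frechet_derivative g (at (\<phi> (t, x))) (snd (snd z)))) (at ?z)"
        unfolding f_def
        using has_derivative_compose[of "\<lambda>z. snd (snd z)" "\<lambda>z. snd (snd z)" ?z UNIV g] smooth_on_has_derivative[OF g inS[OF tx]] by simp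
      from frechet_derivative_at[OF this] show ?thesis
        using y_has_derivative(2)[OF C1 tx, of w] by (metis snd_conv)
    qed
    show "frechet_derivative \<phi> (at (0, x)) (0, w) = w" if "x \<in> ball x0 R" for x w
      using y_has_derivative(3)[OF C1 _ that, of 0 w] T frechet_derivative_at[OF has_derivative_ident[of "at x"]] by simp
  qed (use T R Y inS in \<open>auto simp: \<phi>_def\<close>)
qed

section \<open>Local solutions of Hamilton--Jacobi equations\<close>

text \<open>The Riesz representation in coordinates; it turns partial differentials into the vectors
  that enter Hamilton's equations and the Legendre transformation.\<close>

lemma inner_sum_functional:
  fixes D :: "'a::euclidean_space \<Rightarrow> real"
  assumes "linear D" shows "(\<Sum>b\<in>Basis. D b *\<^sub>R b) \<bullet> v = D v"
  unfolding inner_sum_left inner_scaleR_left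
  by (subst linear_euclidean_expand[OF assms, of v]) (auto intro!: sum.cong simp: inner_commute)

lemma frechet_derivative_apply: "(f has_derivative D) (at x) \<Longrightarrow> frechet_derivative f (at x) v = D v"
  using frechet_derivative_at by metis

lemma constant_on_interval:
  fixes u :: "real \<Rightarrow> 'a::real_normed_vector"
  assumes "\<And>t. \<bar>t\<bar> < T \<Longrightarrow> (u has_vector_derivative 0) (at t)" "\<bar>t\<bar> < T"
  shows "u t = u 0"
proof -
  have "norm (u t - u 0) \<le> 0 * \<bar>t\<bar>"
    by (rule has_vector_derivative_norm_bound[where r="\<bar>t\<bar>" and u'="\<lambda>t. 0"])
       (use assms in \<open>auto intro: has_vector_derivative_at_within\<close>)
  then show ?thesis by simp
qed

text \<open>The method of characteristics. As \<open>H\<close> is homogeneous of degree one in the momentum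
  (\<open>euler\<close>), the solution is the time at which the characteristic through a point left the
  initial hypersurface. That hypersurface need not be parametrized: adding its equation as a last
  component to \<open>(s, t) \<mapsto> x(t, s)\<close> gives a local diffeomorphism.\<close>

theorem eikonal_local_solution:
  fixes H :: "'a::euclidean_space \<times> 'a \<Rightarrow> real" and f :: "'a \<Rightarrow> real" and q0 :: "'a \<Rightarrow> 'a"
  assumes D: "open D" "smooth_on D H" and N: "open N" "x0 \<in> N"
    and f: "smooth_on N f" "f x0 = 0" and q0: "smooth_on N q0" "\<And>x. x \<in> N \<Longrightarrow> (x, q0 x) \<in> D"
    and H1: "\<And>x. x \<in> N \<Longrightarrow> f x = 0 \<Longrightarrow> H (x, q0 x) = 1"
    and conormal: "\<And>x v. x \<in> N \<Longrightarrow> f x = 0 \<Longrightarrow> frechet_derivative f (at x) v = 0 \<Longrightarrow> q0 x \<bullet> v = 0"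
    and euler: "\<And>x p. (x, p) \<in> D \<Longrightarrow> frechet_derivative H (at (x, p)) (0, p) = H (x, p)"
  obtains N' P \<rho> where "open N'" "x0 \<in> N'" "N' \<subseteq> N" "smooth_on N' \<rho>" "smooth_on N' P"
    "\<And>x. x \<in> N' \<Longrightarrow> (x, P x) \<in> D" "\<And>x. x \<in> N' \<Longrightarrow> H (x, P x) = 1"
    "\<And>x v. x \<in> N' \<Longrightarrow> frechet_derivative \<rho> (at x) v = P x \<bullet> v"
    "\<And>x. x \<in> N' \<Longrightarrow> \<rho> x = 0 \<longleftrightarrow> f x = 0" "\<And>x. x \<in> N' \<Longrightarrow> f x = 0 \<Longrightarrow> P x = q0 x"
proof -
  note H' = smooth_on_has_derivative[OF D(2)]
  note linH = has_derivative_linear[OF H']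
  define Hx where "Hx = (\<lambda>z. \<Sum>b\<in>Basis. frechet_derivative H (at z) (b, 0) *\<^sub>R b)"
  define Hq where "Hq = (\<lambda>z. \<Sum>b\<in>Basis. frechet_derivative H (at z) (0, b) *\<^sub>R b)"
  have Hx: "Hx z \<bullet> v = frechet_derivative H (at z) (v, 0)" if "z \<in> D" for z v
    unfolding Hx_def
    by (rule inner_sum_functional[of "\<lambda>v. frechet_derivative H (at z) (v, 0)"])
       (use linear_compose[of "\<lambda>v. (v, 0)", OF _ linH[OF that]] in \<open>auto simp: o_def linear_iff\<close>)
  have Hq: "Hq z \<bullet> v = frechet_derivative H (at z) (0, v)" if "z \<in> D" for z v
    unfolding Hq_def
    by (rule inner_sum_functional[of "\<lambda>v. frechet_derivative H (at z) (0, v)"])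
       (use linear_compose[of "\<lambda>v. (0, v)", OF _ linH[OF that]] in \<open>auto simp: o_def linear_iff\<close>)
  have H'_eq: "frechet_derivative H (at z) v = Hx z \<bullet> fst v + Hq z \<bullet> snd v" if "z \<in> D" for z v
    using linear_add[OF linH[OF that], of "(fst v, 0)" "(0, snd v)"] Hx[OF that] Hq[OF that] by simp
  have smHx: "smooth_on D Hx" and smHq: "smooth_on D Hq"
    unfolding Hx_def Hq_def
    by (intro smooth_on_sum smooth_on_scaleR smooth_on_const smooth_on_frechet_derivative D)+
  have eulerq: "snd z \<bullet> Hq z = H z" if "z \<in> D" for z
    using euler[of "fst z" "snd z"] Hq[OF that, of "snd z"] that by (simp add: inner_commute)
  \<comment> \<open>Differentiate the identity \<open>snd z \<bullet> Hq z = H z\<close>: the terms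
    \<open>snd v \<bullet> Hq z\<close> on both sides cancel and the derivative of \<open>Hq\<close>
    remains, paired with the momentum.\<close>
  have eulerD: "snd z \<bullet> frechet_derivative Hq (at z) v = Hx z \<bullet> fst v" if z: "z \<in> D" for z v
  proof -
    have "((\<lambda>z. snd z \<bullet> Hq z) has_derivative (\<lambda>v. snd z \<bullet> frechet_derivative Hq (at z) v + snd v \<bullet> Hq z)) (at z)"
      by (intro has_derivative_inner has_derivative_snd has_derivative_ident smooth_on_has_derivative[OF smHq z])
    then have "(H has_derivative (\<lambda>v. snd z \<bullet> frechet_derivative Hq (at z) v + snd v \<bullet> Hq z)) (at z)"
      by (rule has_derivative_transform_within_open[OF _ D(1) z eulerq])
    from frechet_derivative_apply[OF this, of v] show ?thesis
      using H'_eq[OF z, of v] by (simp add: inner_commute)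
  qed
  define g where "g = (\<lambda>z. (Hq z, - Hx z))"
  have smg: "smooth_on D g" unfolding g_def by (intro smooth_on_Pair smooth_on_minus smHx smHq D(1))
  have g': "frechet_derivative g (at z) v = (frechet_derivative Hq (at z) v, - frechet_derivative Hx (at z) v)" if "z \<in> D" for z v
  proof -
    have "(g has_derivative (\<lambda>v. (frechet_derivative Hq (at z) v, - frechet_derivative Hx (at z) v))) (at z)"
      unfolding g_def by (intro has_derivative_Pair has_derivative_minus smooth_on_has_derivative[OF smHq that] smooth_on_has_derivative[OF smHx that])
    from frechet_derivative_apply[OF this] show ?thesis .
  qed
  obtain T U \<phi> where T: "0 < T" and U: "open U" "(x0, q0 x0) \<in> U" and sm\<phi>: "smooth_on ({-T<..<T} \<times> U) \<phi>"
    and \<phi>D: "\<And>t x. \<bar>t\<bar> < T \<Longrightarrow> x \<in> U \<Longrightarrow> \<phi> (t, x) \<in> D" and \<phi>0: "\<And>x. x \<in> U \<Longrightarrow> \<phi> (0, x) = x"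
    and \<phi>t: "\<And>t x. \<bar>t\<bar> < T \<Longrightarrow> x \<in> U \<Longrightarrow> ((\<lambda>t. \<phi> (t, x)) has_vector_derivative g (\<phi> (t, x))) (at t)"
    and \<phi>'t: "\<And>t x w. \<bar>t\<bar> < T \<Longrightarrow> x \<in> U \<Longrightarrow> ((\<lambda>t. frechet_derivative \<phi> (at (t, x)) (0, w)) has_vector_derivative
      frechet_derivative g (at (\<phi> (t, x))) (frechet_derivative \<phi> (at (t, x)) (0, w))) (at t)"
    and \<phi>'0: "\<And>x w. x \<in> U \<Longrightarrow> frechet_derivative \<phi> (at (0, x)) (0, w) = w"
    by (rule smooth_local_flow[OF D(1) smg q0(2)[OF N(2)]]) (rule that)
  have \<phi>': "(\<phi> has_derivative frechet_derivative \<phi> (at (t, x))) (at (t, x))" if "\<bar>t\<bar> < T" "x \<in> U" for t x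
    by (rule smooth_on_has_derivative[OF sm\<phi>]) (use that in auto)
  have \<phi>'_eq: "frechet_derivative \<phi> (at (t, x)) (\<tau>, w) = \<tau> *\<^sub>R g (\<phi> (t, x)) + frechet_derivative \<phi> (at (t, x)) (0, w)"
    if tx: "\<bar>t\<bar> < T" "x \<in> U" for t x \<tau> w
  proof -
    have "((\<lambda>t. (t, x)) has_derivative (\<lambda>\<tau>. (\<tau>, 0))) (at t)"
      by (intro has_derivative_Pair has_derivative_ident has_derivative_const)
    from has_derivative_compose[OF this \<phi>'[OF tx]]
    have "((\<lambda>t. \<phi> (t, x)) has_derivative (\<lambda>\<tau>. frechet_derivative \<phi> (at (t, x)) (\<tau>, 0))) (at t)" .
    from fun_cong[OF has_derivative_unique[OF this \<phi>t[OF tx, unfolded has_vector_derivative_def]], of \<tau>]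
    have "frechet_derivative \<phi> (at (t, x)) (\<tau>, 0) = \<tau> *\<^sub>R g (\<phi> (t, x))" .
    then show ?thesis
      using linear_add[OF has_derivative_linear[OF \<phi>'[OF tx]], of "(\<tau>, 0)" "(0, w)"] by simp
  qed
  have conserved: "H (\<phi> (t, x)) = H x" if t: "\<bar>t\<bar> < T" and x: "x \<in> U" for t x
  proof -
    have "((\<lambda>t. H (\<phi> (t, x))) has_vector_derivative 0) (at t)" if t: "\<bar>t\<bar> < T" for t
    proof -
      have "((\<lambda>t. H (\<phi> (t, x))) has_vector_derivative frechet_derivative H (at (\<phi> (t, x))) (g (\<phi> (t, x)))) (at t)"
        using has_derivative_compose[OF \<phi>t[OF t x, unfolded has_vector_derivative_def] H'[OF \<phi>D[OF t x]]]
        unfolding has_vector_derivative_def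
        by (simp add: linear_scale[OF linH[OF \<phi>D[OF t x]]])
      moreover have "frechet_derivative H (at (\<phi> (t, x))) (g (\<phi> (t, x))) = 0"
        unfolding H'_eq[OF \<phi>D[OF t x]] g_def by (simp add: inner_commute)
      ultimately show ?thesis by simp
    qed
    from constant_on_interval[OF this t] show ?thesis using \<phi>0[OF x] by simp
  qed
  \<comment> \<open>The canonical one-form is preserved by the flow of a Hamiltonian that is
    homogeneous of degree one. The derivative of the pairing is \<open>p\<close> against the
    derivative of \<open>Hq\<close>, minus \<open>Hx\<close> against the varied position, which is
    \<open>0\<close> by \<open>eulerD\<close>.\<close>
  have lagrange: "snd (\<phi> (t, x)) \<bullet> fst (frechet_derivative \<phi> (at (t, x)) (0, w)) = snd x \<bullet> fst w"
    if t: "\<bar>t\<bar> < T" and x: "x \<in> U" for t x w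
  proof -
    have "((\<lambda>t. snd (\<phi> (t, x)) \<bullet> fst (frechet_derivative \<phi> (at (t, x)) (0, w))) has_vector_derivative 0) (at t)"
      if t: "\<bar>t\<bar> < T" for t
    proof -
      let ?z = "\<phi> (t, x)" and ?\<eta> = "frechet_derivative \<phi> (at (t, x)) (0, w)"
      have "((\<lambda>t. snd (\<phi> (t, x)) \<bullet> fst (frechet_derivative \<phi> (at (t, x)) (0, w))) has_derivative
        (\<lambda>h. snd ?z \<bullet> fst (h *\<^sub>R frechet_derivative g (at ?z) ?\<eta>) + snd (h *\<^sub>R g ?z) \<bullet> fst ?\<eta>)) (at t)"
        by (intro has_derivative_inner has_derivative_snd has_derivative_fst
            \<phi>t[OF t x, unfolded has_vector_derivative_def] \<phi>'t[OF t x, unfolded has_vector_derivative_def])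
      then show ?thesis
        unfolding has_vector_derivative_def g'[OF \<phi>D[OF t x]] using eulerD[OF \<phi>D[OF t x]]
        by (simp add: g_def)
    qed
    from constant_on_interval[OF this t] show ?thesis using \<phi>0[OF x] \<phi>'0[OF x] by simp
  qed
  define N1 where "N1 = {s \<in> N. (s, q0 s) \<in> U}"
  have open_N1: "open N1"
  proof -
    have "continuous_on N (\<lambda>s. (s, q0 s))" by (intro continuous_intros smooth_on_continuous_on[OF q0(1)])
    from continuous_open_preimage[OF this N(1) U(1)] show ?thesis by (simp add: N1_def vimage_def Int_def)
  qed
  have x0N1: "x0 \<in> N1" using U N by (simp add: N1_def)
  define W where "W = N1 \<times> {-T<..<T}"
  have openW: "open W" unfolding W_def by (intro open_Times open_N1) auto
  \<comment> \<open>Characteristics are launched from all points near \<open>x0\<close>, though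
    \<open>H = 1\<close> is known only where \<open>f\<close> vanishes. Preimages under
    \<open>G\<close> of points \<open>(x, 0)\<close> start exactly there.\<close>
  define \<Psi> where "\<Psi> = (\<lambda>z :: 'a \<times> real. \<phi> (snd z, (fst z, q0 (fst z))))"
  define G where "G = (\<lambda>z :: 'a \<times> real. (fst (\<Psi> z), f (fst z)))"
  note fst_smooth = smooth_on_fst[OF openW] smooth_on_snd[OF openW]
  have WN: "fst z \<in> N" "\<bar>snd z\<bar> < T" "(fst z, q0 (fst z)) \<in> U" if "z \<in> W" for z
    using that by (auto simp: W_def N1_def)
  have smq: "smooth_on W (\<lambda>z. q0 (fst z))" by (rule smooth_on_compose[OF openW N(1) fst_smooth(1) q0(1) WN(1)])
  have smf: "smooth_on W (\<lambda>z. f (fst z))" by (rule smooth_on_compose[OF openW N(1) fst_smooth(1) f(1) WN(1)])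
  have sm\<Psi>: "smooth_on W \<Psi>"
    unfolding \<Psi>_def
  proof (rule smooth_on_compose[OF openW _ _ sm\<phi>])
    show "smooth_on W (\<lambda>z. (snd z, fst z, q0 (fst z)))" by (intro smooth_on_Pair openW fst_smooth smq)
  qed (use WN U in \<open>auto intro!: open_Times simp: abs_less_iff minus_less_iff\<close>)
  have smG: "smooth_on W G"
    unfolding G_def by (intro smooth_on_Pair openW smf smooth_on_bounded_linear_comp[OF bounded_linear_fst openW sm\<Psi>])
  have G': "frechet_derivative G (at z) (\<sigma>, \<tau>) =
     (\<tau> *\<^sub>R Hq (\<Psi> z) + fst (frechet_derivative \<phi> (at (snd z, (fst z, q0 (fst z)))) (0, \<sigma>, frechet_derivative q0 (at (fst z)) \<sigma>)),
      frechet_derivative f (at (fst z)) \<sigma>)" if z: "z \<in> W" for z \<sigma> \<tau>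
  proof -
    let ?w = "(snd z, fst z, q0 (fst z))"
    have 0: "(fst has_derivative fst) (at z)" "(snd has_derivative snd) (at z)"
      by (intro has_derivative_fst has_derivative_snd has_derivative_ident)+
    have 1: "((\<lambda>z. q0 (fst z)) has_derivative (\<lambda>v. frechet_derivative q0 (at (fst z)) (fst v))) (at z)"
      by (rule has_derivative_compose[OF 0(1) smooth_on_has_derivative[OF q0(1) WN(1)[OF z]]])
    have 2: "((\<lambda>z. f (fst z)) has_derivative (\<lambda>v. frechet_derivative f (at (fst z)) (fst v))) (at z)"
      by (rule has_derivative_compose[OF 0(1) smooth_on_has_derivative[OF f(1) WN(1)[OF z]]])
    have 3: "(\<Psi> has_derivative (\<lambda>v. frechet_derivative \<phi> (at ?w) (snd v, fst v, frechet_derivative q0 (at (fst z)) (fst v)))) (at z)"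
      unfolding \<Psi>_def
      by (rule has_derivative_compose[OF has_derivative_Pair[OF 0(2) has_derivative_Pair[OF 0(1) 1]] \<phi>'[OF WN(2,3)[OF z]]])
    have "(G has_derivative (\<lambda>v. (fst (frechet_derivative \<phi> (at ?w) (snd v, fst v, frechet_derivative q0 (at (fst z)) (fst v))),
        frechet_derivative f (at (fst z)) (fst v)))) (at z)"
      unfolding G_def by (intro has_derivative_Pair has_derivative_fst 2 3)
    from frechet_derivative_apply[OF this, of "(\<sigma>, \<tau>)"]
    have "frechet_derivative G (at z) (\<sigma>, \<tau>) = (fst (frechet_derivative \<phi> (at ?w) (\<tau>, \<sigma>, frechet_derivative q0 (at (fst z)) \<sigma>)),
        frechet_derivative f (at (fst z)) \<sigma>)" by simp
    then show ?thesis
      using \<phi>'_eq[OF WN(2,3)[OF z], of \<tau>] by (simp add: g_def \<Psi>_def)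
  qed
  have x0W: "(x0, 0) \<in> W" using x0N1 T by (simp add: W_def)
  have \<Psi>0: "\<Psi> (s, 0) = (s, q0 s)" if "s \<in> N1" for s using that \<phi>0 by (simp add: \<Psi>_def N1_def)
  \<comment> \<open>Transversality: \<open>q0 x0 \<bullet> Hq = H = 1\<close> while
    \<open>q0 x0\<close> annihilates the kernel of \<open>df\<close>, so \<open>Hq\<close> lies
    outside that kernel and the time component must vanish.\<close>
  have inj: "v = 0" if v: "frechet_derivative G (at (x0, 0)) v = 0" for v
  proof -
    obtain \<sigma> \<tau> where v_eq: "v = (\<sigma>, \<tau>)" by (cases v)
    let ?h = "Hq (x0, q0 x0)"
    have 1: "\<tau> *\<^sub>R ?h + \<sigma> = 0" "frechet_derivative f (at x0) \<sigma> = 0"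
      using v G'[OF x0W, of \<sigma> \<tau>] \<phi>'0[of "(x0, q0 x0)"] U \<Psi>0[OF x0N1] by (auto simp: v_eq zero_prod_def)
    have "q0 x0 \<bullet> ?h = 1" using eulerq[OF q0(2)[OF N(2)]] H1[OF N(2) f(2)] by simp
    then have "frechet_derivative f (at x0) ?h \<noteq> 0" using conormal[OF N(2) f(2), of ?h] by auto
    moreover have "\<sigma> = - \<tau> *\<^sub>R ?h" using 1(1) by (simp add: add_eq_0_iff)
    then have "\<tau> * frechet_derivative f (at x0) ?h = 0"
      using 1(2) linear_scale[OF has_derivative_linear[OF smooth_on_has_derivative[OF f(1) N(2)]], of "- \<tau>" ?h] by simp
    ultimately have "\<tau> = 0" by simp
    then show ?thesis using 1(1) by (simp add: v_eq zero_prod_def)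
  qed
  obtain U' V Gi where U': "open U'" "U' \<subseteq> W" "(x0, 0) \<in> U'" and V: "open V" "G (x0, 0) \<in> V"
    and hom: "homeomorphism U' V G Gi" and smGi: "smooth_on V Gi"
    and GGi': "\<And>y v. y \<in> V \<Longrightarrow> frechet_derivative G (at (Gi y)) (frechet_derivative Gi (at y) v) = v"
    by (rule smooth_inverse_function[OF openW smG x0W inj]) (assumption, rule that)
  have Gi: "Gi y \<in> U'" "G (Gi y) = y" if "y \<in> V" for y
    using hom that by (auto simp: homeomorphism_def)
  have GiG: "Gi (G z) = z" if "z \<in> U'" for z using hom that by (auto simp: homeomorphism_def)
  have G0: "G (s, 0) = (s, 0)" if "s \<in> N1" "f s = 0" for s
    using \<Psi>0[OF that(1)] that(2) by (simp add: G_def)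
  \<comment> \<open>Membership of \<open>(x, 0)\<close> in \<open>V\<close> makes \<open>Gi\<close>
    available. Membership in \<open>U'\<close>, where \<open>(x, 0)\<close> means starting at
    \<open>x\<close> with time \<open>0\<close>, lets points with \<open>f x = 0\<close> be
    recognized as their own starting points.\<close>
  define N' where "N' = {x. (x, 0) \<in> V} \<inter> {x. (x, 0) \<in> U'}"
  have openN': "open N'"
  proof -
    have "continuous_on UNIV (\<lambda>x::'a. (x, 0::real))" by (intro continuous_intros)
    then have "open ((\<lambda>x::'a. (x, 0::real)) -` V)" "open ((\<lambda>x::'a. (x, 0::real)) -` U')"
      using V(1) U'(1) by (auto intro: open_vimage)
    then show ?thesis by (simp add: N'_def vimage_def open_Int)
  qed
  have N'N1: "x \<in> N1" if "x \<in> N'" for x using that U'(2) by (auto simp: N'_def W_def)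
  define K where "K = (\<lambda>x. Gi (x, 0))"
  have K: "K x \<in> W" "fst (\<Psi> (K x)) = x" "f (fst (K x)) = 0" if "x \<in> N'" for x
  proof -
    have "(x, 0) \<in> V" using that by (simp add: N'_def)
    from Gi[OF this] show "K x \<in> W" "fst (\<Psi> (K x)) = x" "f (fst (K x)) = 0"
      using U'(2) by (auto simp: K_def G_def)
  qed
  have smK: "smooth_on N' K"
    unfolding K_def
    by (rule smooth_on_compose[OF openN' V(1) _ smGi])
       (auto simp: N'_def[symmetric] intro!: smooth_on_Pair openN' smooth_on_ident smooth_on_const, simp add: N'_def)
  define \<rho> where "\<rho> = (\<lambda>x. snd (K x))"
  define P where "P = (\<lambda>x. snd (\<Psi> (K x)))"
  have xP: "\<Psi> (K x) = (x, P x)" if "x \<in> N'" for x using K(2)[OF that] by (simp add: P_def prod_eq_iff)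
  have KN: "fst (K x) \<in> N" "\<bar>snd (K x)\<bar> < T" "(fst (K x), q0 (fst (K x))) \<in> U" if "x \<in> N'" for x
    using WN[OF K(1)[OF that]] by auto
  have xPD: "(x, P x) \<in> D" if "x \<in> N'" for x
    using \<phi>D[OF KN(2,3)[OF that]] xP[OF that] by (simp add: \<Psi>_def)
  have HP: "H (x, P x) = 1" if "x \<in> N'" for x
    using conserved[OF KN(2,3)[OF that]] xP[OF that] H1[OF KN(1) K(3), OF that that] by (simp add: \<Psi>_def)
  show ?thesis
  proof (rule that[of N' \<rho> P])
    show "x0 \<in> N'" using V(2) U'(3) G0[OF x0N1 f(2)] by (simp add: N'_def)
    show "N' \<subseteq> N" using N'N1 by (auto simp: N1_def)
    show "smooth_on N' \<rho>" unfolding \<rho>_def by (rule smooth_on_bounded_linear_comp[OF bounded_linear_snd openN' smK])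
    show "smooth_on N' P" unfolding P_def
      by (intro smooth_on_bounded_linear_comp[OF bounded_linear_snd openN'] smooth_on_compose[OF openN' openW smK sm\<Psi> K(1)])
    show "frechet_derivative \<rho> (at x) v = P x \<bullet> v" if x: "x \<in> N'" for x v
    proof -
      have xV: "(x, 0) \<in> V" using x by (simp add: N'_def)
      obtain \<sigma> \<tau> where st: "frechet_derivative Gi (at (x, 0)) (v, 0) = (\<sigma>, \<tau>)" by (cases "frechet_derivative Gi (at (x, 0)) (v, 0)")
      have "((\<lambda>x. (x, 0)) has_derivative (\<lambda>v. (v, 0))) (at x)"
        by (intro has_derivative_Pair has_derivative_ident has_derivative_const)
      from has_derivative_snd[OF has_derivative_compose[OF this smooth_on_has_derivative[OF smGi xV]]]
      have "(\<rho> has_derivative (\<lambda>v. snd (frechet_derivative Gi (at (x, 0)) (v, 0)))) (at x)"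
        by (simp add: \<rho>_def K_def)
      from frechet_derivative_apply[OF this, of v] have \<rho>': "frechet_derivative \<rho> (at x) v = \<tau>" using st by simp
      let ?w = "(snd (K x), fst (K x), q0 (fst (K x)))" and ?\<zeta> = "(\<sigma>, frechet_derivative q0 (at (fst (K x))) \<sigma>)"
      have "frechet_derivative G (at (K x)) (\<sigma>, \<tau>) = (v, 0)"
        using GGi'[OF xV, of "(v, 0)"] st by (simp add: K_def)
      \<comment> \<open>A vector \<open>v\<close> at \<open>x\<close> splits into
        \<open>\<tau>\<close> times the characteristic velocity and the transport of a vector
        tangent to the initial hypersurface. The momentum pairs to \<open>H = 1\<close> with the
        velocity and, by \<open>lagrange\<close> and \<open>conormal\<close>, to \<open>0\<close>
        with the other part.\<close>
      then have eq: "v = \<tau> *\<^sub>R Hq (x, P x) + fst (frechet_derivative \<phi> (at ?w) (0, ?\<zeta>))"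
        and tan: "frechet_derivative f (at (fst (K x))) \<sigma> = 0"
        using G'[OF K(1)[OF x]] xP[OF x] by auto
      have "P x \<bullet> fst (frechet_derivative \<phi> (at ?w) (0, ?\<zeta>)) = q0 (fst (K x)) \<bullet> \<sigma>"
        using lagrange[OF KN(2,3)[OF x], of ?\<zeta>] xP[OF x] by (simp add: \<Psi>_def)
      also have "\<dots> = 0" by (rule conormal[OF KN(1)[OF x] K(3)[OF x] tan])
      finally have "P x \<bullet> v = \<tau>"
        using eulerq[OF xPD[OF x]] HP[OF x] by (subst eq) (simp add: inner_add_right)
      then show ?thesis using \<rho>' by simp
    qed
    show \<rho>_iff: "\<rho> x = 0 \<longleftrightarrow> f x = 0" if x: "x \<in> N'" for x
    proof
      assume "\<rho> x = 0"
      then have "K x = (fst (K x), 0)" by (simp add: \<rho>_def prod_eq_iff)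
      then have "fst (K x) \<in> N1" "\<Psi> (K x) = (fst (K x), q0 (fst (K x)))"
        using K(1)[OF x] \<Psi>0 by (auto simp: W_def)
      then show "f x = 0" using K(2,3)[OF x] by simp
    next
      assume "f x = 0"
      then show "\<rho> x = 0" using GiG[of "(x, 0)"] G0[OF N'N1[OF x]] x by (simp add: \<rho>_def K_def N'_def)
    qed
    show "P x = q0 x" if x: "x \<in> N'" and fx: "f x = 0" for x
      using GiG[of "(x, 0)"] G0[OF N'N1[OF x] fx] x \<Psi>0[OF N'N1[OF x]] by (simp add: P_def K_def N'_def)
  qed (use openN' xPD HP in auto)
qed

section \<open>Minkowski norms\<close>

lemma directional_deriv:
  fixes G :: "'a::euclidean_space \<Rightarrow> real"
  assumes "(G has_derivative D) (at v)"
  shows "((\<lambda>t. G (v + t *\<^sub>R u)) has_real_derivative D u) (at 0)"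
proof -
  have "((\<lambda>t. v + t *\<^sub>R u) has_derivative (\<lambda>t. t *\<^sub>R u)) (at 0)" by (auto intro!: derivative_eq_intros)
  moreover have "(G has_derivative D) (at (v + 0 *\<^sub>R u))" using assms by simp
  ultimately have "((\<lambda>t. G (v + t *\<^sub>R u)) has_derivative (\<lambda>t. D (t *\<^sub>R u))) (at 0)" by (rule has_derivative_compose)
  moreover have "(\<lambda>t. D (t *\<^sub>R u)) = (*) (D u)"
    using linear_scale[OF has_derivative_linear[OF assms]] by (auto simp: mult.commute)
  ultimately show ?thesis by (simp add: has_field_derivative_def)
qed

text \<open>Translates the iterated \<open>deriv\<close> of the fundamental tensor into Frechet
  derivatives. The inner derivative has to be known for all \<open>t2\<close> near \<open>0\<close>,
  so the equality is established eventually and not only at \<open>0\<close>.\<close>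

lemma mixed_deriv:
  fixes G :: "'a::euclidean_space \<Rightarrow> real"
  assumes N: "open N" "v \<in> N" and G: "smooth_on N G"
  shows "deriv (\<lambda>t2. deriv (\<lambda>t1. G (v + t1 *\<^sub>R u1 + t2 *\<^sub>R u2)) 0) 0 =
    frechet_derivative (\<lambda>w. frechet_derivative G (at w) u1) (at v) u2"
proof -
  have "((\<lambda>t. v + t *\<^sub>R u2) \<longlongrightarrow> v + 0 *\<^sub>R u2) (nhds 0)" by (intro tendsto_intros filterlim_ident)
  then have ev: "\<forall>\<^sub>F t2 in nhds 0. v + t2 *\<^sub>R u2 \<in> N"
    by (rule topological_tendstoD) (use N in auto)
  have "\<forall>\<^sub>F t2 in nhds 0. deriv (\<lambda>t1. G (v + t1 *\<^sub>R u1 + t2 *\<^sub>R u2)) 0 = frechet_derivative G (at (v + t2 *\<^sub>R u2)) u1"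
    using ev
  proof eventually_elim
    case (elim t2)
    have "v + t1 *\<^sub>R u1 + t2 *\<^sub>R u2 = (v + t2 *\<^sub>R u2) + t1 *\<^sub>R u1" for t1 by simp
    then show ?case
      using DERIV_imp_deriv[OF directional_deriv[OF smooth_on_has_derivative[OF G elim]]] by presburger
  qed
  then have "deriv (\<lambda>t2. deriv (\<lambda>t1. G (v + t1 *\<^sub>R u1 + t2 *\<^sub>R u2)) 0) 0 =
      deriv (\<lambda>t2. frechet_derivative G (at (v + t2 *\<^sub>R u2)) u1) 0"
    by (intro deriv_cong_ev) auto
  also have "\<dots> = frechet_derivative (\<lambda>w. frechet_derivative G (at w) u1) (at v) u2"
    by (rule DERIV_imp_deriv[OF directional_deriv[OF smooth_on_has_derivative[OF smooth_on_frechet_derivative[OF G] N(2)]]])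
  finally show ?thesis .
qed

text \<open>Writing \<open>dG w v = 2 G w - dG w (w - v)\<close>, no symmetry of second derivatives is needed.\<close>

lemma euler_mixed_deriv:
  fixes G :: "'a::euclidean_space \<Rightarrow> real"
  assumes N: "open N" "v \<in> N" and G: "smooth_on N G"
    and euler: "\<And>w. w \<in> N \<Longrightarrow> frechet_derivative G (at w) w = 2 * G w"
  shows "deriv (\<lambda>t2. deriv (\<lambda>t1. G (v + t1 *\<^sub>R v + t2 *\<^sub>R u)) 0) 0 = frechet_derivative G (at v) u"
proof -
  let ?D = "frechet_derivative G"
  note G' = smooth_on_has_derivative[OF G]
  have "((\<lambda>w. \<Sum>b\<in>Basis. ((w - v) \<bullet> b) *\<^sub>R ?D (at w) b) has_derivative (\<lambda>h. \<Sum>b\<in>Basis. (h \<bullet> b) *\<^sub>R ?D (at v) b)) (at v)"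
  proof (intro has_derivative_sum has_derivative_scaleR_zero)
    fix b :: 'a
    show "((\<lambda>w. (w - v) \<bullet> b) has_derivative (\<lambda>h. h \<bullet> b)) (at v)" by (auto intro!: derivative_eq_intros)
    show "isCont (\<lambda>w. ?D (at w) b) v"
      using smooth_on_continuous_on[OF smooth_on_frechet_derivative[OF G]] N by (simp add: continuous_on_eq_continuous_at)
  qed simp
  then have "((\<lambda>w. 2 * G w - (\<Sum>b\<in>Basis. ((w - v) \<bullet> b) *\<^sub>R ?D (at w) b)) has_derivative
      (\<lambda>h. 2 * ?D (at v) h - (\<Sum>b\<in>Basis. (h \<bullet> b) *\<^sub>R ?D (at v) b))) (at v)"
    by (intro has_derivative_diff has_derivative_mult_right G' N)
  moreover have "(\<lambda>h. 2 * ?D (at v) h - (\<Sum>b\<in>Basis. (h \<bullet> b) *\<^sub>R ?D (at v) b)) = ?D (at v)"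
    using linear_euclidean_expand[OF has_derivative_linear[OF G'[OF N(2)]], symmetric] by auto
  ultimately have "((\<lambda>w. 2 * G w - (\<Sum>b\<in>Basis. ((w - v) \<bullet> b) *\<^sub>R ?D (at w) b)) has_derivative ?D (at v)) (at v)"
    by simp
  then have "((\<lambda>w. ?D (at w) v) has_derivative ?D (at v)) (at v)"
  proof (rule has_derivative_transform_within_open[OF _ N])
    fix w assume w: "w \<in> N"
    have "(\<Sum>b\<in>Basis. ((w - v) \<bullet> b) *\<^sub>R ?D (at w) b) = ?D (at w) (w - v)"
      by (rule linear_euclidean_expand[OF has_derivative_linear[OF G'[OF w]], symmetric])
    also have "\<dots> = 2 * G w - ?D (at w) v"
      using linear_diff[OF has_derivative_linear[OF G'[OF w]]] euler[OF w] by simp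
    finally show "2 * G w - (\<Sum>b\<in>Basis. ((w - v) \<bullet> b) *\<^sub>R ?D (at w) b) = ?D (at w) v" by simp
  qed
  then show ?thesis
    unfolding mixed_deriv[OF N G] by (rule frechet_derivative_apply)
qed

text \<open>The restriction of a Finsler metric to one tangent space. The expression in
  \<open>pos_def\<close> is twice the fundamental tensor on the diagonal, kept as an iterated
  \<open>deriv\<close> to match the definition on the manifold.\<close>

locale minkowski_norm =
  fixes f :: "'a::euclidean_space \<Rightarrow> real"
  assumes smooth: "smooth_on (- {0}) f"
    and homogeneous: "\<And>r v. r > 0 \<Longrightarrow> f (r *\<^sub>R v) = r * f v"
    and nonneg: "\<And>v. f v \<ge> 0"
    and pos_def: "\<And>v u. v \<noteq> 0 \<Longrightarrow> u \<noteq> 0 \<Longrightarrow> deriv (\<lambda>t2. deriv (\<lambda>t1. (f (v + t1 *\<^sub>R u + t2 *\<^sub>R u))\<^sup>2) 0) 0 > 0"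
begin

abbreviation df :: "'a \<Rightarrow> 'a \<Rightarrow> real" where "df v \<equiv> frechet_derivative f (at v)"

lemma zero: "f 0 = 0"
  using homogeneous[of 2 0] by simp

lemma open_ne: "open (- {0::'a})" by auto

lemma f': "v \<noteq> 0 \<Longrightarrow> (f has_derivative df v) (at v)"
  by (rule smooth_on_has_derivative[OF smooth]) auto

lemma linear_df: "v \<noteq> 0 \<Longrightarrow> linear (df v)"
  using f' has_derivative_linear by blast

lemma euler: "v \<noteq> 0 \<Longrightarrow> df v v = f v"
proof -
  assume v: "v \<noteq> 0"
  have "((\<lambda>t. f (v + t *\<^sub>R v)) has_real_derivative df v v) (at 0)"
    by (rule directional_deriv[OF f'[OF v]])
  moreover have "((\<lambda>t. f (v + t *\<^sub>R v)) has_real_derivative f v) (at 0)"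
  proof (rule has_field_derivative_transform_within_open[where S="{-1<..}" and f="\<lambda>t. (1 + t) * f v"])
    show "((\<lambda>t. (1 + t) * f v) has_real_derivative f v) (at 0)" by (auto intro!: derivative_eq_intros)
    show "(1 + t) * f v = f (v + t *\<^sub>R v)" if "t \<in> {-1<..}" for t
      using homogeneous[of "1 + t" v] that by (simp add: scaleR_add_left)
  qed auto
  ultimately show ?thesis by (rule DERIV_unique)
qed

lemma smooth_sq: "smooth_on (- {0}) (\<lambda>v. (f v)\<^sup>2)"
  by (rule smooth_on_power2[OF open_ne smooth])

lemma frechet_sq: "v \<noteq> 0 \<Longrightarrow> frechet_derivative (\<lambda>v. (f v)\<^sup>2) (at v) u = 2 * f v * df v u"
proof -
  assume "v \<noteq> 0"
  then have "((\<lambda>v. (f v)\<^sup>2) has_derivative (\<lambda>u. 2 * f v * df v u)) (at v)"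
    using has_derivative_power[OF f', of v 2] by (simp add: mult.commute mult.left_commute)
  then show ?thesis by (rule frechet_derivative_apply)
qed

lemma tensor_radial:
  "v \<noteq> 0 \<Longrightarrow> deriv (\<lambda>t2. deriv (\<lambda>t1. (f (v + t1 *\<^sub>R v + t2 *\<^sub>R u))\<^sup>2) 0) 0 = 2 * f v * df v u"
proof -
  assume "v \<noteq> 0"
  moreover have "frechet_derivative (\<lambda>v. (f v)\<^sup>2) (at w) w = 2 * (f w)\<^sup>2" if "w \<in> - {0}" for w
    using frechet_sq[of w w] euler[of w] that unfolding power2_eq_square[of "f w"] by simp
  ultimately show ?thesis
    using euler_mixed_deriv[OF open_ne _ smooth_sq, of v u] frechet_sq by simp
qed

text \<open>Evaluated at \<open>(v, v)\<close> the expression in \<open>pos_def\<close> is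
  \<open>2 * (f v)\<^sup>2\<close> by Euler's relation, so definiteness excludes a zero
  value.\<close>

lemma pos: "v \<noteq> 0 \<Longrightarrow> f v > 0"
  using pos_def[of v v] tensor_radial[of v v] euler[of v] nonneg[of v] by (simp add: zero_less_mult_iff less_le)

text \<open>Convexity of \<open>f\<^sup>2\<close> along a segment, which is what
  \<open>pos_def\<close> provides. The inequality is insensitive to positive rescaling of
  \<open>w\<close>, so \<open>w\<close> may be scaled to the same \<open>f\<close>-length as
  \<open>u\<close>; then the slope at \<open>u\<close> towards the end point cannot be
  positive.\<close>

lemma fundamental_inequality:
  assumes u: "u \<noteq> 0" shows "df u w \<le> f w"
proof (cases "\<exists>c\<ge>0. w = - c *\<^sub>R u")
  \<comment> \<open>In the direction opposite to \<open>u\<close> (including \<open>w = 0\<close>)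
    the segment would pass through the origin or end there, where \<open>f\<close> is not smooth;
    homogeneity settles this case directly.\<close>
  case True
  then obtain c where "c \<ge> 0" "w = - c *\<^sub>R u" by blast
  then have "df u w = - (c * f u)"
    using linear_scale[OF linear_df[OF u], of "- c" u] euler[OF u] by simp
  moreover have "0 \<le> c * f u" using \<open>c \<ge> 0\<close> nonneg by simp
  ultimately show ?thesis using nonneg[of w] by linarith
next
  case False
  have w: "w \<noteq> 0" using False by (metis add.inverse_neutral order_refl scaleR_zero_left)
  \<comment> \<open>The scaling with \<open>f (l *\<^sub>R w) = f u\<close>, which makes the
    increment of \<open>f\<^sup>2\<close> over the segment zero.\<close>
  define l where "l = f u / f w"
  have l: "l > 0" using pos u w by (simp add: l_def)
  define d where "d = l *\<^sub>R w - u"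
  define k where "k = (\<lambda>t. (f (u + t *\<^sub>R d))\<^sup>2)"
  have ne: "u + t *\<^sub>R d \<noteq> 0" if t: "t \<in> {0..1}" for t
  proof
    assume *: "u + t *\<^sub>R d = 0"
    show False
    proof (cases "t = 0")
      case True then show False using * u by simp
    next
      case t0: False
      have "(t * l) *\<^sub>R w = - (1 - t) *\<^sub>R u" using * by (simp add: d_def algebra_simps)
      then have "w = - ((1 - t) / (t * l)) *\<^sub>R u"
      proof -
        have "w = (1 / (t * l)) *\<^sub>R ((t * l) *\<^sub>R w)" using t0 l by simp
        also have "\<dots> = - ((1 - t) / (t * l)) *\<^sub>R u" unfolding \<open>(t * l) *\<^sub>R w = _\<close>
          by (simp add: minus_divide_left flip: scaleR_minus_left)
        finally show ?thesis .
      qed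
      moreover have "(1 - t) / (t * l) \<ge> 0" using t t0 l by simp
      ultimately show False using False by blast
    qed
  qed
  let ?G = "\<lambda>v. (f v)\<^sup>2"
  let ?k' = "\<lambda>t. frechet_derivative ?G (at (u + t *\<^sub>R d)) d"
  have dir: "((\<lambda>t. g (u + t *\<^sub>R d)) has_real_derivative frechet_derivative g (at (u + t *\<^sub>R d)) d) (at t)"
    if "t \<in> {0..1}" "smooth_on (- {0}) g" for g t
  proof -
    have "((\<lambda>s. g ((u + t *\<^sub>R d) + s *\<^sub>R d)) has_real_derivative frechet_derivative g (at (u + t *\<^sub>R d)) d) (at 0)"
      by (rule directional_deriv, rule smooth_on_has_derivative[OF that(2)]) (use ne[OF that(1)] in auto)
    then show ?thesis
      using DERIV_shift[of "\<lambda>t. g (u + t *\<^sub>R d)" "frechet_derivative g (at (u + t *\<^sub>R d)) d" 0 t]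
      by (simp add: algebra_simps)
  qed
  \<comment> \<open>A convex function lies above its tangent at \<open>0\<close>. The second
    derivative along the segment is the tensor on \<open>(d, d)\<close>, and it vanishes if
    \<open>d = 0\<close>.\<close>
  have "?k' 0 * (1 - 0) \<le> k 1 - k 0"
  proof (rule f''_imp_f'[of "{0..1}" k ?k' "\<lambda>t. frechet_derivative (\<lambda>w. frechet_derivative ?G (at w) d) (at (u + t *\<^sub>R d)) d"])
    show "(k has_real_derivative ?k' t) (at t)" if "t \<in> {0..1}" for t
      unfolding k_def by (rule dir[OF that smooth_sq])
    show "(?k' has_real_derivative frechet_derivative (\<lambda>w. frechet_derivative ?G (at w) d) (at (u + t *\<^sub>R d)) d) (at t)" if "t \<in> {0..1}" for t
      by (rule dir[OF that smooth_on_frechet_derivative[OF smooth_sq]])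
    show "0 \<le> frechet_derivative (\<lambda>w. frechet_derivative ?G (at w) d) (at (u + t *\<^sub>R d)) d" if "t \<in> {0..1}" for t
    proof (cases "d = 0")
      case True
      have "linear (frechet_derivative (\<lambda>w. frechet_derivative ?G (at w) d) (at (u + t *\<^sub>R d)))"
        by (rule linear_frechet_derivative[OF smooth_on_differentiable[OF smooth_on_frechet_derivative[OF smooth_sq]]])
           (use ne[OF that] in auto)
      then show ?thesis using True linear_0 by fastforce
    next
      case False
      show ?thesis
        using pos_def[OF ne[OF that] False] mixed_deriv[OF open_ne _ smooth_sq, of "u + t *\<^sub>R d" d d] ne[OF that] by simp
    qed
  qed auto
  then have "2 * f u * df u d \<le> (f (l *\<^sub>R w))\<^sup>2 - (f u)\<^sup>2"
    using frechet_sq[OF u, of d] by (simp add: k_def d_def)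
  moreover have "f (l *\<^sub>R w) = f u" using homogeneous[OF l, of w] pos[OF w] by (simp add: l_def)
  ultimately have "df u d \<le> 0" using pos[OF u] by (simp add: mult_le_0_iff)
  moreover have "df u d = l * df u w - f u"
    using linear_diff[OF linear_df[OF u], of "l *\<^sub>R w" u] linear_scale[OF linear_df[OF u], of l w] euler[OF u]
    by (simp add: d_def)
  ultimately have "l * df u w \<le> l * f w" using pos[OF w] by (simp add: l_def)
  then show ?thesis using l by simp
qed

text \<open>The Zermelo indicatrix in one tangent space. On \<open>f u = 1\<close> the tensor
  \<open>g_u(u, .)\<close> equals \<open>df u\<close>, so the condition
  \<open>g_u(u, -w) < 1\<close> becomes \<open>0 < 1 + df u w\<close>.\<close>

definition wind_sphere :: "'a \<Rightarrow> 'a set" where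
  "wind_sphere w = {u + w | u. f u = 1 \<and> 0 < 1 + df u w}"

definition zermelo :: "'a \<Rightarrow> 'a \<Rightarrow> real" where
  "zermelo w v = (if v = 0 then 0 else (THE r. r > 0 \<and> inverse r *\<^sub>R v \<in> wind_sphere w))"

text \<open>The unit ball lies on one side of its tangent hyperplane at \<open>u\<close>, and the
  ray through \<open>u + w\<close> crosses that hyperplane outwards as
  \<open>1 + df u w > 0\<close>. So no unit vector translated by \<open>w\<close> lies further out
  on the ray; exchanging the two points gives the reverse bound.\<close>

lemma wind_sphere_unique:
  assumes u: "f u = 1" "0 < 1 + df u w" and u': "f u' = 1" "0 < 1 + df u' w"
    and s: "s > 0" "u' + w = s *\<^sub>R (u + w)"
  shows "s = 1"
proof -
  have le: "s \<le> 1" if u: "f u = 1" "0 < 1 + df u w" and u': "f u' = 1" and s: "u' + w = s *\<^sub>R (u + w)" for u u' :: 'a and s :: real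
  proof -
    have u0: "u \<noteq> 0" using u zero by auto
    have "u' - u = (s - 1) *\<^sub>R (u + w)" using s by (simp add: algebra_simps)
    then have "df u u' - df u u = (s - 1) * (df u u + df u w)"
      using linear_diff[OF linear_df[OF u0], of u' u] linear_scale[OF linear_df[OF u0], of "s - 1" "u + w"]
        linear_add[OF linear_df[OF u0], of u w] by simp
    moreover have "df u u' \<le> 1" using fundamental_inequality[OF u0, of u'] u' by simp
    ultimately have "(s - 1) * (1 + df u w) \<le> 0" using euler[OF u0] u(1) by simp
    then show "s \<le> 1" using u(2) by (simp add: mult_le_0_iff)
  qed
  have "u + w = inverse s *\<^sub>R (u' + w)" using s by simp
  from le[OF u' u(1) this] have "1 \<le> s" using s(1) by (simp add: field_simps)
  moreover have "s \<le> 1" by (rule le[OF u u'(1) s(2)])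
  ultimately show ?thesis by simp
qed

lemma wind_sphere_nonzero: "v \<in> wind_sphere w \<Longrightarrow> v \<noteq> 0"
proof
  assume "v \<in> wind_sphere w" "v = 0"
  then obtain u where u: "u + w = 0" "f u = 1" "0 < 1 + df u w" by (auto simp: wind_sphere_def)
  have u0: "u \<noteq> 0" using u zero by auto
  have "w = - u" using u(1) by (simp add: add_eq_0_iff)
  then have "df u w = - 1" using linear_neg[OF linear_df[OF u0], of u] euler[OF u0] u(2) by simp
  then show False using u(3) by simp
qed

lemma zermelo_eq:
  assumes "r > 0" "inverse r *\<^sub>R v \<in> wind_sphere w"
  shows "zermelo w v = r"
proof -
  have v0: "v \<noteq> 0" using wind_sphere_nonzero[OF assms(2)] by auto
  have uniq: "s = r" if s: "s > 0" "inverse s *\<^sub>R v \<in> wind_sphere w" for s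
  proof -
    obtain u where u: "inverse r *\<^sub>R v = u + w" "f u = 1" "0 < 1 + df u w" using assms(2) by (auto simp: wind_sphere_def)
    obtain u' where u': "inverse s *\<^sub>R v = u' + w" "f u' = 1" "0 < 1 + df u' w" using s(2) by (auto simp: wind_sphere_def)
    have "u' + w = (r / s) *\<^sub>R (u + w)"
      unfolding u(1)[symmetric] u'(1)[symmetric] using assms(1) by (simp add: divide_inverse)
    from wind_sphere_unique[OF u(2,3) u'(2,3) _ this] show "s = r" using assms(1) s(1) by simp
  qed
  have "(THE r. r > 0 \<and> inverse r *\<^sub>R v \<in> wind_sphere w) = r"
    by (rule the_equality) (use assms uniq in blast)+
  then show ?thesis using v0 by (simp add: zermelo_def)
qed

text \<open>The Zermelo metric is given near \<open>u + w\<close> by the inverse function theorem, applied to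
  \<open>(v, r) \<mapsto> (v, f (v / r - w))\<close>.\<close>

theorem zermelo_tensor:
  assumes u: "f u = 1" "0 < 1 + df u w"
  shows "deriv (\<lambda>t2. deriv (\<lambda>t1. (zermelo w ((u + w) + t1 *\<^sub>R (u + w) + t2 *\<^sub>R x))\<^sup>2) 0) 0 = 2 * (df u x / (1 + df u w))"
proof -
  define v0 where "v0 = u + w"
  have u0: "u \<noteq> 0" using u zero by auto
  let ?h = "\<lambda>z :: 'a \<times> real. inverse (snd z) *\<^sub>R fst z - w"
  define Q1 :: "('a \<times> real) set" where "Q1 = {z. snd z > 0}"
  have oQ1: "open Q1" unfolding Q1_def by (intro open_Collect_less continuous_intros)
  have smh: "smooth_on Q1 ?h"
    by (intro smooth_on_diff smooth_on_scaleR smooth_on_inverse smooth_on_fst smooth_on_snd smooth_on_const oQ1)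
       (simp add: Q1_def)
  \<comment> \<open>The domain is shrunk so that \<open>f\<close> is smooth at \<open>?h z\<close>
    and, in \<open>Q\<close> below, so that the wind condition persists; it is needed at
    neighbouring points to recognize them as points of the translated sphere.\<close>
  define Q2 where "Q2 = {z \<in> Q1. ?h z \<in> - {0}}"
  have oQ2: "open Q2"
    using continuous_open_preimage[OF smooth_on_continuous_on[OF smh] oQ1 open_ne] by (simp add: Q2_def vimage_def Int_def)
  have sub2: "Q2 \<subseteq> Q1" by (auto simp: Q2_def)
  have smh2: "smooth_on Q2 ?h" by (rule smooth_on_subset[OF smh sub2])
  have smdf: "smooth_on Q2 (\<lambda>z. df (?h z) w)"
    by (rule smooth_on_compose[OF oQ2 open_ne smh2 smooth_on_frechet_derivative[OF smooth]]) (simp add: Q2_def)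
  define Q where "Q = {z \<in> Q2. df (?h z) w \<in> {-1<..}}"
  have oQ: "open Q"
    using continuous_open_preimage[OF smooth_on_continuous_on[OF smdf] oQ2, of "{-1<..}"] by (simp add: Q_def vimage_def Int_def)
  have Q: "snd z > 0" "?h z \<noteq> 0" "0 < 1 + df (?h z) w" if "z \<in> Q" for z using that by (auto simp: Q_def Q2_def Q1_def)
  have smhQ: "smooth_on Q ?h" by (rule smooth_on_subset[OF smh2]) (auto simp: Q_def)
  have smfh: "smooth_on Q (\<lambda>z. f (?h z))"
    by (rule smooth_on_compose[OF oQ open_ne smhQ smooth]) (use Q(2) in simp)
  define E where "E = (\<lambda>z. (fst z, f (?h z)))"
  have smE: "smooth_on Q E" unfolding E_def by (intro smooth_on_Pair smfh smooth_on_fst oQ)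
  have inQ: "(v0, 1) \<in> Q" using u u0 by (simp add: Q_def Q2_def Q1_def v0_def)
  have fh': "((\<lambda>z. f (?h z)) has_derivative
      (\<lambda>d. df (?h z) (inverse (snd z) *\<^sub>R fst d - (inverse (snd z) * snd d * inverse (snd z)) *\<^sub>R fst z))) (at z)" if z: "z \<in> Q" for z
  proof (rule has_derivative_compose[where f="?h" and x=z, OF _ f'[OF Q(2)[OF z]]])
    have "snd z \<noteq> 0" using Q(1)[OF z] by simp
    then show "(?h has_derivative (\<lambda>d. inverse (snd z) *\<^sub>R fst d - (inverse (snd z) * snd d * inverse (snd z)) *\<^sub>R fst z)) (at z)"
      by (auto intro!: derivative_eq_intros simp: algebra_simps)
  qed
  have E': "frechet_derivative E (at z) d = (fst d, df (?h z) (inverse (snd z) *\<^sub>R fst d - (inverse (snd z) * snd d * inverse (snd z)) *\<^sub>R fst z))"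
    if "z \<in> Q" for z d
  proof -
    have "(E has_derivative (\<lambda>d. (fst d, df (?h z) (inverse (snd z) *\<^sub>R fst d - (inverse (snd z) * snd d * inverse (snd z)) *\<^sub>R fst z)))) (at z)"
      unfolding E_def by (intro has_derivative_Pair fh' that has_derivative_fst has_derivative_ident)
    then show ?thesis by (rule frechet_derivative_apply)
  qed
  \<comment> \<open>At \<open>(v0, 1)\<close> the derivative of \<open>f (v / r - w)\<close> in
    \<open>r\<close> is \<open>- df u (u + w) = - (1 + df u w)\<close>, which is nonzero by the wind
    condition.\<close>
  have inj: "d = 0" if d: "frechet_derivative E (at (v0, 1)) d = 0" for d
  proof -
    have d1: "fst d = 0" and d2: "df u (- (snd d *\<^sub>R v0)) = 0"
      using d E'[OF inQ, of d] by (auto simp: zero_prod_def v0_def)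
    have "- (snd d * (1 + df u w)) = 0"
      using d2 linear_scale[OF linear_df[OF u0], of "- snd d" v0] linear_add[OF linear_df[OF u0], of u w] euler[OF u0] u(1)
      by (simp add: v0_def)
    then have "snd d = 0" using u(2) by simp
    with d1 show ?thesis by (simp add: prod_eq_iff)
  qed
  obtain U' V Ei where U': "open U'" "U' \<subseteq> Q" "(v0, 1) \<in> U'" and V: "open V" "E (v0, 1) \<in> V"
    and hom: "homeomorphism U' V E Ei" and smEi: "smooth_on V Ei"
    and "\<And>y v. y \<in> V \<Longrightarrow> frechet_derivative E (at (Ei y)) (frechet_derivative Ei (at y) v) = v"
    by (rule smooth_inverse_function[OF oQ smE inQ inj]) (assumption, rule that)
  define z where "z = (\<lambda>v. snd (Ei (v, 1)))"
  define N where "N = {v. (v, 1) \<in> V}"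
  have oN: "open N"
  proof -
    have "continuous_on UNIV (\<lambda>x::'a. (x, 1::real))" by (intro continuous_intros)
    then show ?thesis using open_vimage[OF V(1)] by (simp add: N_def vimage_def)
  qed
  have E0: "E (v0, 1) = (v0, 1)" using u(1) by (simp add: E_def v0_def)
  have v0N: "v0 \<in> N" using V(2) E0 by (simp add: N_def)
  have Ei: "Ei (v, 1) = (v, z v)" "(v, z v) \<in> Q" "f (?h (v, z v)) = 1" if "v \<in> N" for v
  proof -
    have vV: "(v, 1) \<in> V" using that by (simp add: N_def)
    then have 1: "E (Ei (v, 1)) = (v, 1)" "Ei (v, 1) \<in> U'" using hom by (auto simp: homeomorphism_def)
    then show 2: "Ei (v, 1) = (v, z v)" by (simp add: E_def z_def prod_eq_iff)
    show "(v, z v) \<in> Q" using 1(2) U'(2) unfolding 2 by blast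
    show "f (?h (v, z v)) = 1" using 1(1) unfolding 2 by (simp add: E_def)
  qed
  have smz: "smooth_on N z"
    unfolding z_def
    by (intro smooth_on_bounded_linear_comp[OF bounded_linear_snd oN] smooth_on_compose[OF oN V(1) _ smEi])
       (auto intro!: smooth_on_Pair smooth_on_ident smooth_on_const oN, simp add: N_def)
  have zeq: "zermelo w v = z v" if "v \<in> N" for v
    by (rule zermelo_eq) (use Q[OF Ei(2)[OF that]] Ei(3)[OF that] in \<open>auto simp: wind_sphere_def intro!: exI[of _ "?h (v, z v)"]\<close>)
  have z0: "z v0 = 1"
    using zeq[OF v0N] zermelo_eq[of 1 v0 w] u by (auto simp: wind_sphere_def v0_def)
  \<comment> \<open>Implicit differentiation of \<open>f (v / z v - w) = 1\<close>.\<close>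
  have z': "frechet_derivative z (at v) d * df (?h (v, z v)) v = z v * df (?h (v, z v)) d" if v: "v \<in> N" for v d
  proof -
    let ?z = "(v, z v)" and ?zd = "frechet_derivative z (at v) d"
    have h0: "linear (df (?h ?z))" by (rule linear_df[OF Q(2)[OF Ei(2)[OF v]]])
    have zp: "z v > 0" using Q(1)[OF Ei(2)[OF v]] by simp
    have "((\<lambda>v. (v, z v)) has_derivative (\<lambda>d. (d, frechet_derivative z (at v) d))) (at v)"
      by (intro has_derivative_Pair has_derivative_ident smooth_on_has_derivative[OF smz v])
    from has_derivative_compose[OF this fh'[OF Ei(2)[OF v]]]
    have D1: "((\<lambda>v. f (?h (v, z v))) has_derivative (\<lambda>d. df (?h ?z) (inverse (z v) *\<^sub>R d -
       (inverse (z v) * frechet_derivative z (at v) d * inverse (z v)) *\<^sub>R v))) (at v)" by simp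
    have "((\<lambda>v. f (?h (v, z v))) has_derivative (\<lambda>d. 0)) (at v)"
      by (rule has_derivative_transform_within_open[OF has_derivative_const[of 1] oN v]) (rule Ei(3)[symmetric])
    from fun_cong[OF has_derivative_unique[OF D1 this], of d]
    have "df (?h ?z) (inverse (z v) *\<^sub>R d - (inverse (z v) * ?zd * inverse (z v)) *\<^sub>R v) = 0" .
    then have "inverse (z v) * df (?h ?z) d = (inverse (z v) * ?zd * inverse (z v)) * df (?h ?z) v"
      unfolding linear_diff[OF h0] linear_scale[OF h0] by simp
    then show ?thesis using zp by (simp add: field_simps)
  qed
  have euler_z: "frechet_derivative (\<lambda>v. (zermelo w v)\<^sup>2) (at v) d = 2 * z v * frechet_derivative z (at v) d" if v: "v \<in> N" for v d
  proof -
    have "((\<lambda>v. (z v)\<^sup>2) has_derivative (\<lambda>d. 2 * z v * frechet_derivative z (at v) d)) (at v)"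
      using has_derivative_power[OF smooth_on_has_derivative[OF smz v], of 2] by (simp add: mult.commute mult.left_commute)
    then have "((\<lambda>v. (zermelo w v)\<^sup>2) has_derivative (\<lambda>d. 2 * z v * frechet_derivative z (at v) d)) (at v)"
      by (rule has_derivative_transform_within_open[OF _ oN v]) (simp add: zeq)
    then show ?thesis by (rule frechet_derivative_apply)
  qed
  have smZ: "smooth_on N (\<lambda>v. (zermelo w v)\<^sup>2)"
    using smooth_on_cong[OF oN, of "\<lambda>v. (zermelo w v)\<^sup>2" "\<lambda>v. (z v)\<^sup>2"] smooth_on_power2[OF oN smz] zeq by simp
  have "deriv (\<lambda>t2. deriv (\<lambda>t1. (zermelo w (v0 + t1 *\<^sub>R v0 + t2 *\<^sub>R x))\<^sup>2) 0) 0 = frechet_derivative (\<lambda>v. (zermelo w v)\<^sup>2) (at v0) x"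
  proof (rule euler_mixed_deriv[OF oN v0N smZ])
    fix v assume v: "v \<in> N"
    let ?k = "?h (v, z v)"
    note Qv = Q[OF Ei(2)[OF v], unfolded fst_conv snd_conv]
    \<comment> \<open>Euler's relation for \<open>z\<close>: since
      \<open>df ?k v = z v * (1 + df ?k w)\<close> is nonzero, it cancels in \<open>z'\<close> taken
      in the radial direction.\<close>
    have "v = z v *\<^sub>R (?k + w)" using Qv(1) by simp
    then have "df ?k v = df ?k (z v *\<^sub>R (?k + w))" by (rule arg_cong)
    also have "\<dots> = z v * (df ?k ?k + df ?k w)"
      using linear_scale[OF linear_df[OF Qv(2)], of "z v" "?k + w"] linear_add[OF linear_df[OF Qv(2)], of ?k w] by simp
    also have "\<dots> = z v * (1 + df ?k w)" using euler[OF Qv(2)] Ei(3)[OF v] by simp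
    finally have "df ?k v \<noteq> 0" using Qv(1,3) by simp
    then have "frechet_derivative z (at v) v = z v" using z'[OF v, of v] by simp
    then show "frechet_derivative (\<lambda>v. (zermelo w v)\<^sup>2) (at v) v = 2 * (zermelo w v)\<^sup>2"
      unfolding euler_z[OF v] zeq[OF v] by (simp add: power2_eq_square)
  qed
  also have "\<dots> = 2 * frechet_derivative z (at v0) x" using euler_z[OF v0N] z0 by simp
  also have "frechet_derivative z (at v0) x * (1 + df u w) = df u x"
    using z'[OF v0N, of x] z0 linear_add[OF linear_df[OF u0], of u w] euler[OF u0] u(1) by (simp add: v0_def)
  then have "frechet_derivative z (at v0) x = df u x / (1 + df u w)" using u(2) by (simp add: field_simps)
  finally show ?thesis by (simp add: v0_def)
qed

end

section \<open>Volume of the unit balls\<close>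

lemma DERIV_max_0_power2: "((\<lambda>u::real. (max 0 u)\<^sup>2) has_real_derivative 2 * max 0 u) (at u)"
proof (cases "u = 0")
  case True
  have "((\<lambda>h::real. h) \<longlongrightarrow> 0) (at 0)" by (rule tendsto_ident_at)
  then have "((\<lambda>h::real. ((max 0 (0 + h))\<^sup>2 - (max 0 0)\<^sup>2) / h) \<longlongrightarrow> 0) (at 0)"
    by (rule Lim_null_comparison[OF _ tendsto_norm_zero, rotated])
       (auto intro!: always_eventually simp: max_def power2_eq_square)
  then show ?thesis using True by (simp add: DERIV_def)
next
  case False
  show ?thesis
  proof (cases "u > 0")
    case True
    have "((\<lambda>u::real. u\<^sup>2) has_real_derivative 2 * max 0 u) (at u)"
      using True by (auto intro!: derivative_eq_intros simp: max_def)
    then show ?thesis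
      by (rule has_field_derivative_transform_within_open[where S="{0<..}"]) (use True in auto)
  next
    case neg: False
    have "((\<lambda>u::real. 0) has_real_derivative 2 * max 0 u) (at u)"
      using neg by (auto intro!: derivative_eq_intros simp: max_def)
    then show ?thesis
      by (rule has_field_derivative_transform_within_open[where S="{..<0}"]) (use neg False in auto)
  qed
qed

text \<open>Positive exactly between 1 and 2. Vanishing up to 1 hides the zero section, where
  \<open>F\<close> is not differentiable; vanishing from 2 on makes the integrals compactly
  supported. The square provides the continuous derivative for differentiation under the
  integral.\<close>

definition bump :: "real \<Rightarrow> real" where "bump r = (max 0 ((r - 1) * (2 - r)))\<^sup>2"

lemma DERIV_bump: "(bump has_real_derivative 2 * max 0 ((r - 1) * (2 - r)) * (3 - 2 * r)) (at r)"
proof -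
  have "((\<lambda>r. (r - 1) * (2 - r)) has_real_derivative 3 - 2 * r) (at r)"
    by (auto intro!: derivative_eq_intros)
  from DERIV_chain2[OF DERIV_max_0_power2 this] show ?thesis by (simp add: bump_def[abs_def])
qed

lemma bump_eq_0: "r \<le> 1 \<or> 2 \<le> r \<Longrightarrow> bump r = 0"
proof -
  assume "r \<le> 1 \<or> 2 \<le> r"
  then have "(r - 1) * (2 - r) \<le> 0" by (auto simp: mult_le_0_iff)
  then show ?thesis by (simp add: bump_def max_def)
qed

lemma bump_nonneg: "bump r \<ge> 0" by (simp add: bump_def)

lemma continuous_bump: "continuous_on S bump"
  unfolding bump_def[abs_def] by (intro continuous_intros)

locale finsler_domain =
  fixes D :: "'a::euclidean_space set" and F :: "'a \<times> 'a \<Rightarrow> real"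
  assumes open_D: "open D" and cont_F: "continuous_on (D \<times> UNIV) F"
    and smooth_F: "smooth_on (D \<times> (- {0})) F"
    and minkowski: "\<And>x. x \<in> D \<Longrightarrow> minkowski_norm (\<lambda>y. F (x, y))"
begin

definition ball_volume :: "'a \<Rightarrow> real" where
  "ball_volume x = measure lborel {y. F (x, y) < 1}"

lemma open_slit: "open (D \<times> (- {0::'a}))"
  using open_D by (intro open_Times) auto

lemma cont_fibre: "x \<in> D \<Longrightarrow> continuous_on UNIV (\<lambda>y. F (x, y))"
  by (intro continuous_on_compose2[OF cont_F] continuous_intros) auto

text \<open>Extreme values of \<open>F\<close> on the compact product of a ball of base points with
  the unit sphere, extended to all vectors by homogeneity. The constants are locally uniform in the
  base point, so one box can serve a whole neighbourhood.\<close>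

lemma bounds:
  assumes x0: "x0 \<in> D"
  obtains e m K where "0 < e" "cball x0 e \<subseteq> D" "0 < m" "0 < K"
    "\<And>x y. x \<in> cball x0 e \<Longrightarrow> m * norm y \<le> F (x, y)" "\<And>x y. x \<in> cball x0 e \<Longrightarrow> F (x, y) \<le> K * norm y"
proof -
  obtain e where e: "0 < e" "cball x0 e \<subseteq> D" using open_D x0 open_contains_cball by blast
  let ?S = "cball x0 e \<times> sphere (0::'a) 1"
  have comp: "compact ?S" by (intro compact_Times compact_cball compact_sphere)
  have ne: "?S \<noteq> {}" using e(1) SOME_Basis by (auto intro: norm_Basis)
  have cont: "continuous_on ?S F" by (rule continuous_on_subset[OF cont_F]) (use e in auto)
  obtain z1 where z1: "z1 \<in> ?S" "\<And>z. z \<in> ?S \<Longrightarrow> F z1 \<le> F z" using continuous_attains_inf[OF comp ne cont] by blast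
  obtain z2 where z2: "z2 \<in> ?S" "\<And>z. z \<in> ?S \<Longrightarrow> F z \<le> F z2" using continuous_attains_sup[OF comp ne cont] by blast
  have posF: "F z > 0" if "z \<in> ?S" for z
  proof -
    have "fst z \<in> D" "snd z \<noteq> 0" using that e(2) by auto
    from minkowski_norm.pos[OF minkowski[OF this(1)] this(2)] show ?thesis by simp
  qed
  have *: "F (x, y) = norm y * F (x, y /\<^sub>R norm y)" "(x, y /\<^sub>R norm y) \<in> ?S" if "x \<in> cball x0 e" "y \<noteq> 0" for x y
    using minkowski_norm.homogeneous[OF minkowski, of x "norm y" "y /\<^sub>R norm y"] that e(2) by (auto simp: subset_iff)
  have 0: "F (x, 0) = 0" if "x \<in> cball x0 e" for x
    using minkowski_norm.zero[OF minkowski, of x] that e(2) by (auto simp: subset_iff)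
  show ?thesis
  proof (rule that[of e "F z1" "F z2"])
    show "F z1 * norm y \<le> F (x, y)" if "x \<in> cball x0 e" for x y
    proof (cases "y = 0")
      case False
      then show ?thesis using z1(2)[OF *(2)[OF that False]] mult_left_mono[OF _ norm_ge_zero[of y]]
        unfolding *(1)[OF that False] by (simp add: mult.commute)
    qed (simp add: 0[OF that])
    show "F (x, y) \<le> F z2 * norm y" if "x \<in> cball x0 e" for x y
    proof (cases "y = 0")
      case False
      then show ?thesis using z2(2)[OF *(2)[OF that False]] mult_left_mono[OF _ norm_ge_zero[of y]]
        unfolding *(1)[OF that False] by (simp add: mult.commute)
    qed (simp add: 0[OF that])
  qed (use e posF z1 z2 in auto)
qed

lemma borel_sublevel: "x \<in> D \<Longrightarrow> {y. F (x, y) < r} \<in> sets borel"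
  by (intro borel_open open_Collect_less cont_fibre continuous_on_const)

lemma emeasure_unit_ball:
  assumes "x \<in> D" shows "emeasure lborel {y. F (x, y) < 1} = ennreal (ball_volume x)" and "0 < ball_volume x"
proof -
  obtain e m K where b: "0 < e" and "cball x e \<subseteq> D" and b': "0 < m" "0 < K"
    "\<And>x' y. x' \<in> cball x e \<Longrightarrow> m * norm y \<le> F (x', y)" "\<And>x' y. x' \<in> cball x e \<Longrightarrow> F (x', y) \<le> K * norm y"
    by (rule bounds[OF assms]) (rule that)
  note b = b b'
  have "{y. F (x, y) < 1} \<subseteq> ball 0 (1 / m)"
  proof
    fix y assume "y \<in> {y. F (x, y) < 1}"
    then have "m * norm y < 1" using b(4)[of x y] b(1) by simp
    then show "y \<in> ball 0 (1 / m)" using b(2) by (simp add: field_simps)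
  qed
  then have fin: "emeasure lborel {y. F (x, y) < 1} < \<infinity>"
    by (intro emeasure_bounded_finite) (auto intro: bounded_subset)
  then show eq: "emeasure lborel {y. F (x, y) < 1} = ennreal (ball_volume x)"
    unfolding ball_volume_def by (intro emeasure_eq_ennreal_measure) auto
  have "ball 0 (1 / K) \<subseteq> {y. F (x, y) < 1}"
  proof
    fix y :: 'a assume "y \<in> ball 0 (1 / K)"
    then have "K * norm y < 1" using b(3) by (simp add: field_simps)
    then show "y \<in> {y. F (x, y) < 1}" using b(5)[of x y] b(1) by simp
  qed
  then have "emeasure lborel (ball (0::'a) (1 / K)) \<le> ennreal (ball_volume x)"
    unfolding eq[symmetric] using borel_sublevel[OF assms] by (intro emeasure_mono) auto
  moreover have "0 < emeasure lborel (ball (0::'a) (1 / K))"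
    using b(3) by (simp add: emeasure_ball)
  ultimately have "0 < ennreal (ball_volume x)" by (rule order.strict_trans2[rotated])
  then show "0 < ball_volume x" by (simp add: ennreal_less_zero_iff)
qed

lemma emeasure_sublevel:
  assumes x: "x \<in> D" and r: "0 < r"
  shows "emeasure lborel {y. F (x, y) < r} = ennreal (r ^ DIM('a)) * ennreal (ball_volume x)"
proof -
  have "emeasure lborel {y. F (x, y) < r} =
     emeasure (density (distr lborel borel (\<lambda>y. 0 + r *\<^sub>R y)) (\<lambda>_. ennreal (\<bar>r\<bar> ^ DIM('a)))) {y. F (x, y) < r}"
    using lborel_affine[of r "0::'a"] r by simp
  also have "\<dots> = ennreal (\<bar>r\<bar> ^ DIM('a)) * emeasure (distr lborel borel (\<lambda>y. 0 + r *\<^sub>R y)) {y. F (x, y) < r}"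
    using borel_sublevel[OF x] by (intro emeasure_density_const) auto
  also have "emeasure (distr lborel borel (\<lambda>y. 0 + r *\<^sub>R y)) {y. F (x, y) < r} = emeasure lborel ((\<lambda>y. 0 + r *\<^sub>R y) -` {y. F (x, y) < r} \<inter> space lborel)"
    using borel_sublevel[OF x] by (intro emeasure_distr) auto
  also have "(\<lambda>y. 0 + r *\<^sub>R y) -` {y. F (x, y) < r} \<inter> space lborel = {y. F (x, y) < 1}"
    using minkowski_norm.homogeneous[OF minkowski[OF x] r] r by auto
  finally show ?thesis using r emeasure_unit_ball[OF x] by simp
qed

text \<open>By homogeneity the distributions of \<open>F (x, \<sqdot>)\<close> under Lebesgue measure are proportional,
  with the volume of the unit ball as factor; so that volume can be computed by integrating any
  profile of \<open>F\<close>, in particular a differentiable one.\<close>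

lemma distr_proportional:
  assumes x: "x \<in> D" and p: "p \<in> D"
  shows "distr lborel borel (\<lambda>y. - F (x, y)) =
    scale_measure (ennreal (ball_volume x / ball_volume p)) (distr lborel borel (\<lambda>y. - F (p, y)))"
proof (rule measure_eqI_lessThan)
  \<comment> \<open>The sign in \<open>- F\<close> turns the upper rays, on which the two measures
    are compared, into sublevel sets of \<open>F\<close>; these have finite volume.\<close>
  have em: "emeasure (distr lborel borel (\<lambda>y. - F (x, y))) {a<..} = (if a < 0 then ennreal ((- a) ^ DIM('a)) * ennreal (ball_volume x) else 0)"
    if x: "x \<in> D" for x a
  proof -
    have "(\<lambda>y. - F (x, y)) \<in> borel_measurable borel"
      by (intro borel_measurable_continuous_onI continuous_intros cont_fibre x)
    then have "emeasure (distr lborel borel (\<lambda>y. - F (x, y))) {a<..} = emeasure lborel ((\<lambda>y. - F (x, y)) -` {a<..} \<inter> space lborel)"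
      by (intro emeasure_distr) auto
    also have "(\<lambda>y. - F (x, y)) -` {a<..} \<inter> space lborel = {y. F (x, y) < - a}" by auto
    also have "emeasure lborel \<dots> = (if a < 0 then ennreal ((- a) ^ DIM('a)) * ennreal (ball_volume x) else 0)"
    proof (cases "a < 0")
      case True
      then show ?thesis using emeasure_sublevel[OF x, of "- a"] by simp
    next
      case False
      have "\<not> F (x, y) < - a" for y
        using minkowski_norm.nonneg[OF minkowski[OF x], of y] False by simp
      then have "{y. F (x, y) < - a} = {}" by blast
      then show ?thesis using False by simp
    qed
    finally show ?thesis .
  qed
  show "emeasure (distr lborel borel (\<lambda>y. - F (x, y))) {a<..} < \<infinity>" for a
    by (auto simp: em[OF x] ennreal_mult_less_top)
  show "emeasure (distr lborel borel (\<lambda>y. - F (x, y))) {a<..} =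
    emeasure (scale_measure (ennreal (ball_volume x / ball_volume p)) (distr lborel borel (\<lambda>y. - F (p, y)))) {a<..}" for a
  proof (cases "a < 0")
    case True
    have "ball_volume x = ball_volume x / ball_volume p * ball_volume p" using emeasure_unit_ball(2)[OF p] by simp
    then have "ennreal (ball_volume x) = ennreal (ball_volume x / ball_volume p) * ennreal (ball_volume p)"
      using emeasure_unit_ball(2)[OF p] emeasure_unit_ball(2)[OF x] by (subst ennreal_mult[symmetric]) auto
    then show ?thesis using True by (simp add: em[OF x] em[OF p] ac_simps)
  qed (simp add: em[OF x] em[OF p])
qed auto

lemma nn_integral_proportional:
  assumes x: "x \<in> D" and p: "p \<in> D"
  shows "(\<integral>\<^sup>+y. ennreal (bump (F (x, y))) \<partial>lborel) =
    ennreal (ball_volume x / ball_volume p) * (\<integral>\<^sup>+y. ennreal (bump (F (p, y))) \<partial>lborel)"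
proof -
  have m: "(\<lambda>y. - F (x, y)) \<in> measurable lborel borel" if "x \<in> D" for x
    using borel_measurable_continuous_onI[OF continuous_on_minus[OF cont_fibre[OF that]]] by simp
  have "(\<lambda>s. bump (- s)) \<in> borel_measurable borel"
    by (intro borel_measurable_continuous_onI continuous_on_compose2[OF continuous_bump] continuous_intros) auto
  then have b: "(\<lambda>s. ennreal (bump (- s))) \<in> borel_measurable borel" by measurable
  have eq: "(\<integral>\<^sup>+y. ennreal (bump (F (x, y))) \<partial>lborel) = (\<integral>\<^sup>+s. ennreal (bump (- s)) \<partial>distr lborel borel (\<lambda>y. - F (x, y)))" if "x \<in> D" for x
    using nn_integral_distr[OF m[OF that], of "\<lambda>s. ennreal (bump (- s))"] b by simp
  show ?thesis
    unfolding eq[OF x] eq[OF p] distr_proportional[OF x p]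
    by (rule nn_integral_scale_measure) (use b in simp)
qed

text \<open>Near \<open>x0\<close> the volume is a constant multiple of the integral of
  \<open>bump (F (x, y))\<close> over a fixed box. In this form the base point enters only through
  the integrand, and the Leibniz rule applies.\<close>

theorem ball_volume_differentiable:
  assumes x0: "x0 \<in> D" shows "ball_volume differentiable (at x0)"
proof -
  obtain e m K where e: "0 < e" "cball x0 e \<subseteq> D" and mK: "0 < m" "0 < K"
    "\<And>x y. x \<in> cball x0 e \<Longrightarrow> m * norm y \<le> F (x, y)" "\<And>x y. x \<in> cball x0 e \<Longrightarrow> F (x, y) \<le> K * norm y"
    by (rule bounds[OF x0]) (rule that)
  \<comment> \<open>Outside the ball of radius \<open>2 / m\<close> one has \<open>F \<ge> 2\<close>
    for all base points near \<open>x0\<close>, so the profile vanishes off this box.\<close>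
  obtain a :: 'a where a: "cball 0 (2 / m) \<subseteq> cbox (- a) a" by (rule bounded_subset_cbox_symmetric[OF bounded_cball])
  have supp: "bump (F (x, y)) = 0" if "x \<in> cball x0 e" "y \<notin> cbox (- a) a" for x y
  proof -
    have "2 / m < norm y" using a that(2) by (auto simp: subset_iff not_le)
    then have "2 \<le> m * norm y" using mK(1) by (simp add: field_simps)
    then show ?thesis using mK(3)[OF that(1), of y] bump_eq_0 by simp
  qed
  have contb: "continuous_on A (\<lambda>y. bump (F (x, y)))" if "x \<in> D" for A x
    by (rule continuous_on_compose2[OF continuous_bump[of UNIV]]) (auto intro: continuous_on_subset[OF cont_fibre[OF that]])
  define I where "I = (\<lambda>x. integral (cbox (- a) a) (\<lambda>y. bump (F (x, y))))"
  have hasI: "((\<lambda>y. bump (F (x, y))) has_integral I x) (cbox (- a) a)" if "x \<in> cball x0 e" for x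
    unfolding I_def using that e(2) by (intro integrable_integral integrable_continuous contb) auto
  have I0: "0 \<le> I x" if "x \<in> cball x0 e" for x
    using has_integral_nonneg[OF hasI[OF that]] bump_nonneg by simp
  have nnI: "(\<integral>\<^sup>+y. ennreal (bump (F (x, y))) \<partial>lborel) = ennreal (I x)" if "x \<in> cball x0 e" for x
  proof (rule nn_integral_has_integral_lborel)
    show "(\<lambda>y. bump (F (x, y))) \<in> borel_measurable borel"
      using that e(2) by (intro borel_measurable_continuous_onI contb) auto
    show "((\<lambda>y. bump (F (x, y))) has_integral I x) UNIV"
      by (rule has_integral_on_superset[OF hasI[OF that]]) (use supp[OF that] in auto)
  qed (rule bump_nonneg)
  have x0e: "x0 \<in> cball x0 e" using e by simp
  \<comment> \<open>A vector scaled to \<open>F = 3/2\<close>, in the middle of the support, shows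
    that the continuous nonnegative integrand is not identically zero.\<close>
  have "I x0 \<noteq> 0"
  proof
    assume "I x0 = 0"
    interpret minkowski_norm "\<lambda>y. F (x0, y)" by (rule minkowski[OF x0])
    obtain b :: 'a where b: "b \<in> Basis" using nonempty_Basis by blast
    define y where "y = (3 / 2 / F (x0, b)) *\<^sub>R b"
    have "F (x0, b) > 0" using pos b nonzero_Basis by blast
    then have Fy: "F (x0, y) = 3/2" using homogeneous[of "3 / 2 / F (x0, b)" b] by (simp add: y_def)
    have "bump (F (x0, y)) \<noteq> 0" by (simp add: Fy bump_def)
    moreover have "bump (F (x0, y)) = 0"
    proof (rule has_integral_0_cbox_imp_0[OF contb[OF x0]])
      show "((\<lambda>y. bump (F (x0, y))) has_integral 0) (cbox (- a) a)" using hasI[OF x0e] \<open>I x0 = 0\<close> by simp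
      have "ball 0 (2 / m) \<subseteq> cbox (- a) a" using a ball_subset_cball by blast
      then have "ball 0 (2 / m) \<subseteq> interior (cbox (- a) a)" by (rule interior_maximal) simp
      then show "box (- a) a \<noteq> {}" using mK(1) by (auto simp: interior_cbox)
      show "y \<in> cbox (- a) a" using supp[OF x0e, of y] \<open>bump (F (x0, y)) \<noteq> 0\<close> by blast
    qed (rule bump_nonneg)
    ultimately show False by simp
  qed
  have vol: "ball_volume x = ball_volume x0 / I x0 * I x" if "x \<in> cball x0 e" for x
  proof -
    have xD: "x \<in> D" using that e(2) by blast
    have "0 \<le> ball_volume x / ball_volume x0" using emeasure_unit_ball(2)[OF xD] emeasure_unit_ball(2)[OF x0] by simp
    then have "ennreal (I x) = ennreal (ball_volume x / ball_volume x0 * I x0)"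
      using nn_integral_proportional[OF xD x0] unfolding nnI[OF that] nnI[OF x0e]
      by (simp only: ennreal_mult[OF \<open>0 \<le> ball_volume x / ball_volume x0\<close> I0[OF x0e]])
    moreover have "0 \<le> ball_volume x / ball_volume x0 * I x0"
      using \<open>0 \<le> ball_volume x / ball_volume x0\<close> I0[OF x0e] by (rule mult_nonneg_nonneg)
    ultimately have "I x = ball_volume x / ball_volume x0 * I x0" using ennreal_inj I0[OF that] by blast
    then show ?thesis using \<open>I x0 \<noteq> 0\<close> emeasure_unit_ball(2)[OF x0] by (simp add: field_simps)
  qed
  have "Ck_on (Suc 0) (D \<times> (- {0})) F" using smooth_F unfolding smooth_on_def by blast
  then obtain F' :: "'a \<times> 'a \<Rightarrow> ('a \<times> 'a) \<Rightarrow>\<^sub>L real" where F':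
    "\<And>z. z \<in> D \<times> (- {0}) \<Longrightarrow> (F has_derivative blinfun_apply (F' z)) (at z)" "continuous_on (D \<times> (- {0})) F'"
    by (rule C1_blinfun_derivative) blast
  define inl where "inl = Blinfun (\<lambda>v::'a. (v, 0::'a))"
  have inl: "blinfun_apply inl v = (v, 0)" for v
    unfolding inl_def by (subst bounded_linear_Blinfun_apply) (auto intro!: bounded_linear_intros)
  define b' where "b' = (\<lambda>r::real. 2 * max 0 ((r - 1) * (2 - r)) * (3 - 2 * r))"
  \<comment> \<open>The derivative of the integrand in the base point. At \<open>y = 0\<close> the
    value \<open>0\<close> is the true derivative, because \<open>F (x, 0) = 0\<close> for all
    \<open>x\<close> and \<open>bump\<close> vanishes there.\<close>
  define G where "G = (\<lambda>x y. if y = 0 then 0 else b' (F (x, y)) *\<^sub>R (F' (x, y) o\<^sub>L inl))"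
  have F0: "F (x, 0) = 0" if "x \<in> D" for x using minkowski_norm.zero[OF minkowski[OF that]] .
  have "((\<lambda>x. integral (cbox (- a) a) (\<lambda>y. bump (F (x, y)))) has_derivative integral (cbox (- a) a) (G x0)) (at x0 within ball x0 e)"
  proof (rule leibniz_rule)
    fix x y assume x: "x \<in> ball x0 e"
    then have xD: "x \<in> D" using e(2) by auto
    show "((\<lambda>x. bump (F (x, y))) has_derivative blinfun_apply (G x y)) (at x within ball x0 e)"
    proof (cases "y = 0")
      case True
      have "((\<lambda>x. bump (F (x, y))) has_derivative (\<lambda>_. 0)) (at x)"
        by (rule has_derivative_transform_within_open[OF has_derivative_const[of 0] open_D xD])
           (simp add: True F0 bump_eq_0)
      then show ?thesis using True by (auto simp: G_def zero_blinfun.rep_eq intro: has_derivative_at_withinI)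
    next
      case False
      have "((\<lambda>x. (x, y)) has_derivative (\<lambda>v. (v, 0))) (at x)" by (intro has_derivative_Pair has_derivative_ident has_derivative_const)
      from has_derivative_compose[OF this F'(1)] have 1: "((\<lambda>x. F (x, y)) has_derivative (\<lambda>v. F' (x, y) (v, 0))) (at x)"
        using xD False by simp
      have "(bump has_derivative (*) (b' (F (x, y)))) (at (F (x, y)))"
        using DERIV_bump by (simp add: has_field_derivative_def b'_def)
      from has_derivative_compose[OF 1 this] have "((\<lambda>x. bump (F (x, y))) has_derivative (\<lambda>v. b' (F (x, y)) * F' (x, y) (v, 0))) (at x)" .
      moreover have "blinfun_apply (G x y) = (\<lambda>v. b' (F (x, y)) * F' (x, y) (v, 0))"
        using False by (auto simp: G_def inl blinfun.scaleR_left)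
      ultimately show ?thesis by (auto intro: has_derivative_at_withinI)
    qed
  next
    fix x assume "x \<in> ball x0 e"
    then have "x \<in> cball x0 e" by simp
    from hasI[OF this] show "(\<lambda>y. bump (F (x, y))) integrable_on cbox (- a) a" by blast
  next
    \<comment> \<open>An open set around the zero section on which \<open>bump\<close> and its
      derivative vanish along \<open>F\<close>. Joint continuity of \<open>G\<close> is glued from
      the slit domain and \<open>T\<close>.\<close>
    define T where "T = {z \<in> D \<times> UNIV. F z \<in> {..<1}}"
    have openT: "open T"
      using continuous_open_preimage[OF cont_F open_Times[OF open_D open_UNIV], of "{..<1}"] by (simp add: T_def vimage_def Int_def)
    have c1: "continuous_on (D \<times> (- {0})) (\<lambda>(x, y). G x y)"
    proof -
      have cF: "continuous_on (D \<times> (- {0})) F" by (rule continuous_on_subset[OF cont_F]) auto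
      have "continuous_on (D \<times> (- {0})) (\<lambda>z. b' (F z) *\<^sub>R (F' z o\<^sub>L inl))"
        unfolding b'_def by (intro continuous_intros cF F'(2))
      then show ?thesis by (rule continuous_on_eq) (auto simp: G_def split: if_splits)
    qed
    have c2: "continuous_on T (\<lambda>(x, y). G x y)"
    proof -
      have "G x y = 0" if "(x, y) \<in> T" for x y
      proof -
        have "F (x, y) < 1" using that by (simp add: T_def)
        then have "(F (x, y) - 1) * (2 - F (x, y)) \<le> 0" by (simp add: mult_le_0_iff)
        then show ?thesis by (simp add: G_def b'_def max_def)
      qed
      then show ?thesis by (intro continuous_on_eq[OF continuous_on_const[of _ 0]]) auto
    qed
    have "continuous_on (D \<times> (- {0}) \<union> T) (\<lambda>(x, y). G x y)"
      by (rule continuous_on_open_Un[OF open_slit openT c1 c2])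
    moreover have "ball x0 e \<times> cbox (- a) a \<subseteq> D \<times> (- {0}) \<union> T"
      using e(2) F0 by (auto simp: T_def subset_iff)
    ultimately show "continuous_on (ball x0 e \<times> cbox (- a) a) (\<lambda>(x, y). G x y)"
      by (rule continuous_on_subset)
  qed (use e in auto)
  then have "(I has_derivative integral (cbox (- a) a) (G x0)) (at x0)"
    unfolding I_def using at_within_open[OF _ open_ball, of x0 x0 e] e(1) by (metis centre_in_ball)
  then have "((\<lambda>x. ball_volume x0 / I x0 * I x) has_derivative (\<lambda>v. ball_volume x0 / I x0 * integral (cbox (- a) a) (G x0) v)) (at x0)"
    by (rule has_derivative_mult_right)
  then have "(ball_volume has_derivative (\<lambda>v. ball_volume x0 / I x0 * integral (cbox (- a) a) (G x0) v)) (at x0)"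
  proof (rule has_derivative_transform_within_open[OF _ open_ball[of x0 e]])
    show "ball_volume x0 / I x0 * I x = ball_volume x" if "x \<in> ball x0 e" for x
      by (rule vol[symmetric]) (use that in simp)
  qed (use e in auto)
  then show ?thesis by (auto simp: differentiable_def)
qed

end

section \<open>Distance functions and divergence in coordinates\<close>

text \<open>A line in a direction of the kernel of \<open>df\<close> need not stay in the level set,
  so the level set is first straightened by a local diffeomorphism whose derivative at
  \<open>x0\<close> is the identity. Along the image of the line \<open>h\<close> vanishes
  identically.\<close>

lemma eventually_on_level_set_derivative_zero:
  fixes f :: "'a::euclidean_space \<Rightarrow> real" and h :: "'a \<Rightarrow> 'b::real_normed_vector"
  assumes N: "open N" "x0 \<in> N" and f: "smooth_on N f" "f x0 = 0" "frechet_derivative f (at x0) e \<noteq> 0"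
    and h: "(h has_derivative h') (at x0)" "\<And>x. x \<in> N \<Longrightarrow> f x = 0 \<Longrightarrow> h x = 0"
    and v: "frechet_derivative f (at x0) v = 0"
  shows "h' v = 0"
proof -
  let ?f' = "frechet_derivative f (at x0)"
  note f' = smooth_on_has_derivative[OF f(1) N(2)]
  note lin = has_derivative_linear[OF f']
  define e1 where "e1 = (1 / ?f' e) *\<^sub>R e"
  have e1: "?f' e1 = 1" using linear_scale[OF lin, of "1 / ?f' e" e] f(3) by (simp add: e1_def)
  \<comment> \<open>The correction along \<open>e1\<close>, normalized by \<open>df e1 = 1\<close>,
    gives \<open>df (\<Theta> x - x0) = f x\<close>. So the hyperplane through \<open>x0\<close>
    pulls back to the level set, and the correction has zero derivative at
    \<open>x0\<close>.\<close>
  define \<Theta> where "\<Theta> = (\<lambda>x. x + (f x - ?f' (x - x0)) *\<^sub>R e1)"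
  have bl: "bounded_linear ?f'" by (rule has_derivative_bounded_linear[OF f'])
  have "smooth_on N (\<lambda>x. ?f' (x - x0))"
    by (intro smooth_on_bounded_linear_comp[OF bl N(1)] smooth_on_diff smooth_on_ident smooth_on_const N(1))
  then have sm: "smooth_on N \<Theta>"
    unfolding \<Theta>_def by (intro smooth_on_add smooth_on_ident smooth_on_scaleR smooth_on_diff smooth_on_const f(1) N(1))
  have \<Theta>': "frechet_derivative \<Theta> (at x0) w = w" for w
  proof -
    have "((\<lambda>x. x - x0) has_derivative (\<lambda>w. w)) (at x0)" by (auto intro!: derivative_eq_intros)
    from bounded_linear.has_derivative[OF bl this] have 1: "((\<lambda>x. ?f' (x - x0)) has_derivative (\<lambda>w. ?f' w)) (at x0)" .
    have "(\<Theta> has_derivative (\<lambda>w. w + (?f' w - ?f' w) *\<^sub>R e1)) (at x0)"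
      unfolding \<Theta>_def by (intro has_derivative_add has_derivative_ident has_derivative_scaleR_left has_derivative_diff f' 1)
    from frechet_derivative_apply[OF this] show ?thesis by simp
  qed
  obtain U' V \<theta> where U': "open U'" "U' \<subseteq> N" "x0 \<in> U'" "open V" "\<Theta> x0 \<in> V" and hom: "homeomorphism U' V \<Theta> \<theta>"
    and sm\<theta>: "smooth_on V \<theta>" and inv: "\<And>y v. y \<in> V \<Longrightarrow> frechet_derivative \<Theta> (at (\<theta> y)) (frechet_derivative \<theta> (at y) v) = v"
    by (rule smooth_inverse_function[OF N(1) sm N(2)]) (simp add: \<Theta>', rule that)
  have \<Theta>x0: "\<Theta> x0 = x0" using f(2) linear_0[OF lin] by (simp add: \<Theta>_def)
  have \<theta>x0: "\<theta> x0 = x0" using hom U'(3) \<Theta>x0 unfolding homeomorphism_def by metis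
  have x0V: "x0 \<in> V" using U'(5) \<Theta>x0 by simp
  have \<theta>': "frechet_derivative \<theta> (at x0) v = v" using inv[OF x0V, of v] \<theta>x0 \<Theta>' by simp
  have on_level: "f (\<theta> y) = 0" if y: "y \<in> V" "?f' (y - x0) = 0" for y
  proof -
    have "\<Theta> (\<theta> y) = y" using hom y(1) by (simp add: homeomorphism_def)
    then have "y - x0 = (\<theta> y - x0) + (f (\<theta> y) - ?f' (\<theta> y - x0)) *\<^sub>R e1" by (simp add: \<Theta>_def algebra_simps)
    then have "?f' (y - x0) = ?f' (\<theta> y - x0) + (f (\<theta> y) - ?f' (\<theta> y - x0)) * ?f' e1"
      by (simp only: linear_add[OF lin] linear_scale[OF lin] real_scaleR_def)
    then show ?thesis using y(2) e1 by simp
  qed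
  have \<theta>N: "\<theta> y \<in> N" if "y \<in> V" for y using hom that U'(2) by (auto simp: homeomorphism_def)
  define \<gamma> where "\<gamma> = (\<lambda>t. x0 + t *\<^sub>R v)"
  have \<gamma>': "(\<gamma> has_derivative (\<lambda>t. t *\<^sub>R v)) (at 0)" unfolding \<gamma>_def by (auto intro!: derivative_eq_intros)
  have h\<theta>: "((\<lambda>y. h (\<theta> y)) has_derivative (\<lambda>w. h' (frechet_derivative \<theta> (at x0) w))) (at x0)"
    by (rule has_derivative_compose[where f=\<theta> and x=x0, OF smooth_on_has_derivative[OF sm\<theta> x0V]]) (simp add: \<theta>x0 h(1))
  have "((\<lambda>t. h (\<theta> (\<gamma> t))) has_derivative (\<lambda>t. h' (frechet_derivative \<theta> (at x0) (t *\<^sub>R v)))) (at 0)"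
    by (rule has_derivative_compose[where f=\<gamma> and x=0, OF \<gamma>']) (simp add: \<gamma>_def h\<theta>)
  moreover have "((\<lambda>t. h (\<theta> (\<gamma> t))) has_derivative (\<lambda>t. 0)) (at 0)"
  proof (rule has_derivative_transform_within_open[OF has_derivative_const[of 0]])
    have "continuous_on UNIV \<gamma>" unfolding \<gamma>_def by (intro continuous_intros)
    then show "open (\<gamma> -` V)" using U'(4) by (rule open_vimage[rotated])
    show "0 \<in> \<gamma> -` V" using x0V by (simp add: \<gamma>_def)
    fix t assume "t \<in> \<gamma> -` V"
    then have t: "\<gamma> t \<in> V" by simp
    have "?f' (\<gamma> t - x0) = 0" using linear_scale[OF lin, of t v] assms(8) by (simp add: \<gamma>_def)
    from h(2)[OF \<theta>N[OF t] on_level[OF t this]] show "0 = h (\<theta> (\<gamma> t))" by simp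
  qed
  ultimately have "(\<lambda>t. h' (frechet_derivative \<theta> (at x0) (t *\<^sub>R v))) = (\<lambda>t. 0)" by (rule has_derivative_unique)
  from fun_cong[OF this, of 1] show ?thesis by (simp add: \<theta>')
qed

lemma (in minkowski_norm) df_scale:
  assumes r: "r > 0" and v: "v \<noteq> 0" shows "df (r *\<^sub>R v) u = df v u"
proof -
  have "((\<lambda>v. r *\<^sub>R v) has_derivative (\<lambda>u. r *\<^sub>R u)) (at v)" by (auto intro!: derivative_eq_intros)
  from has_derivative_compose[OF this f'] have "((\<lambda>v. f (r *\<^sub>R v)) has_derivative (\<lambda>u. df (r *\<^sub>R v) (r *\<^sub>R u))) (at v)"
    using r v by simp
  moreover have "((\<lambda>v. f (r *\<^sub>R v)) has_derivative (\<lambda>u. r * df v u)) (at v)"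
    using has_derivative_mult_right[OF f'[OF v], of r] homogeneous[OF r] by simp
  ultimately have "(\<lambda>u. df (r *\<^sub>R v) (r *\<^sub>R u)) = (\<lambda>u. r * df v u)" by (rule has_derivative_unique)
  from fun_cong[OF this, of u] show ?thesis
    using linear_scale[OF linear_df, of "r *\<^sub>R v" r u] r v by simp
qed

section \<open>Unit fields in a chart: the trace along a hypersurface and the Legendre
  transformation\<close>

context finsler_domain
begin

definition dF :: "'a \<Rightarrow> 'a \<Rightarrow> 'a \<Rightarrow> real" where
  "dF x y = frechet_derivative (\<lambda>y. F (x, y)) (at y)"

lemma F': "x \<in> D \<Longrightarrow> y \<noteq> 0 \<Longrightarrow> (F has_derivative frechet_derivative F (at (x, y))) (at (x, y))"
  by (rule smooth_on_has_derivative[OF smooth_F]) auto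

lemma dF_eq:
  assumes "x \<in> D" "y \<noteq> 0" shows "dF x y v = frechet_derivative F (at (x, y)) (0, v)"
proof -
  have "((\<lambda>y. (x, y)) has_derivative (\<lambda>v. (0, v))) (at y)" by (intro has_derivative_Pair has_derivative_ident has_derivative_const)
  from has_derivative_compose[OF this F'[OF assms]] show ?thesis
    unfolding dF_def by (rule frechet_derivative_apply)
qed

lemma linear_dF: "x \<in> D \<Longrightarrow> y \<noteq> 0 \<Longrightarrow> linear (dF x y)"
  unfolding dF_def using minkowski_norm.linear_df[OF minkowski] .

lemma dF_euler: "x \<in> D \<Longrightarrow> y \<noteq> 0 \<Longrightarrow> dF x y y = F (x, y)"
  unfolding dF_def using minkowski_norm.euler[OF minkowski] .

lemma F_pos: "x \<in> D \<Longrightarrow> y \<noteq> 0 \<Longrightarrow> F (x, y) > 0"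
  using minkowski_norm.pos[OF minkowski] .

lemma F_one_nonzero: "x \<in> D \<Longrightarrow> F (x, y) = 1 \<Longrightarrow> y \<noteq> 0"
  using minkowski_norm.zero[OF minkowski] by force

lemma F_scale: "x \<in> D \<Longrightarrow> r > 0 \<Longrightarrow> F (x, r *\<^sub>R y) = r * F (x, y)"
  using minkowski_norm.homogeneous[OF minkowski] .

lemma dF_scale: "x \<in> D \<Longrightarrow> r > 0 \<Longrightarrow> y \<noteq> 0 \<Longrightarrow> dF x (r *\<^sub>R y) u = dF x y u"
  unfolding dF_def using minkowski_norm.df_scale[OF minkowski] .

text \<open>No quotient of \<open>X - Y\<close> by \<open>f\<close> is formed. The derivative
  \<open>\<Delta>\<close> of the difference vanishes on the kernel of \<open>df\<close>, hence has
  rank at most one, and \<open>\<Delta> e / df e\<close> plays the role of the factor at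
  \<open>x0\<close>. In this way differentiability of \<open>X\<close> and \<open>Y\<close> at the
  single point \<open>x0\<close> suffices.\<close>

theorem trace_unique:
  fixes f :: "'a \<Rightarrow> real"
  assumes N: "open N" "x0 \<in> N" "N \<subseteq> D" and f: "smooth_on N f" "f x0 = 0" "frechet_derivative f (at x0) e \<noteq> 0"
    and X: "X differentiable (at x0)" "\<And>x. x \<in> N \<Longrightarrow> F (x, X x) = 1"
    and Y: "Y differentiable (at x0)" "\<And>x. x \<in> N \<Longrightarrow> F (x, Y x) = 1"
    and eq: "\<And>x. x \<in> N \<Longrightarrow> f x = 0 \<Longrightarrow> X x = Y x"
    and normal: "\<And>v. frechet_derivative f (at x0) v = 0 \<Longrightarrow> dF x0 (X x0) v = 0"
  shows "(\<Sum>b\<in>Basis. frechet_derivative X (at x0) b \<bullet> b) = (\<Sum>b\<in>Basis. frechet_derivative Y (at x0) b \<bullet> b)"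
proof -
  let ?f' = "frechet_derivative f (at x0)" and ?X' = "frechet_derivative X (at x0)" and ?Y' = "frechet_derivative Y (at x0)"
  note f' = smooth_on_has_derivative[OF f(1) N(2)]
  note lin = has_derivative_linear[OF f']
  have X': "(X has_derivative ?X') (at x0)" and Y': "(Y has_derivative ?Y') (at x0)"
    using X(1) Y(1) by (auto simp: frechet_derivative_works)
  define \<Delta> where "\<Delta> = (\<lambda>v. ?X' v - ?Y' v)"
  have \<Delta>: "((\<lambda>x. X x - Y x) has_derivative \<Delta>) (at x0)" unfolding \<Delta>_def by (intro has_derivative_diff X' Y')
  note lin\<Delta> = has_derivative_linear[OF \<Delta>]
  have ker: "\<Delta> v = 0" if "?f' v = 0" for v
    by (rule eventually_on_level_set_derivative_zero[OF N(1,2) f \<Delta>]) (use eq that in auto)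
  have x0D: "x0 \<in> D" using N by blast
  have X0: "X x0 \<noteq> 0" using F_one_nonzero[OF x0D X(2)[OF N(2)]] .
  have dec: "v - (?f' v / ?f' e) *\<^sub>R e \<in> {v. ?f' v = 0}" for v
    using linear_diff[OF lin, of v "(?f' v / ?f' e) *\<^sub>R e"] linear_scale[OF lin, of "?f' v / ?f' e" e] f(3) by simp
  have \<Delta>_eq: "\<Delta> v = (?f' v / ?f' e) *\<^sub>R \<Delta> e" for v
    using ker dec[of v] linear_diff[OF lin\<Delta>, of v "(?f' v / ?f' e) *\<^sub>R e"] linear_scale[OF lin\<Delta>, of "?f' v / ?f' e" e] by simp
  have dF_f': "dF x0 (X x0) v = (?f' v / ?f' e) * dF x0 (X x0) e" for v
    using normal dec[of v] linear_diff[OF linear_dF[OF x0D X0], of v "(?f' v / ?f' e) *\<^sub>R e"]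
      linear_scale[OF linear_dF[OF x0D X0], of "?f' v / ?f' e" e] by simp
  have "dF x0 (X x0) (X x0) = 1" using dF_euler[OF x0D X0] X(2)[OF N(2)] by simp
  then have dFe: "dF x0 (X x0) e \<noteq> 0" using dF_f'[of "X x0"] by auto
  have unit: "frechet_derivative F (at (x0, X x0)) (v, Z' v) = 0"
    if "(Z has_derivative Z') (at x0)" "Z x0 = X x0" "\<And>x. x \<in> N \<Longrightarrow> F (x, Z x) = 1" for Z Z' v
  proof -
    have 1: "((\<lambda>x. (x, Z x)) has_derivative (\<lambda>v. (v, Z' v))) (at x0)"
      by (intro has_derivative_Pair has_derivative_ident that(1))
    have "((\<lambda>x. F (x, Z x)) has_derivative (\<lambda>v. frechet_derivative F (at (x0, X x0)) (v, Z' v))) (at x0)"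
      by (rule has_derivative_compose[where f="\<lambda>x. (x, Z x)" and x=x0, OF 1]) (simp add: that(2) F'[OF x0D X0])
    moreover have "((\<lambda>x. F (x, Z x)) has_derivative (\<lambda>v. 0)) (at x0)"
      by (rule has_derivative_transform_within_open[OF has_derivative_const[of 1] N(1,2)]) (simp add: that(3))
    ultimately have "(\<lambda>v. frechet_derivative F (at (x0, X x0)) (v, Z' v)) = (\<lambda>v. 0)" by (rule has_derivative_unique)
    from fun_cong[OF this, of v] show ?thesis .
  qed
  \<comment> \<open>Both fields agree at \<open>x0\<close>, so in the two differentiated equations
    the contributions of the base point are the same and cancel.\<close>
  have "frechet_derivative F (at (x0, X x0)) (e, ?X' e) - frechet_derivative F (at (x0, X x0)) (e, ?Y' e) = 0"
    using unit[OF X' refl X(2)] unit[OF Y' _ Y(2)] eq[OF N(2) f(2)] by simp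
  then have "dF x0 (X x0) (\<Delta> e) = 0"
    using linear_diff[OF has_derivative_linear[OF F'[OF x0D X0]], of "(e, ?X' e)" "(e, ?Y' e)"] dF_eq[OF x0D X0]
    by (simp add: \<Delta>_def)
  then have 0: "?f' (\<Delta> e) = 0" using dF_f'[of "\<Delta> e"] dFe f(3) by simp
  \<comment> \<open>The trace of a rank-one map \<open>v \<mapsto> df v * R\<close> is
    \<open>df R\<close>, and here \<open>R\<close> is proportional to \<open>\<Delta> e\<close>,
    which lies in the kernel of \<open>df\<close>.\<close>
  have "(\<Sum>b\<in>Basis. \<Delta> b \<bullet> b) = (\<Sum>b\<in>Basis. (?f' b * (\<Delta> e \<bullet> b)) / ?f' e)"
    by (rule sum.cong[OF refl]) (subst \<Delta>_eq, simp)
  also have "\<dots> = (\<Sum>b\<in>Basis. (\<Delta> e \<bullet> b) *\<^sub>R ?f' b) / ?f' e"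
    by (simp add: sum_divide_distrib mult.commute)
  also have "\<dots> = 0" using linear_euclidean_expand[OF lin, of "\<Delta> e"] 0 by simp
  finally show ?thesis by (simp add: \<Delta>_def inner_diff_left sum_subtractf)
qed

text \<open>The Legendre transform of \<open>y\<close>: the covector
  \<open>g_y(y, .) = F * dF\<close>, half the fibre differential of \<open>F\<^sup>2\<close>,
  written as a vector through the Euclidean inner product.\<close>

definition gradF :: "'a \<times> 'a \<Rightarrow> 'a" where
  "gradF z = (\<Sum>b\<in>Basis. (F z * frechet_derivative F (at z) (0, b)) *\<^sub>R b)"

lemma gradF_inner: "x \<in> D \<Longrightarrow> y \<noteq> 0 \<Longrightarrow> gradF (x, y) \<bullet> v = F (x, y) * dF x y v"
proof -
  assume a: "x \<in> D" "y \<noteq> 0"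
  have eq: "(\<lambda>b. F (x, y) * frechet_derivative F (at (x, y)) (0, b)) = (\<lambda>b. F (x, y) * dF x y b)"
    using dF_eq[OF a] by simp
  have "linear (\<lambda>b. F (x, y) * dF x y b)"
    using linear_compose_scale_right[OF linear_dF[OF a], of "F (x, y)"] by simp
  from inner_sum_functional[OF this] show ?thesis unfolding gradF_def fun_cong[OF eq] .
qed

lemma smooth_gradF: "smooth_on (D \<times> (- {0})) gradF"
  unfolding gradF_def
  by (intro smooth_on_sum smooth_on_scaleR smooth_on_mult smooth_on_const smooth_on_frechet_derivative smooth_F open_slit)

lemma gradF_scale: "x \<in> D \<Longrightarrow> r > 0 \<Longrightarrow> y \<noteq> 0 \<Longrightarrow> gradF (x, r *\<^sub>R y) = r *\<^sub>R gradF (x, y)"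
  unfolding gradF_def using dF_eq[of x y] dF_eq[of x "r *\<^sub>R y"] dF_scale F_scale
  by (simp add: scaleR_sum_right mult.assoc)

text \<open>The fibre derivative of the Legendre transformation is the fundamental tensor; its
  definiteness is what makes the transformation locally invertible.\<close>

lemma gradF_fibre_derivative:
  assumes x: "x \<in> D" and y: "y \<noteq> 0" and v: "v \<noteq> 0"
  shows "frechet_derivative gradF (at (x, y)) (0, v) \<bullet> v > 0"
proof -
  interpret minkowski_norm "\<lambda>y. F (x, y)" by (rule minkowski[OF x])
  let ?G = "\<lambda>y. (F (x, y))\<^sup>2"
  have "((\<lambda>y. (x, y)) has_derivative (\<lambda>v. (0, v))) (at y)" by (intro has_derivative_Pair has_derivative_ident has_derivative_const)
  moreover have "(gradF has_derivative frechet_derivative gradF (at (x, y))) (at (x, y))"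
    by (rule smooth_on_has_derivative[OF smooth_gradF]) (use x y in simp)
  ultimately have "((\<lambda>y. gradF (x, y)) has_derivative (\<lambda>w. frechet_derivative gradF (at (x, y)) (0, w))) (at y)"
    by (rule has_derivative_compose)
  then have "((\<lambda>y. gradF (x, y) \<bullet> v) has_derivative (\<lambda>w. frechet_derivative gradF (at (x, y)) (0, w) \<bullet> v)) (at y)"
    by (rule has_derivative_inner_left)
  then have "((\<lambda>y. 2 * (gradF (x, y) \<bullet> v)) has_derivative (\<lambda>w. 2 * (frechet_derivative gradF (at (x, y)) (0, w) \<bullet> v))) (at y)"
    by (rule has_derivative_mult_right)
  then have "((\<lambda>w. frechet_derivative ?G (at w) v) has_derivative (\<lambda>w. 2 * (frechet_derivative gradF (at (x, y)) (0, w) \<bullet> v))) (at y)"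
    by (rule has_derivative_transform_within_open[OF _ open_ne]) (use y x in \<open>auto simp: gradF_inner frechet_sq dF_def\<close>)
  from frechet_derivative_apply[OF this, of v] show ?thesis
    using mixed_deriv[OF open_ne _ smooth_sq, of y v v] pos_def[OF y v] y by simp
qed

text \<open>The Hamiltonian is \<open>F* + V\<close>, where the dual norm \<open>F*\<close> is obtained locally by inverting
  the Legendre transformation \<open>(x, y) \<mapsto> (x, gradF (x, y))\<close>. With \<open>V = 0\<close> its characteristics
  are the geodesics of \<open>F\<close>, with \<open>V\<close> the wind those of the Zermelo metric.\<close>

theorem distance_function_exists:
  fixes f :: "'a \<Rightarrow> real"
  assumes N: "open N" "x0 \<in> N" "N \<subseteq> D" and f: "smooth_on N f" "f x0 = 0"
    and V: "smooth_on N V" and n: "smooth_on N n" "\<And>x. x \<in> N \<Longrightarrow> f x = 0 \<Longrightarrow> F (x, n x) = 1"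
    and normal: "\<And>x v. x \<in> N \<Longrightarrow> f x = 0 \<Longrightarrow> frechet_derivative f (at x) v = 0 \<Longrightarrow> dF x (n x) v = 0"
    and wind: "0 < 1 + dF x0 (n x0) (V x0)"
  obtains N' Y \<rho> where "open N'" "x0 \<in> N'" "N' \<subseteq> N" "smooth_on N' \<rho>" "smooth_on N' Y"
    "\<And>x. x \<in> N' \<Longrightarrow> F (x, Y x) = 1" "\<And>x. x \<in> N' \<Longrightarrow> 0 < 1 + dF x (Y x) (V x)"
    "\<And>x v. x \<in> N' \<Longrightarrow> frechet_derivative \<rho> (at x) v = dF x (Y x) v / (1 + dF x (Y x) (V x))"
    "\<And>x. x \<in> N' \<Longrightarrow> \<rho> x = 0 \<longleftrightarrow> f x = 0" "\<And>x. x \<in> N' \<Longrightarrow> f x = 0 \<Longrightarrow> Y x = n x"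
proof -
  have x0D: "x0 \<in> D" using N by blast
  have n0: "n x0 \<noteq> 0" by (rule F_one_nonzero[OF x0D n(2)[OF N(2) f(2)]])
  \<comment> \<open>The momentum on the hypersurface has to be a multiple \<open>\<kappa>\<close> of
    \<open>gradF (x, n x)\<close> with Hamiltonian 1. For unit \<open>n x\<close> the dual norm
    contributes \<open>\<kappa>\<close> and the drift \<open>\<kappa>\<close> times the pairing with
    \<open>V\<close>, which determines \<open>\<kappa>\<close>.\<close>
  define \<kappa> where "\<kappa> = (\<lambda>x. inverse (1 + gradF (x, n x) \<bullet> V x))"
  have wind': "0 < 1 + gradF (x0, n x0) \<bullet> V x0"
    using wind gradF_inner[OF x0D n0] n(2)[OF N(2) f(2)] by simp
  have l0: "\<kappa> x0 > 0" using wind' by (simp add: \<kappa>_def)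
  let ?S = "D \<times> (- {0::'a})"
  define L where "L = (\<lambda>z. (fst z, gradF z))"
  have smL: "smooth_on ?S L" unfolding L_def by (intro smooth_on_Pair smooth_on_fst smooth_gradF open_slit)
  have L': "frechet_derivative L (at z) d = (fst d, frechet_derivative gradF (at z) d)" if "z \<in> ?S" for z d
  proof -
    have "(L has_derivative (\<lambda>d. (fst d, frechet_derivative gradF (at z) d))) (at z)"
      unfolding L_def
      by (intro has_derivative_Pair has_derivative_fst has_derivative_ident smooth_on_has_derivative[OF smooth_gradF that])
    then show ?thesis by (rule frechet_derivative_apply)
  qed
  define y0 where "y0 = \<kappa> x0 *\<^sub>R n x0"
  have y0: "(x0, y0) \<in> ?S" using x0D n0 l0 by (simp add: y0_def)
  have inj: "d = 0" if d: "frechet_derivative L (at (x0, y0)) d = 0" for d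
  proof -
    have 1: "fst d = 0" "frechet_derivative gradF (at (x0, y0)) d = 0" using d L'[OF y0, of d] by (auto simp: zero_prod_def)
    then have "d = (0, snd d)" by (simp add: prod_eq_iff)
    then have "snd d = 0" using gradF_fibre_derivative[OF x0D, of y0 "snd d"] 1(2) y0 by auto
    then show ?thesis using 1(1) by (simp add: prod_eq_iff)
  qed
  obtain U' V' Li where U': "open U'" "U' \<subseteq> ?S" "(x0, y0) \<in> U'" and V': "open V'" "L (x0, y0) \<in> V'"
    and hom: "homeomorphism U' V' L Li" and smLi: "smooth_on V' Li"
    and "\<And>y v. y \<in> V' \<Longrightarrow> frechet_derivative L (at (Li y)) (frechet_derivative Li (at y) v) = v"
    by (rule smooth_inverse_function[OF open_slit smL y0 inj]) (assumption, rule that)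
  define l where "l = (\<lambda>z. snd (Li z))"
  have Li: "Li (x, q) = (x, l (x, q))" "x \<in> D" "l (x, q) \<noteq> 0" "gradF (x, l (x, q)) = q" if "(x, q) \<in> V'" for x q
  proof -
    have 1: "L (Li (x, q)) = (x, q)" "Li (x, q) \<in> U'" using hom that by (auto simp: homeomorphism_def)
    then show 2: "Li (x, q) = (x, l (x, q))" by (simp add: L_def l_def prod_eq_iff)
    show "x \<in> D" "l (x, q) \<noteq> 0" using 1(2) U'(2) unfolding 2 by auto
    show "gradF (x, l (x, q)) = q" using 1(1) unfolding 2 by (simp add: L_def)
  qed
  have LiL: "Li (x, gradF (x, y)) = (x, y)" "(x, gradF (x, y)) \<in> V'" if "(x, y) \<in> U'" for x y
    using hom that unfolding homeomorphism_def L_def by force+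
  define E where "E = V' \<inter> N \<times> UNIV"
  have oE: "open E" unfolding E_def by (intro open_Int V' open_Times N open_UNIV)
  have smlE: "smooth_on E l"
    unfolding l_def E_def[symmetric]
    by (rule smooth_on_subset[OF smooth_on_bounded_linear_comp[OF bounded_linear_snd V'(1) smLi]]) (simp add: E_def)
  have smLiE: "smooth_on E Li" by (rule smooth_on_subset[OF smLi]) (simp add: E_def)
  have LiS: "Li z \<in> ?S" if "z \<in> V'" for z using hom that U'(2) by (auto simp: homeomorphism_def)
  have smFL: "smooth_on E (\<lambda>z. F (Li z))"
    by (rule smooth_on_compose[OF oE open_slit smLiE smooth_F]) (use LiS in \<open>simp add: E_def\<close>)
  have smVE: "smooth_on E (\<lambda>z. V (fst z))"
    by (rule smooth_on_compose[OF oE N(1) smooth_on_fst[OF oE] V]) (auto simp: E_def)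
  \<comment> \<open>\<open>F (Li z)\<close> is the dual norm of the momentum \<open>snd z\<close>,
    expressed through the vector whose Legendre transform it is.\<close>
  define H where "H = (\<lambda>z. F (Li z) + snd z \<bullet> V (fst z))"
  have smH: "smooth_on E H"
    unfolding H_def by (intro smooth_on_add smooth_on_inner smFL smVE smooth_on_snd oE)
  have legendre: "q \<bullet> l (x, q) = (F (Li (x, q)))\<^sup>2" if "(x, q) \<in> V'" for x q
    using gradF_inner[OF Li(2,3)[OF that], of "l (x, q)"] Li[OF that] dF_euler[OF Li(2,3)[OF that]]
    by (simp add: power2_eq_square)
  \<comment> \<open>The local inverse \<open>Li\<close> lives on an open set that need not be a
    cone, so homogeneity of the dual norm cannot simply be quoted; Euler's identity is obtained by
    differentiating \<open>legendre\<close>.\<close>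
  have eulerH: "frechet_derivative H (at (x, q)) (0, q) = H (x, q)" if xq: "(x, q) \<in> E" for x q
  proof -
    have xV: "(x, q) \<in> V'" and xN: "x \<in> N" using xq by (auto simp: E_def)
    note Lx = Li[OF xV]
    let ?z = "(x, q)"
    have FL: "F (Li ?z) > 0" using F_pos[OF Lx(2,3)] Lx(1) by simp
    define Fl' where "Fl' = frechet_derivative (\<lambda>z. F (Li z)) (at ?z)"
    define l' where "l' = frechet_derivative l (at ?z)"
    have l': "(l has_derivative l') (at ?z)" unfolding l'_def by (rule smooth_on_has_derivative[OF smlE xq])
    have Fl': "((\<lambda>z. F (Li z)) has_derivative Fl') (at ?z)" unfolding Fl'_def by (rule smooth_on_has_derivative[OF smFL xq])
    have A: "Fl' (0, k) * F (Li ?z) = q \<bullet> l' (0, k)" for k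
    proof -
      have "((\<lambda>q. (x, q)) has_derivative (\<lambda>k. (0, k))) (at q)" by (intro has_derivative_Pair has_derivative_ident has_derivative_const)
      note c = this
      have B: "((\<lambda>q. F (Li (x, q))) has_derivative (\<lambda>k. Fl' (0, k))) (at q)" by (rule has_derivative_compose[OF c Fl'])
      have C: "((\<lambda>q. l (x, q)) has_derivative (\<lambda>k. l' (0, k))) (at q)" by (rule has_derivative_compose[OF c l'])
      have "((\<lambda>y. F (x, y)) has_derivative dF x (l ?z)) (at (l ?z))"
        unfolding dF_def using minkowski_norm.f'[OF minkowski[OF Lx(2)] Lx(3)] .
      then have D: "((\<lambda>q. F (x, l (x, q))) has_derivative (\<lambda>k. dF x (l ?z) (l' (0, k)))) (at q)"
        by (rule has_derivative_compose[where f="\<lambda>q. l (x, q)" and x=q, OF C])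
      have "open ((\<lambda>q. (x, q)) -` V')" by (intro open_vimage V' continuous_intros)
      then have "((\<lambda>q. F (Li (x, q))) has_derivative (\<lambda>k. dF x (l ?z) (l' (0, k)))) (at q)"
        by (rule has_derivative_transform_within_open[OF D]) (use xV Li(1) in auto)
      from fun_cong[OF has_derivative_unique[OF B this], of k]
      have "Fl' (0, k) = dF x (l ?z) (l' (0, k))" .
      then show ?thesis using gradF_inner[OF Lx(2,3), of "l' (0, k)"] Lx(1,4) by (simp add: mult.commute)
    qed
    \<comment> \<open>Differentiating \<open>q \<bullet> l = F\<^sup>2\<close> radially and
      replacing the right side by \<open>A\<close> gives
      \<open>q \<bullet> l' + q \<bullet> l = 2 * (q \<bullet> l')\<close>.\<close>
    have Bq: "q \<bullet> l' (0, q) = q \<bullet> l ?z"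
    proof -
      have "((\<lambda>z. snd z \<bullet> l z) has_derivative (\<lambda>d. snd ?z \<bullet> l' d + snd d \<bullet> l ?z)) (at ?z)"
        by (intro has_derivative_inner has_derivative_snd has_derivative_ident l')
      moreover have "((\<lambda>z. snd z \<bullet> l z) has_derivative (\<lambda>d. 2 * F (Li ?z) * Fl' d)) (at ?z)"
      proof (rule has_derivative_transform_within_open[OF _ V'(1) xV])
        show "((\<lambda>z. (F (Li z))\<^sup>2) has_derivative (\<lambda>d. 2 * F (Li ?z) * Fl' d)) (at ?z)"
          using has_derivative_power[OF Fl', of 2] by (simp add: mult.commute mult.left_commute)
        show "(F (Li z))\<^sup>2 = snd z \<bullet> l z" if "z \<in> V'" for z using legendre[of "fst z" "snd z"] that by simp
      qed
      ultimately have "(\<lambda>d. snd ?z \<bullet> l' d + snd d \<bullet> l ?z) = (\<lambda>d. 2 * F (Li ?z) * Fl' d)" by (rule has_derivative_unique)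
      from fun_cong[OF this, of "(0, q)"] have "q \<bullet> l' (0, q) + q \<bullet> l ?z = 2 * (Fl' (0, q) * F (Li ?z))" by simp
      then show ?thesis unfolding A by simp
    qed
    have "Fl' (0, q) * F (Li ?z) = F (Li ?z) * F (Li ?z)"
      using A[of q] Bq legendre[OF xV] by (simp add: power2_eq_square)
    then have Fq: "Fl' (0, q) = F (Li ?z)" using FL by simp
    have "(fst has_derivative fst) (at ?z)" by (intro has_derivative_fst has_derivative_ident)
    from has_derivative_compose[OF this] smooth_on_has_derivative[OF V xN]
    have "((\<lambda>z. V (fst z)) has_derivative (\<lambda>d. frechet_derivative V (at x) (fst d))) (at ?z)" by simp
    then have "(H has_derivative (\<lambda>d. Fl' d + (snd ?z \<bullet> frechet_derivative V (at x) (fst d) + snd d \<bullet> V (fst ?z)))) (at ?z)"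
      unfolding H_def by (intro has_derivative_add has_derivative_inner has_derivative_snd has_derivative_ident Fl')
    from frechet_derivative_apply[OF this, of "(0, q)"] show ?thesis
      using Fq linear_0[OF has_derivative_linear[OF smooth_on_has_derivative[OF V xN]]] by (simp add: H_def)
  qed
  \<comment> \<open>Away from the hypersurface \<open>n\<close> is an arbitrary smooth extension: it
    may vanish or violate the wind condition. The neighbourhoods \<open>N1\<close>,
    \<open>N2\<close> and \<open>N3\<close> restore these properties and the applicability of the
    local inverse.\<close>
  define N1 where "N1 = {x \<in> N. n x \<in> - {0}}"
  have oN1: "open N1"
    using continuous_open_preimage[OF smooth_on_continuous_on[OF n(1)] N(1) open_Compl[OF closed_singleton[of 0]]]
    by (simp add: N1_def vimage_def Int_def)
  have N1: "x \<in> N" "x \<in> D" "n x \<noteq> 0" if "x \<in> N1" for x using that N(3) by (auto simp: N1_def)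
  have smn1: "smooth_on N1 n" and smV1: "smooth_on N1 V" and smf1: "smooth_on N1 f"
    by (rule smooth_on_subset[OF n(1)] smooth_on_subset[OF V] smooth_on_subset[OF f(1)], auto simp: N1_def)+
  have smg1: "smooth_on N1 (\<lambda>x. gradF (x, n x))"
    by (rule smooth_on_compose[OF oN1 open_slit _ smooth_gradF]) (use N1 in \<open>auto intro!: smooth_on_Pair smooth_on_ident smn1 oN1\<close>)
  have sm1: "smooth_on N1 (\<lambda>x. 1 + gradF (x, n x) \<bullet> V x)"
    by (intro smooth_on_add smooth_on_const smooth_on_inner smg1 smV1 oN1)
  define N2 where "N2 = {x \<in> N1. 1 + gradF (x, n x) \<bullet> V x \<in> {0<..}}"
  have oN2: "open N2"
    using continuous_open_preimage[OF smooth_on_continuous_on[OF sm1] oN1, of "{0<..}"] by (simp add: N2_def vimage_def Int_def)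
  have N21: "N2 \<subseteq> N1" by (auto simp: N2_def)
  have lpos: "\<kappa> x > 0" if "x \<in> N2" for x using that by (simp add: N2_def \<kappa>_def)
  have sml: "smooth_on N2 \<kappa>"
    unfolding \<kappa>_def by (rule smooth_on_inverse[OF oN2 smooth_on_subset[OF sm1 N21]]) (simp add: N2_def)
  have smln: "smooth_on N2 (\<lambda>x. (x, \<kappa> x *\<^sub>R n x))"
    by (intro smooth_on_Pair smooth_on_ident smooth_on_scaleR sml smooth_on_subset[OF smn1 N21] oN2)
  define N3 where "N3 = {x \<in> N2. (x, \<kappa> x *\<^sub>R n x) \<in> U'}"
  have oN3: "open N3"
    using continuous_open_preimage[OF smooth_on_continuous_on[OF smln] oN2 U'(1)] by (simp add: N3_def vimage_def Int_def)
  have N32: "N3 \<subseteq> N2" and N31: "N3 \<subseteq> N1" using N21 by (auto simp: N3_def)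
  have x0N3: "x0 \<in> N3" using N(2) n0 wind' U'(3) by (simp add: N3_def N2_def N1_def y0_def)
  define q0 where "q0 = (\<lambda>x. \<kappa> x *\<^sub>R gradF (x, n x))"
  have smq0: "smooth_on N3 q0"
    unfolding q0_def by (intro smooth_on_scaleR smooth_on_subset[OF sml N32] smooth_on_subset[OF smg1 N31] oN3)
  have q0: "(x, q0 x) \<in> E" "Li (x, q0 x) = (x, \<kappa> x *\<^sub>R n x)" if "x \<in> N3" for x
  proof -
    have "x \<in> N1" "x \<in> N2" using that N31 N32 by auto
    then have eq: "gradF (x, \<kappa> x *\<^sub>R n x) = q0 x" using gradF_scale[of x "\<kappa> x" "n x"] N1 lpos by (simp add: q0_def)
    have "(x, \<kappa> x *\<^sub>R n x) \<in> U'" using that by (simp add: N3_def)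
    from LiL[OF this] show "(x, q0 x) \<in> E" "Li (x, q0 x) = (x, \<kappa> x *\<^sub>R n x)"
      using N1(1)[OF \<open>x \<in> N1\<close>] by (auto simp: eq E_def)
  qed
  have H1: "H (x, q0 x) = 1" if x: "x \<in> N3" "f x = 0" for x
  proof -
    have x1: "x \<in> N1" and x2: "x \<in> N2" using x N31 N32 by auto
    have "F (x, \<kappa> x *\<^sub>R n x) = \<kappa> x" using F_scale[OF N1(2)[OF x1] lpos[OF x2], of "n x"] n(2)[OF N1(1)[OF x1] x(2)] by simp
    then have "H (x, q0 x) = \<kappa> x + q0 x \<bullet> V x" using q0(2)[OF x(1)] by (simp add: H_def)
    also have "\<dots> = \<kappa> x * (1 + gradF (x, n x) \<bullet> V x)" by (simp add: q0_def algebra_simps)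
    also have "\<dots> = 1" using x2 by (simp add: \<kappa>_def N2_def)
    finally show ?thesis .
  qed
  have conormal: "q0 x \<bullet> v = 0" if x: "x \<in> N3" "f x = 0" "frechet_derivative f (at x) v = 0" for x v
  proof -
    have x1: "x \<in> N1" using x N31 by auto
    show ?thesis using normal[OF N1(1)[OF x1] x(2,3)] gradF_inner[OF N1(2,3)[OF x1], of v] by (simp add: q0_def)
  qed
  obtain N' P \<rho> where N': "open N'" "x0 \<in> N'" "N' \<subseteq> N3" and sm: "smooth_on N' \<rho>" "smooth_on N' P"
    and PE: "\<And>x. x \<in> N' \<Longrightarrow> (x, P x) \<in> E" and HP: "\<And>x. x \<in> N' \<Longrightarrow> H (x, P x) = 1"
    and \<rho>': "\<And>x v. x \<in> N' \<Longrightarrow> frechet_derivative \<rho> (at x) v = P x \<bullet> v"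
    and \<rho>f: "\<And>x. x \<in> N' \<Longrightarrow> \<rho> x = 0 \<longleftrightarrow> f x = 0" and Pq: "\<And>x. x \<in> N' \<Longrightarrow> f x = 0 \<Longrightarrow> P x = q0 x"
    by (rule eikonal_local_solution[OF oE smH oN3 x0N3 smooth_on_subset[OF smf1 N31] f(2) smq0 q0(1) H1 conormal eulerH])
       (assumption+, rule that)
  \<comment> \<open>The unit vector in the direction whose Legendre transform is the momentum. The
    equation \<open>H = 1\<close> says that \<open>F (Li (x, P x))\<close> is the reciprocal of
    \<open>1 + dF x (Y x) (V x)\<close>, which turns \<open>P\<close> into the stated
    differential.\<close>
  define Y where "Y = (\<lambda>x. inverse (F (Li (x, P x))) *\<^sub>R l (x, P x))"
  have smP: "smooth_on N' (\<lambda>x. (x, P x))" by (intro smooth_on_Pair smooth_on_ident sm N')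
  have FY: "F (x, Y x) = 1" "1 + dF x (Y x) (V x) = inverse (F (Li (x, P x)))" "dF x (Y x) v = inverse (F (Li (x, P x))) * (P x \<bullet> v)"
      "F (Li (x, P x)) > 0" if x: "x \<in> N'" for x v
  proof -
    have xV: "(x, P x) \<in> V'" using PE[OF x] by (simp add: E_def)
    note Lx = Li[OF xV]
    show FL: "F (Li (x, P x)) > 0" using F_pos[OF Lx(2,3)] Lx(1) by simp
    show "F (x, Y x) = 1" using F_scale[OF Lx(2), of "inverse (F (Li (x, P x)))" "l (x, P x)"] FL Lx(1) by (simp add: Y_def)
    have dFY: "dF x (Y x) v = inverse (F (Li (x, P x))) * (P x \<bullet> v)" for v
      using dF_scale[OF Lx(2) _ Lx(3), of "inverse (F (Li (x, P x)))" v] FL gradF_inner[OF Lx(2,3), of v] Lx(1,4)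
      by (simp add: Y_def field_simps)
    show "dF x (Y x) v = inverse (F (Li (x, P x))) * (P x \<bullet> v)" by (rule dFY)
    show "1 + dF x (Y x) (V x) = inverse (F (Li (x, P x)))"
      using HP[OF x] FL unfolding dFY H_def by (simp add: field_simps)
  qed
  show ?thesis
  proof (rule that[of N' \<rho> Y])
    show "N' \<subseteq> N" using N'(3) N31 by (auto simp: N1_def)
    show "smooth_on N' Y"
      unfolding Y_def
      by (intro smooth_on_scaleR smooth_on_inverse smooth_on_compose[OF N'(1) oE smP smFL] smooth_on_compose[OF N'(1) oE smP smlE] N' PE)
         (assumption, drule FY(4), simp, assumption)
    show "frechet_derivative \<rho> (at x) v = dF x (Y x) v / (1 + dF x (Y x) (V x))" if "x \<in> N'" for x v
      using FY[OF that] \<rho>'[OF that] by (simp add: FY(2,3)[OF that])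
    show "Y x = n x" if x: "x \<in> N'" "f x = 0" for x
    proof -
      have x3: "x \<in> N3" and x1: "x \<in> N1" and x2: "x \<in> N2" using x N' N31 N32 by auto
      have "Li (x, P x) = (x, \<kappa> x *\<^sub>R n x)" using q0(2)[OF x3] Pq[OF x] by simp
      moreover have "F (x, \<kappa> x *\<^sub>R n x) = \<kappa> x" using F_scale[OF N1(2)[OF x1] lpos[OF x2], of "n x"] n(2)[OF N1(1)[OF x1] x(2)] by simp
      ultimately show ?thesis using lpos[OF x2] by (simp add: Y_def l_def)
    qed
    show "0 < 1 + dF x (Y x) (V x)" if "x \<in> N'" for x
      using FY(2,4)[OF that] by simp
  qed (use N' sm FY(1) \<rho>f in auto)
qed

end

section \<open>Manifolds in charts\<close>

locale atlas =
  fixes M :: "'a topology" and \<A> :: "('a, 'n::finite) chart set"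
  assumes manifold: "smooth_manifold M \<A>"
begin

lemma chart:
  assumes "c \<in> \<A>"
  shows "openin M (fst c)" "open (snd c ` fst c)" "homeomorphic_map (subtopology M (fst c)) (top_of_set (snd c ` fst c)) (snd c)"
  using assms manifold unfolding smooth_manifold_def is_chart_def by blast+

lemma topspace_chart: "c \<in> \<A> \<Longrightarrow> topspace (subtopology M (fst c)) = fst c"
  using openin_subset[OF chart(1), of c] by (simp add: Int_absorb1)

lemma chart_inj: "c \<in> \<A> \<Longrightarrow> inj_on (snd c) (fst c)"
  using homeomorphic_imp_injective_map[OF chart(3)] topspace_chart by metis

lemma chart_inv [simp]: "c \<in> \<A> \<Longrightarrow> p \<in> fst c \<Longrightarrow> chart_inv c (snd c p) = p"
  by (simp add: chart_inv_def chart_inj)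

lemma chart_inv_mem: "x \<in> snd c ` fst c \<Longrightarrow> chart_inv c x \<in> fst c"
  by (simp add: chart_inv_def inv_into_into)

lemma chart_chart_inv: "x \<in> snd c ` fst c \<Longrightarrow> snd c (chart_inv c x) = x"
  by (simp add: chart_inv_def f_inv_into_f)

lemma open_image: "c \<in> \<A> \<Longrightarrow> openin M U \<Longrightarrow> open (snd c ` (U \<inter> fst c))"
proof -
  assume c: "c \<in> \<A>" and U: "openin M U"
  have "openin (subtopology M (fst c)) (U \<inter> fst c)" using U by (rule openin_subtopology_Int)
  then have "openin (top_of_set (snd c ` fst c)) (snd c ` (U \<inter> fst c))"
    using homeomorphic_imp_open_map[OF chart(3)[OF c]] by (simp add: open_map_def)
  then show ?thesis using chart(2)[OF c] by (simp add: openin_open_eq)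
qed

lemma open_preimage: "c \<in> \<A> \<Longrightarrow> open S \<Longrightarrow> S \<subseteq> snd c ` fst c \<Longrightarrow> openin M (chart_inv c ` S)"
proof -
  assume c: "c \<in> \<A>" and S: "open S" "S \<subseteq> snd c ` fst c"
  have "openin (top_of_set (snd c ` fst c)) S" using S chart(2)[OF c] by (simp add: openin_open_eq)
  from openin_continuous_map_preimage[OF homeomorphic_imp_continuous_map[OF chart(3)[OF c]] this]
  have "openin (subtopology M (fst c)) {p \<in> fst c. snd c p \<in> S}" unfolding topspace_chart[OF c] .
  then have "openin M {p \<in> fst c. snd c p \<in> S}" by (rule openin_trans_full[OF _ chart(1)[OF c]])
  moreover have "{p \<in> fst c. snd c p \<in> S} = chart_inv c ` S"
  proof (intro equalityI subsetI)
    fix p assume "p \<in> {p \<in> fst c. snd c p \<in> S}"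
    then have "p = chart_inv c (snd c p)" "snd c p \<in> S" using c by simp_all
    then show "p \<in> chart_inv c ` S" by (rule image_eqI)
  next
    fix p assume "p \<in> chart_inv c ` S"
    then obtain x where x: "x \<in> S" "p = chart_inv c x" by blast
    then have xi: "x \<in> snd c ` fst c" using S(2) by blast
    show "p \<in> {p \<in> fst c. snd c p \<in> S}" using x chart_inv_mem[OF xi] chart_chart_inv[OF xi] by simp
  qed
  ultimately show ?thesis by simp
qed

lemma chart_at: "p \<in> topspace M \<Longrightarrow> chart_at \<A> p \<in> \<A>" "p \<in> topspace M \<Longrightarrow> p \<in> fst (chart_at \<A> p)"
proof -
  assume "p \<in> topspace M"
  moreover have "(\<Union>c\<in>\<A>. fst c) = topspace M" using manifold by (simp add: smooth_manifold_def)
  ultimately have "\<exists>c. c \<in> \<A> \<and> p \<in> fst c" by blast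
  from someI_ex[OF this] show "chart_at \<A> p \<in> \<A>" "p \<in> fst (chart_at \<A> p)" by (auto simp: chart_at_def)
qed

lemma open_overlap: "c \<in> \<A> \<Longrightarrow> d \<in> \<A> \<Longrightarrow> open (snd c ` (fst c \<inter> fst d))"
  using open_image[of c "fst d"] chart(1)[of d] by (simp add: Int_commute)

lemma smooth_transition: "c \<in> \<A> \<Longrightarrow> d \<in> \<A> \<Longrightarrow> smooth_on (snd c ` (fst c \<inter> fst d)) (snd d \<circ> chart_inv c)"
  using manifold unfolding smooth_manifold_def by blast

abbreviation DT :: "('a, 'n) chart \<Rightarrow> ('a, 'n) chart \<Rightarrow> 'a \<Rightarrow> real^'n \<Rightarrow> real^'n" where
  "DT c d p \<equiv> frechet_derivative (snd d \<circ> chart_inv c) (at (snd c p))"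

lemma has_derivative_transition:
  "c \<in> \<A> \<Longrightarrow> d \<in> \<A> \<Longrightarrow> p \<in> fst c \<Longrightarrow> p \<in> fst d \<Longrightarrow> ((snd d \<circ> chart_inv c) has_derivative DT c d p) (at (snd c p))"
  by (rule smooth_on_has_derivative[OF smooth_transition]) blast+

lemma linear_DT: "c \<in> \<A> \<Longrightarrow> d \<in> \<A> \<Longrightarrow> p \<in> fst c \<Longrightarrow> p \<in> fst d \<Longrightarrow> linear (DT c d p)"
  using has_derivative_transition has_derivative_linear by blast

lemma has_derivative_change_chart:
  assumes c: "c \<in> \<A>" and d: "d \<in> \<A>" and p: "p \<in> fst c" "p \<in> fst d"
    and f: "((f \<circ> chart_inv d) has_derivative D) (at (snd d p))"
  shows "((f \<circ> chart_inv c) has_derivative (\<lambda>y. D (DT c d p y))) (at (snd c p))"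
proof -
  have "((\<lambda>x. (f \<circ> chart_inv d) ((snd d \<circ> chart_inv c) x)) has_derivative (\<lambda>y. D (DT c d p y))) (at (snd c p))"
  proof (rule has_derivative_compose[where g="f \<circ> chart_inv d", OF has_derivative_transition[OF c d p]])
    show "(f \<circ> chart_inv d has_derivative D) (at ((snd d \<circ> chart_inv c) (snd c p)))"
      using f unfolding comp_apply[of "snd d"] chart_inv[OF c p(1)] .
  qed
  then show ?thesis
  proof (rule has_derivative_transform_within_open[OF _ open_overlap[OF c d]])
    fix x assume "x \<in> snd c ` (fst c \<inter> fst d)"
    then obtain q where "x = snd c q" "q \<in> fst c" "q \<in> fst d" by blast
    then show "(f \<circ> chart_inv d) ((snd d \<circ> chart_inv c) x) = (f \<circ> chart_inv c) x" using c d by simp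
  qed (use p in blast)
qed

lemma DT_compose:
  assumes "c \<in> \<A>" "d \<in> \<A>" "e \<in> \<A>" "p \<in> fst c" "p \<in> fst d" "p \<in> fst e"
  shows "DT d e p (DT c d p y) = DT c e p y"
  using frechet_derivative_apply[OF has_derivative_change_chart[OF assms(1,2,4,5) has_derivative_transition[OF assms(2,3,5,6)]]]
  by simp

lemma DT_same: "c \<in> \<A> \<Longrightarrow> p \<in> fst c \<Longrightarrow> DT c c p y = y"
proof -
  assume c: "c \<in> \<A>" and p: "p \<in> fst c"
  have "((snd c \<circ> chart_inv c) has_derivative (\<lambda>y. y)) (at (snd c p))"
  proof (rule has_derivative_transform_within_open[OF has_derivative_ident chart(2)[OF c]])
    show "x = (snd c \<circ> chart_inv c) x" if "x \<in> snd c ` fst c" for x using chart_chart_inv[OF that] by simp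
  qed (use p in blast)
  from frechet_derivative_apply[OF this] show ?thesis .
qed

lemma vec_of_coords_mem: "c \<in> \<A> \<Longrightarrow> p \<in> fst c \<Longrightarrow> vec_of_coords \<A> c p y \<in> tangent_space \<A> p"
  unfolding tangent_space_def
proof (intro CollectI conjI ballI impI allI)
  assume c: "c \<in> \<A>" "p \<in> fst c"
  show "vec_of_coords \<A> c p y e = DT d e p (vec_of_coords \<A> c p y d)"
    if "d \<in> \<A>" "e \<in> \<A>" "p \<in> fst d \<and> p \<in> fst e" for d e
    using that c DT_compose[OF c(1) that(1,2)] by (simp add: vec_of_coords_def)
  show "vec_of_coords \<A> c p y d = 0" if "\<not> (d \<in> \<A> \<and> p \<in> fst d)" for d
    by (simp only: vec_of_coords_def if_not_P[OF that])
qed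

lemma vec_of_coords_apply: "c \<in> \<A> \<Longrightarrow> p \<in> fst c \<Longrightarrow> vec_of_coords \<A> c p y c = y"
  by (simp add: vec_of_coords_def DT_same)

lemma vec_of_coords_coords: "c \<in> \<A> \<Longrightarrow> p \<in> fst c \<Longrightarrow> v \<in> tangent_space \<A> p \<Longrightarrow> vec_of_coords \<A> c p (v c) = v"
proof
  assume c: "c \<in> \<A>" "p \<in> fst c" and v: "v \<in> tangent_space \<A> p"
  show "vec_of_coords \<A> c p (v c) d = v d" for d
  proof (cases "d \<in> \<A> \<and> p \<in> fst d")
    case True
    then have "v d = DT c d p (v c)" using c v unfolding tangent_space_def by blast
    then show ?thesis using True by (simp add: vec_of_coords_def)
  next
    case False
    then have "v d = 0" using v unfolding tangent_space_def by blast
    then show ?thesis by (simp only: vec_of_coords_def if_not_P[OF False])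
  qed
qed

lemma linear_vec_of_coords:
  assumes "c \<in> \<A>" "p \<in> fst c"
  shows "vec_of_coords \<A> c p (x + y) = vec_of_coords \<A> c p x + vec_of_coords \<A> c p y"
    "vec_of_coords \<A> c p (r *\<^sub>R x) = r *\<^sub>R vec_of_coords \<A> c p x"
    "vec_of_coords \<A> c p (x - y) = vec_of_coords \<A> c p x - vec_of_coords \<A> c p y"
    "vec_of_coords \<A> c p 0 = 0"
  using assms
  by (rule_tac [!] ext)
    (simp_all add: vec_of_coords_def scaleR_fun_def linear_add[OF linear_DT] linear_scale[OF linear_DT]
      linear_diff[OF linear_DT] linear_0[OF linear_DT])

lemma sum_coord_frame:
  "c \<in> \<A> \<Longrightarrow> p \<in> fst c \<Longrightarrow> (\<Sum>i\<in>UNIV. (y $ i) *\<^sub>R coord_frame \<A> c p i) = vec_of_coords \<A> c p y"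
proof -
  assume cp: "c \<in> \<A>" "p \<in> fst c"
  have "vec_of_coords \<A> c p (\<Sum>i\<in>I. (y $ i) *\<^sub>R axis i 1) = (\<Sum>i\<in>I. (y $ i) *\<^sub>R coord_frame \<A> c p i)" for I
    by (induction I rule: infinite_finite_induct) (simp_all add: linear_vec_of_coords[OF cp] coord_frame_def)
  moreover have "(\<Sum>i\<in>UNIV. (y $ i) *\<^sub>R axis i 1) = y"
    using basis_expansion[of y] by (simp add: scalar_mult_eq_scaleR)
  ultimately show ?thesis by metis
qed

lemma assumes p: "p \<in> topspace M" and u: "u \<in> tangent_space \<A> p"
  shows tangent_add: "v \<in> tangent_space \<A> p \<Longrightarrow> u + v \<in> tangent_space \<A> p"
    and tangent_diff: "v \<in> tangent_space \<A> p \<Longrightarrow> u - v \<in> tangent_space \<A> p"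
    and tangent_scale: "r *\<^sub>R u \<in> tangent_space \<A> p"
proof -
  let ?c = "chart_at \<A> p"
  note c = chart_at[OF p]
  have eq: "vec_of_coords \<A> ?c p (v ?c) = v" if "v \<in> tangent_space \<A> p" for v by (rule vec_of_coords_coords[OF c that])
  show "u + v \<in> tangent_space \<A> p" if "v \<in> tangent_space \<A> p"
    using vec_of_coords_mem[OF c, of "u ?c + v ?c"] unfolding linear_vec_of_coords[OF c] eq[OF u] eq[OF that] .
  show "u - v \<in> tangent_space \<A> p" if "v \<in> tangent_space \<A> p"
    using vec_of_coords_mem[OF c, of "u ?c - v ?c"] unfolding linear_vec_of_coords[OF c] eq[OF u] eq[OF that] .
  show "r *\<^sub>R u \<in> tangent_space \<A> p"
    using vec_of_coords_mem[OF c, of "r *\<^sub>R u ?c"] unfolding linear_vec_of_coords[OF c] eq[OF u] .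
qed

lemma tangent_eq_0: "c \<in> \<A> \<Longrightarrow> p \<in> fst c \<Longrightarrow> v \<in> tangent_space \<A> p \<Longrightarrow> v c = 0 \<longleftrightarrow> v = 0"
  using vec_of_coords_coords[of c p v] linear_vec_of_coords(4)[of c p] by auto

text \<open>\<open>differential\<close> is defined in the chosen chart \<open>chart_at\<close>; the
  compatibility built into \<open>tangent_space\<close> makes any other chart around
  \<open>p\<close> give the same value.\<close>

lemma differential_eq:
  assumes c: "c \<in> \<A>" "p \<in> fst c" and f: "(f \<circ> chart_inv c) differentiable (at (snd c p))" and v: "v \<in> tangent_space \<A> p"
  shows "differential \<A> f p v = frechet_derivative (f \<circ> chart_inv c) (at (snd c p)) (v c)"
proof -
  have pM: "p \<in> topspace M" using openin_subset[OF chart(1)[OF c(1)]] c(2) by blast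
  let ?d = "chart_at \<A> p"
  note d = chart_at[OF pM]
  have "((f \<circ> chart_inv ?d) has_derivative (\<lambda>y. frechet_derivative (f \<circ> chart_inv c) (at (snd c p)) (DT ?d c p y))) (at (snd ?d p))"
    by (rule has_derivative_change_chart[OF d(1) c(1) d(2) c(2)]) (rule iffD1[OF frechet_derivative_works f])
  from frechet_derivative_apply[OF this, of "v ?d"]
  have "differential \<A> f p v = frechet_derivative (f \<circ> chart_inv c) (at (snd c p)) (DT ?d c p (v ?d))"
    by (simp add: differential_def Let_def)
  also have "v c = DT ?d c p (v ?d)" using v d c unfolding tangent_space_def by blast
  then have "DT ?d c p (v ?d) = v c" by (rule sym)
  finally show ?thesis .
qed

lemma regular_at_iff:
  assumes c: "c \<in> \<A>" "p \<in> fst c" and f: "(f \<circ> chart_inv c) differentiable (at (snd c p))"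
  shows "regular_at \<A> f p \<longleftrightarrow> (\<exists>y. frechet_derivative (f \<circ> chart_inv c) (at (snd c p)) y \<noteq> 0)"
proof
  assume "regular_at \<A> f p"
  then show "\<exists>y. frechet_derivative (f \<circ> chart_inv c) (at (snd c p)) y \<noteq> 0"
    unfolding regular_at_def using differential_eq[OF c f] by auto
next
  assume "\<exists>y. frechet_derivative (f \<circ> chart_inv c) (at (snd c p)) y \<noteq> 0"
  then obtain y where "frechet_derivative (f \<circ> chart_inv c) (at (snd c p)) y \<noteq> 0" by blast
  then have "differential \<A> f p (vec_of_coords \<A> c p y) \<noteq> 0"
    using differential_eq[OF c f vec_of_coords_mem[OF c]] by (simp add: vec_of_coords_apply[OF c])
  then show "regular_at \<A> f p" unfolding regular_at_def using vec_of_coords_mem[OF c] by blast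
qed

lemma smooth_funD:
  assumes "c \<in> \<A>" "smooth_fun \<A> U f" shows "smooth_on (snd c ` (U \<inter> fst c)) (f \<circ> chart_inv c)"
  using assms by (auto simp: smooth_fun_def)

text \<open>Carries the local solutions found in one chart back to the manifold. In another chart a
  field acquires the derivative of the transition map, applied to a vector that moves with the
  point.\<close>

lemma smooth_transport:
  assumes c: "c \<in> \<A>" and S: "open S" "S \<subseteq> snd c ` fst c"
  shows "smooth_on S g \<Longrightarrow> smooth_fun \<A> (chart_inv c ` S) (\<lambda>q. g (snd c q))"
    and "smooth_on S Y \<Longrightarrow> smooth_vector_field \<A> (chart_inv c ` S) (\<lambda>q. vec_of_coords \<A> c q (Y (snd c q)))"
proof -
  let ?U = "chart_inv c ` S"
  have U: "q \<in> fst c" "snd c q \<in> S" if q: "q \<in> ?U" for q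
  proof -
    obtain x where x: "x \<in> S" "q = chart_inv c x" using q by blast
    then have xi: "x \<in> snd c ` fst c" using S(2) by blast
    show "q \<in> fst c" "snd c q \<in> S" using x chart_inv_mem[OF xi] chart_chart_inv[OF xi] by simp_all
  qed
  have op: "open (snd d ` (?U \<inter> fst d))" if "d \<in> \<A>" for d by (rule open_image[OF that open_preimage[OF c S]])
  have tr: "smooth_on (snd d ` (?U \<inter> fst d)) (snd c \<circ> chart_inv d)" if "d \<in> \<A>" for d
    by (rule smooth_on_subset[OF smooth_transition[OF that c]]) (use U(1) in blast)
  have mem: "(snd c \<circ> chart_inv d) x \<in> S" "chart_inv d x \<in> fst c" "chart_inv d x \<in> fst d"
     "chart_inv c ((snd c \<circ> chart_inv d) x) = chart_inv d x"
    if d: "d \<in> \<A>" and x: "x \<in> snd d ` (?U \<inter> fst d)" for d x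
  proof -
    obtain q where q: "q \<in> ?U" "q \<in> fst d" "x = snd d q" using x by blast
    then have "chart_inv d x = q" using d by simp
    then show "(snd c \<circ> chart_inv d) x \<in> S" "chart_inv d x \<in> fst c" "chart_inv d x \<in> fst d"
      "chart_inv c ((snd c \<circ> chart_inv d) x) = chart_inv d x" using U[OF q(1)] q c by simp_all
  qed
  show "smooth_fun \<A> ?U (\<lambda>q. g (snd c q))" if g: "smooth_on S g"
    unfolding smooth_fun_def
  proof
    fix d assume d: "d \<in> \<A>"
    have "smooth_on (snd d ` (?U \<inter> fst d)) (\<lambda>x. g ((snd c \<circ> chart_inv d) x))"
      by (rule smooth_on_compose[OF op[OF d] S(1) tr[OF d] g mem(1)[OF d]])
    then show "smooth_on (snd d ` (?U \<inter> fst d)) ((\<lambda>q. g (snd c q)) \<circ> chart_inv d)" by (simp add: o_def)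
  qed
  show "smooth_vector_field \<A> ?U (\<lambda>q. vec_of_coords \<A> c q (Y (snd c q)))" if Y: "smooth_on S Y"
    unfolding smooth_vector_field_def
  proof (intro conjI ballI)
    fix d assume d: "d \<in> \<A>"
    have Y': "smooth_on (snd d ` (?U \<inter> fst d)) (\<lambda>x. Y ((snd c \<circ> chart_inv d) x))"
      by (rule smooth_on_compose[OF op[OF d] S(1) tr[OF d] Y mem(1)[OF d]])
    have A: "smooth_on (snd d ` (?U \<inter> fst d))
      (\<lambda>x. frechet_derivative (snd d \<circ> chart_inv c) (at ((snd c \<circ> chart_inv d) x)) (Y ((snd c \<circ> chart_inv d) x)))"
      by (rule smooth_on_derivative_comp[OF op[OF d] open_overlap[OF c d] smooth_transition[OF c d] tr[OF d] Y'])
         (use mem[OF d] in \<open>metis IntI comp_apply image_eqI\<close>)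
    have B: "frechet_derivative (snd d \<circ> chart_inv c) (at ((snd c \<circ> chart_inv d) x)) (Y ((snd c \<circ> chart_inv d) x)) =
        vec_of_coords \<A> c (chart_inv d x) (Y (snd c (chart_inv d x))) d" if "x \<in> snd d ` (?U \<inter> fst d)" for x
      using mem[OF d that] d by (simp add: vec_of_coords_def)
    show "smooth_on (snd d ` (?U \<inter> fst d)) (\<lambda>x. vec_of_coords \<A> c (chart_inv d x) (Y (snd c (chart_inv d x))) d)"
      by (rule iffD1[OF smooth_on_cong[OF op[OF d] B] A])
  next
    fix q assume "q \<in> ?U"
    then show "vec_of_coords \<A> c q (Y (snd c q)) \<in> tangent_space \<A> q" using vec_of_coords_mem[OF c U(1)] by blast
  qed
qed

text \<open>\<open>hypersurface_tangent\<close> quantifies over all local equations. A second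
  equation vanishes on the level set of the first, so its differential vanishes on the kernel of the
  first differential, and testing one equation is enough.\<close>

lemma local_equation_tangent:
  assumes f: "local_equation M \<A> L U f" and q: "q \<in> L \<inter> U" and c: "c \<in> \<A>" "q \<in> fst c"
    and v: "v \<in> tangent_space \<A> q" "frechet_derivative (f \<circ> chart_inv c) (at (snd c q)) (v c) = 0"
  shows "v \<in> hypersurface_tangent M \<A> L q"
  unfolding hypersurface_tangent_def
proof (intro CollectI conjI allI impI v(1))
  fix U' h assume "q \<in> U' \<and> local_equation M \<A> L U' h"
  then have h: "q \<in> U'" "local_equation M \<A> L U' h" by auto
  have U: "openin M U" "openin M U'" using f h by (auto simp: local_equation_def)
  have sf: "smooth_on (snd c ` (U \<inter> fst c)) (f \<circ> chart_inv c)" and sh: "smooth_on (snd c ` (U' \<inter> fst c)) (h \<circ> chart_inv c)"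
    using f h by (auto simp: local_equation_def smooth_fun_def c)
  let ?N = "snd c ` (U \<inter> fst c) \<inter> snd c ` (U' \<inter> fst c)"
  have qN: "snd c q \<in> ?N" using q h c by auto
  have dh: "(h \<circ> chart_inv c) differentiable (at (snd c q))" and df: "(f \<circ> chart_inv c) differentiable (at (snd c q))"
    using smooth_on_differentiable[OF sf] smooth_on_differentiable[OF sh] qN by auto
  have "regular_at \<A> f q" using f q by (auto simp: local_equation_def)
  then obtain e where e: "frechet_derivative (f \<circ> chart_inv c) (at (snd c q)) e \<noteq> 0"
    using regular_at_iff[OF c df] by blast
  have N: "chart_inv c x \<in> U" "chart_inv c x \<in> U'" if x: "x \<in> ?N" for x
  proof -
    obtain q1 where q1: "q1 \<in> U" "q1 \<in> fst c" "x = snd c q1" using x by blast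
    obtain q2 where q2: "q2 \<in> U'" "q2 \<in> fst c" "x = snd c q2" using x by blast
    show "chart_inv c x \<in> U" "chart_inv c x \<in> U'"
      using q1(1) q2(1) chart_inv[OF c(1) q1(2)] chart_inv[OF c(1) q2(2)] by (simp_all only: q1(3)[symmetric] q2(3)[symmetric])
  qed
  have "frechet_derivative (h \<circ> chart_inv c) (at (snd c q)) (v c) = 0"
  proof (rule eventually_on_level_set_derivative_zero[OF _ qN smooth_on_subset[OF sf] _ e _ _ v(2)])
    show "open ?N" by (intro open_Int open_image c U)
    show "(f \<circ> chart_inv c) (snd c q) = 0" using f q c by (auto simp: local_equation_def)
    show "(h \<circ> chart_inv c has_derivative frechet_derivative (h \<circ> chart_inv c) (at (snd c q))) (at (snd c q))"
      using dh by (simp add: frechet_derivative_works)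
    show "(h \<circ> chart_inv c) x = 0" if "x \<in> ?N" "(f \<circ> chart_inv c) x = 0" for x
      using N[OF that(1)] that(2) f h by (auto simp: local_equation_def)
  qed auto
  then show "differential \<A> h q v = 0" using differential_eq[OF c dh v(1)] by simp
qed

end

section \<open>Traces as derivatives of determinants\<close>

lemma det_has_derivative:
  fixes A H :: "real^'n^'n"
  shows "((\<lambda>t. det (A + t *\<^sub>R H)) has_real_derivative (\<Sum>i\<in>UNIV. det (\<chi> k. if k = i then H $ k else A $ k))) (at 0)"
proof -
  have 1: "((\<lambda>t. \<Prod>i\<in>UNIV. (A + t *\<^sub>R H) $ i $ p i) has_derivative
      (\<lambda>h. \<Sum>i\<in>UNIV. h * H $ i $ p i * (\<Prod>j\<in>UNIV - {i}. (A + 0 *\<^sub>R H) $ j $ p j))) (at 0)" for p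
    by (rule has_derivative_prod) (auto intro!: derivative_eq_intros)
  have "((\<lambda>t. det (A + t *\<^sub>R H)) has_derivative
      (\<lambda>h. \<Sum>p\<in>{p. p permutes UNIV}. of_int (sign p) * (\<Sum>i\<in>UNIV. h * H $ i $ p i * (\<Prod>j\<in>UNIV - {i}. (A + 0 *\<^sub>R H) $ j $ p j)))) (at 0)"
    unfolding det_def by (intro has_derivative_sum has_derivative_mult_right 1)
  moreover have "(\<Sum>p\<in>{p. p permutes UNIV}. of_int (sign p) * (\<Sum>i\<in>UNIV. h * H $ i $ p i * (\<Prod>j\<in>UNIV - {i}. (A + 0 *\<^sub>R H) $ j $ p j)))
      = (\<Sum>i\<in>UNIV. det (\<chi> k. if k = i then H $ k else A $ k)) * h" for h
  proof -
    have p: "(\<Prod>k\<in>UNIV. (\<chi> k. if k = i then H $ k else A $ k) $ k $ p k) = H $ i $ p i * (\<Prod>j\<in>UNIV - {i}. A $ j $ p j)" for i and p :: "'n \<Rightarrow> 'n"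
      by (subst prod.remove[of UNIV i]) (auto intro!: prod.cong)
    show ?thesis
      unfolding det_def p by (subst sum.swap) (simp add: sum_distrib_left sum_distrib_right ac_simps)
  qed
  ultimately show ?thesis by (simp add: has_field_derivative_def)
qed

text \<open>Both sides are the derivative at \<open>0\<close> of
  \<open>det (R ** (mat 1 + t *\<^sub>R T))\<close>, where the rows of \<open>R\<close> are the
  vectors \<open>v k\<close> and \<open>T\<close> is the transposed matrix of \<open>A\<close>: once
  differentiated row by row, once after splitting off \<open>det R\<close>. It produces the trace in
  the divergence.\<close>

lemma sum_det_replace_column:
  fixes v :: "'n \<Rightarrow> real^'n" and A :: "real^'n \<Rightarrow> real^'n"
  assumes "linear A"
  shows "(\<Sum>j\<in>UNIV. det (\<chi> i k. (if k = j then A (v j) else v k) $ i)) = (\<Sum>b\<in>Basis. A b \<bullet> b) * det (\<chi> i k. v k $ i)"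
proof -
  define R :: "real^'n^'n" where "R = (\<chi> k. v k)"
  define T where "T = transpose (matrix A)"
  have RT: "(R ** T) $ k = A (v k)" for k
    by (subst matrix_works[OF iffD2[OF linear_matrix_vector_mul_eq assms], symmetric])
       (simp add: R_def T_def vec_eq_iff matrix_matrix_mult_def matrix_vector_mult_def transpose_def mult.commute)
  have cols: "det (\<chi> i k. (if k = j then A (v j) else v k) $ i) = det (\<chi> k. if k = j then (R ** T) $ k else R $ k)" for j
    by (subst det_transpose[symmetric], rule arg_cong[where f=det])
       (auto simp: transpose_def vec_eq_iff RT, simp add: R_def)
  have "((\<lambda>t. det (R ** (mat 1 + t *\<^sub>R T))) has_real_derivative (\<Sum>j\<in>UNIV. det (\<chi> i k. (if k = j then A (v j) else v k) $ i))) (at 0)"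
  proof -
    have "R ** (t *\<^sub>R T) = t *\<^sub>R (R ** T)" for t
      by (simp add: vec_eq_iff matrix_matrix_mult_def sum_distrib_left mult.left_commute)
    then have "R ** (mat 1 + t *\<^sub>R T) = R + t *\<^sub>R (R ** T)" for t
      by (simp add: matrix_add_ldistrib)
    then show ?thesis using det_has_derivative[of R "R ** T"] by (simp add: cols)
  qed
  moreover have "((\<lambda>t. det (R ** (mat 1 + t *\<^sub>R T))) has_real_derivative det R * (\<Sum>i\<in>UNIV. T $ i $ i)) (at 0)"
  proof -
    have "det (\<chi> k. if k = i then T $ k else mat 1 $ k) = T $ i $ i" for i
    proof -
      have "det (\<chi> k. if k = i then T $ k else mat 1 $ k) = det (\<chi> k j. if j = i then ((mat 1 :: real^'n^'n) *v (T $ i)) $ k else mat 1 $ k $ j)"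
        unfolding matrix_vector_mul_lid
        by (subst det_transpose[symmetric], rule arg_cong[where f=det]) (auto simp: transpose_def vec_eq_iff mat_def)
      also have "\<dots> = T $ i $ i" by (subst cramer_lemma) simp
      finally show ?thesis .
    qed
    then show ?thesis
      using DERIV_cmult[OF det_has_derivative[of "mat 1" T], of "det R"] by (simp add: det_mul)
  qed
  ultimately have "(\<Sum>j\<in>UNIV. det (\<chi> i k. (if k = j then A (v j) else v k) $ i)) = det R * (\<Sum>i\<in>UNIV. T $ i $ i)"
    by (rule DERIV_unique)
  also have "det R = det (\<chi> i k. v k $ i)"
    by (subst det_transpose[symmetric]) (simp add: R_def transpose_def)
  also have "(\<Sum>i\<in>UNIV. T $ i $ i) = (\<Sum>b\<in>Basis. A b \<bullet> b)"
  proof -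
    have b1: "Basis = range (\<lambda>i. axis i (1::real) :: real^'n)" by (auto simp: Basis_vec_def)
    have b2: "inj (\<lambda>i. axis i (1::real) :: real^'n)" by (auto intro!: injI simp: axis_eq_axis)
    show ?thesis
      unfolding b1 sum.reindex[OF b2] by (simp add: T_def transpose_def matrix_def inner_axis)
  qed
  finally show ?thesis by (simp add: mult.commute)
qed

section \<open>Zermelo metrics and mean curvature\<close>

locale zermelo_data = atlas M \<A> for M :: "'a topology" and \<A> :: "('a, 'n::finite) chart set" +
  fixes F :: "'a \<times> ('a, 'n) tvec \<Rightarrow> real" and W :: "'a \<Rightarrow> ('a, 'n) tvec"
  assumes F: "finsler M \<A> F" and W: "smooth_vector_field \<A> (topspace M) W"
begin

definition Fc :: "('a, 'n) chart \<Rightarrow> (real^'n) \<times> (real^'n) \<Rightarrow> real" where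
  "Fc c = F \<circ> bundle_point \<A> c"

lemma mem_topspace: "c \<in> \<A> \<Longrightarrow> p \<in> fst c \<Longrightarrow> p \<in> topspace M"
  using openin_subset[OF chart(1)] by blast

lemma mem_tangent_bundle: "c \<in> \<A> \<Longrightarrow> p \<in> fst c \<Longrightarrow> (p, vec_of_coords \<A> c p y) \<in> tangent_bundle M \<A>"
  by (simp add: tangent_bundle_def mem_topspace vec_of_coords_mem)

lemma Fc_apply: "c \<in> \<A> \<Longrightarrow> p \<in> fst c \<Longrightarrow> Fc c (snd c p, y) = F (p, vec_of_coords \<A> c p y)"
  by (simp add: Fc_def bundle_point_def)

lemma Fc_coords: "c \<in> \<A> \<Longrightarrow> p \<in> fst c \<Longrightarrow> v \<in> tangent_space \<A> p \<Longrightarrow> Fc c (snd c p, v c) = F (p, v)"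
  by (simp add: Fc_apply vec_of_coords_coords)

lemma bundle_image_tangent_bundle:
  assumes c: "c \<in> \<A>"
  shows "bundle_image \<A> c (tangent_bundle M \<A>) = (snd c ` fst c) \<times> UNIV"
    "bundle_image \<A> c {(p, v) \<in> tangent_bundle M \<A>. v \<noteq> 0} = (snd c ` fst c) \<times> (- {0})"
proof -
  have tm: "bundle_point \<A> c (snd c p, y) \<in> tangent_bundle M \<A>" if "p \<in> fst c" for p y
    using mem_tangent_bundle[OF c that] c that by (simp add: bundle_point_def)
  have nz: "snd (bundle_point \<A> c (snd c p, y)) = 0 \<longleftrightarrow> y = 0" if "p \<in> fst c" for p y
    using tangent_eq_0[OF c that vec_of_coords_mem[OF c that], of y] vec_of_coords_apply[OF c that, of y] c that
    by (simp add: bundle_point_def)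
  have "z \<in> bundle_image \<A> c (tangent_bundle M \<A>)" if z: "z \<in> (snd c ` fst c) \<times> UNIV" for z
  proof -
    obtain p y where "p \<in> fst c" "z = (snd c p, y)" using z by blast
    then show ?thesis unfolding bundle_image_def using tm z by blast
  qed
  then show 1: "bundle_image \<A> c (tangent_bundle M \<A>) = (snd c ` fst c) \<times> UNIV"
    unfolding bundle_image_def by blast
  have "z \<in> bundle_image \<A> c {(p, v) \<in> tangent_bundle M \<A>. v \<noteq> 0} \<longleftrightarrow> z \<in> (snd c ` fst c) \<times> (- {0})"
    if z: "z \<in> (snd c ` fst c) \<times> UNIV" for z
  proof -
    obtain p y where p: "p \<in> fst c" "z = (snd c p, y)" using z by blast
    show ?thesis unfolding bundle_image_def using tm[OF p(1), of y] nz[OF p(1), of y] z by (simp add: p(2) case_prod_beta)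
  qed
  moreover have "bundle_image \<A> c {(p, v) \<in> tangent_bundle M \<A>. v \<noteq> 0} \<subseteq> (snd c ` fst c) \<times> UNIV"
    unfolding bundle_image_def by (rule Collect_restrict)
  moreover have "(snd c ` fst c) \<times> (- {0}) \<subseteq> (snd c ` fst c) \<times> (UNIV :: (real^'n) set)"
    by (rule Sigma_mono) simp_all
  ultimately show "bundle_image \<A> c {(p, v) \<in> tangent_bundle M \<A>. v \<noteq> 0} = (snd c ` fst c) \<times> (- {0})"
    by (meson subset_antisym subset_iff)
qed

lemma tensor_coords:
  assumes c: "c \<in> \<A>" "q \<in> fst c" and T: "v \<in> tangent_space \<A> q" "u1 \<in> tangent_space \<A> q" "u2 \<in> tangent_space \<A> q"
  shows "fundamental_tensor G q v u1 u2 =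
    1/2 * deriv (\<lambda>t2. deriv (\<lambda>t1. (G (q, vec_of_coords \<A> c q (v c + t1 *\<^sub>R u1 c + t2 *\<^sub>R u2 c)))\<^sup>2) 0) 0"
  unfolding fundamental_tensor_def linear_vec_of_coords[OF c] vec_of_coords_coords[OF c T(1)]
    vec_of_coords_coords[OF c T(2)] vec_of_coords_coords[OF c T(3)] ..

text \<open>The bridge from the metric on the manifold to the Euclidean theory: afterwards the
  fibrewise results, the volume and the existence of distance functions are available in every
  chart.\<close>

lemma finsler_domain_chart:
  assumes c: "c \<in> \<A>" shows "finsler_domain (snd c ` fst c) (Fc c)"
proof -
  have cf: "conic_finsler M \<A> (tangent_bundle M \<A>) F" using F by (simp add: finsler_def)
  have hom: "\<And>p v r. (p, v) \<in> tangent_bundle M \<A> \<and> r > 0 \<Longrightarrow> F (p, r *\<^sub>R v) = r * F (p, v)"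
    and nn: "\<And>z. z \<in> tangent_bundle M \<A> \<Longrightarrow> F z \<ge> 0"
    and ct: "continuous_on (bundle_image \<A> c (tangent_bundle M \<A>)) (F \<circ> bundle_point \<A> c)"
    and sm: "smooth_on (bundle_image \<A> c {(p, v) \<in> tangent_bundle M \<A>. v \<noteq> 0}) (F \<circ> bundle_point \<A> c)"
    and pd: "\<And>p v u. (p, v) \<in> tangent_bundle M \<A> \<and> v \<noteq> 0 \<and> u \<in> tangent_space \<A> p \<and> u \<noteq> 0 \<Longrightarrow> fundamental_tensor F p v u u > 0"
  proof -
    note c6 = cf[unfolded conic_finsler_def, THEN conjunct2, THEN conjunct2, THEN conjunct2, THEN conjunct2, THEN conjunct2]
    note c8 = c6[THEN conjunct2, THEN conjunct2]
    show "F (p, r *\<^sub>R v) = r * F (p, v)" if "(p, v) \<in> tangent_bundle M \<A> \<and> r > 0" for p v r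
      using c8[THEN conjunct2, THEN conjunct1] that by blast
    show "F z \<ge> 0" if "z \<in> tangent_bundle M \<A>" for z using c6[THEN conjunct1] that by blast
    show "continuous_on (bundle_image \<A> c (tangent_bundle M \<A>)) (F \<circ> bundle_point \<A> c)"
      by (rule bspec[OF c6[THEN conjunct2, THEN conjunct1] c])
    show "smooth_on (bundle_image \<A> c {(p, v) \<in> tangent_bundle M \<A>. v \<noteq> 0}) (F \<circ> bundle_point \<A> c)"
      by (rule bspec[OF c8[THEN conjunct1] c])
    show "fundamental_tensor F p v u u > 0" if "(p, v) \<in> tangent_bundle M \<A> \<and> v \<noteq> 0 \<and> u \<in> tangent_space \<A> p \<and> u \<noteq> 0" for p v u
      using c8[THEN conjunct2, THEN conjunct2] that by blast
  qed
  have sm': "smooth_on ((snd c ` fst c) \<times> (- {0})) (Fc c)" using sm unfolding bundle_image_tangent_bundle[OF c] Fc_def .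
  show ?thesis
  proof (rule finsler_domain.intro)
    show "open (snd c ` fst c)" by (rule chart(2)[OF c])
    show "continuous_on ((snd c ` fst c) \<times> UNIV) (Fc c)" using ct unfolding bundle_image_tangent_bundle[OF c] Fc_def .
    show "smooth_on ((snd c ` fst c) \<times> (- {0})) (Fc c)" by (rule sm')
    fix x assume "x \<in> snd c ` fst c"
    then obtain p where p: "p \<in> fst c" "x = snd c p" by blast
    note cp = c p(1)
    have ne: "vec_of_coords \<A> c p y \<noteq> 0" if "y \<noteq> 0" for y
      using tangent_eq_0[OF cp vec_of_coords_mem[OF cp], of y] vec_of_coords_apply[OF cp, of y] that by simp
    show "minkowski_norm (\<lambda>y. Fc c (x, y))"
    proof
      show "smooth_on (- {0}) (\<lambda>y. Fc c (x, y))"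
      proof -
        have o: "open (- {0 :: real^'n})" by (rule open_Compl[OF closed_singleton])
        have 1: "smooth_on (- {0}) (\<lambda>y :: real^'n. (x, y))" by (intro smooth_on_Pair smooth_on_const smooth_on_ident o)
        show ?thesis
          by (rule smooth_on_compose[OF o open_Times[OF chart(2)[OF c] o] 1 sm']) (use p in blast)
      qed
      show "Fc c (x, r *\<^sub>R v) = r * Fc c (x, v)" if "0 < r" for r v
        using hom[OF conjI[OF mem_tangent_bundle[OF cp] that]] by (simp add: p(2) Fc_apply[OF cp] linear_vec_of_coords[OF cp])
      show "0 \<le> Fc c (x, v)" for v using nn[OF mem_tangent_bundle[OF cp]] by (simp add: p(2) Fc_apply[OF cp])
      show "0 < deriv (\<lambda>t2. deriv (\<lambda>t1. (Fc c (x, v + t1 *\<^sub>R u + t2 *\<^sub>R u))\<^sup>2) 0) 0" if "v \<noteq> 0" "u \<noteq> 0" for v u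
      proof -
        have "0 < fundamental_tensor F p (vec_of_coords \<A> c p v) (vec_of_coords \<A> c p u) (vec_of_coords \<A> c p u)"
          by (rule pd) (simp add: mem_tangent_bundle[OF cp] vec_of_coords_mem[OF cp] ne that)
        then show ?thesis
          by (simp add: tensor_coords[OF cp vec_of_coords_mem[OF cp] vec_of_coords_mem[OF cp] vec_of_coords_mem[OF cp]]
              vec_of_coords_apply[OF cp] p(2) Fc_apply[OF cp])
      qed
    qed
  qed
qed

lemma minkowski_chart: "c \<in> \<A> \<Longrightarrow> q \<in> fst c \<Longrightarrow> minkowski_norm (\<lambda>y. Fc c (snd c q, y))"
  using finsler_domain.minkowski[OF finsler_domain_chart] by blast

abbreviation dFc :: "('a, 'n) chart \<Rightarrow> real^'n \<Rightarrow> real^'n \<Rightarrow> real^'n \<Rightarrow> real" where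
  "dFc c \<equiv> finsler_domain.dF (Fc c)"

lemma dFc_def: "c \<in> \<A> \<Longrightarrow> dFc c x y = frechet_derivative (\<lambda>y. Fc c (x, y)) (at y)"
  by (rule finsler_domain.dF_def[OF finsler_domain_chart])

lemma tensor_F:
  assumes c: "c \<in> \<A>" "q \<in> fst c" and v: "v \<in> tangent_space \<A> q" "v \<noteq> 0" and u: "u \<in> tangent_space \<A> q"
  shows "fundamental_tensor F q v v u = F (q, v) * dFc c (snd c q) (v c) (u c)"
proof -
  have "v c \<noteq> 0" using tangent_eq_0[OF c v(1)] v(2) by simp
  from minkowski_norm.tensor_radial[OF minkowski_chart[OF c] this, of "u c"]
  show ?thesis
    unfolding tensor_coords[OF c v(1) v(1) u] Fc_apply[OF c, symmetric] dFc_def[OF c(1)] Fc_coords[OF c v(1), symmetric] by simp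
qed

lemma W_tangent: "q \<in> topspace M \<Longrightarrow> W q \<in> tangent_space \<A> q"
  using W by (simp add: smooth_vector_field_def)

lemma F_unit_nonzero: "c \<in> \<A> \<Longrightarrow> q \<in> fst c \<Longrightarrow> F (q, u) = 1 \<Longrightarrow> u \<noteq> 0"
  using minkowski_norm.zero[OF minkowski_chart, of c q] Fc_apply[of c q 0] linear_vec_of_coords(4)[of c q] by force

lemma indicatrix_iff:
  assumes c: "c \<in> \<A>" "q \<in> fst c" and v: "v \<in> tangent_space \<A> q"
  shows "(q, v) \<in> zermelo_indicatrix M \<A> F W \<longleftrightarrow>
    F (q, v - W q) = 1 \<and> 0 < 1 + dFc c (snd c q) ((v - W q) c) (W q c)"
proof -
  have qM: "q \<in> topspace M" by (rule mem_topspace[OF c])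
  have u: "v - W q \<in> tangent_space \<A> q" by (rule tangent_diff[OF qM v W_tangent[OF qM]])
  have mW: "- W q \<in> tangent_space \<A> q" using tangent_scale[OF qM W_tangent[OF qM], of "- 1"] by simp
  have "(q, v) \<in> zermelo_indicatrix M \<A> F W \<longleftrightarrow> F (q, v - W q) = 1 \<and> fundamental_tensor F q (v - W q) (v - W q) (- W q) < 1"
  proof
    assume "(q, v) \<in> zermelo_indicatrix M \<A> F W"
    then obtain u where "v = u + W q" "F (q, u) = 1" "fundamental_tensor F q u u (- W q) < 1"
      unfolding zermelo_indicatrix_def by blast
    then show "F (q, v - W q) = 1 \<and> fundamental_tensor F q (v - W q) (v - W q) (- W q) < 1" by simp
  next
    assume "F (q, v - W q) = 1 \<and> fundamental_tensor F q (v - W q) (v - W q) (- W q) < 1"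
    moreover have "(q, v - W q) \<in> tangent_bundle M \<A>" using u qM by (simp add: tangent_bundle_def)
    moreover have "(q, v) = (q, (v - W q) + W q)" by simp
    ultimately show "(q, v) \<in> zermelo_indicatrix M \<A> F W" unfolding zermelo_indicatrix_def by blast
  qed
  moreover have "fundamental_tensor F q (v - W q) (v - W q) (- W q) = - dFc c (snd c q) ((v - W q) c) (W q c)" if "F (q, v - W q) = 1"
  proof -
    have ne: "v - W q \<noteq> 0" by (rule F_unit_nonzero[OF c that])
    have "(v - W q) c \<noteq> 0" using tangent_eq_0[OF c u] ne by simp
    then have "linear (dFc c (snd c q) ((v - W q) c))"
      unfolding dFc_def[OF c(1)] by (rule minkowski_norm.linear_df[OF minkowski_chart[OF c]])
    from linear_neg[OF this, of "W q c"] show ?thesis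
      unfolding tensor_F[OF c u ne mW] that by simp
  qed
  ultimately show ?thesis by auto
qed

lemma indicatrix_tangent: "(q, v) \<in> zermelo_indicatrix M \<A> F W \<Longrightarrow> q \<in> topspace M \<and> v \<in> tangent_space \<A> q"
  unfolding zermelo_indicatrix_def tangent_bundle_def using tangent_add W_tangent by blast

lemma indicatrix_wind_sphere:
  assumes c: "c \<in> \<A>" "q \<in> fst c" and v: "v \<in> tangent_space \<A> q"
  shows "(q, v) \<in> zermelo_indicatrix M \<A> F W \<longleftrightarrow> v c \<in> minkowski_norm.wind_sphere (\<lambda>y. Fc c (snd c q, y)) (W q c)"
proof -
  have qM: "q \<in> topspace M" by (rule mem_topspace[OF c])
  have u: "v - W q \<in> tangent_space \<A> q" by (rule tangent_diff[OF qM v W_tangent[OF qM]])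
  have "v c = u + W q c \<longleftrightarrow> u = (v - W q) c" for u by auto
  then show ?thesis
    unfolding indicatrix_iff[OF c v] minkowski_norm.wind_sphere_def[OF minkowski_chart[OF c]] dFc_def[OF c(1)] Fc_coords[OF c u, symmetric]
    by auto
qed

lemma zermelo_metric_coords:
  assumes c: "c \<in> \<A>" "q \<in> fst c" and v: "v \<in> tangent_space \<A> q"
  shows "zermelo_metric M \<A> F W (q, v) = minkowski_norm.zermelo (\<lambda>y. Fc c (snd c q, y)) (W q c) (v c)"
proof -
  have qM: "q \<in> topspace M" by (rule mem_topspace[OF c])
  have "(q, inverse r *\<^sub>R v) \<in> zermelo_indicatrix M \<A> F W \<longleftrightarrow>
      inverse r *\<^sub>R v c \<in> minkowski_norm.wind_sphere (\<lambda>y. Fc c (snd c q, y)) (W q c)" for r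
    using indicatrix_wind_sphere[OF c tangent_scale[OF qM v]] by (simp add: scaleR_fun_def)
  then show ?thesis
    unfolding zermelo_metric_def minkowski_norm.zermelo_def[OF minkowski_chart[OF c]] tangent_eq_0[OF c v] by simp
qed

lemma zermelo_unitD:
  assumes c: "c \<in> \<A>" "q \<in> fst c" and v: "(q, v) \<in> zermelo_domain M \<A> F W" "v \<noteq> 0" "zermelo_metric M \<A> F W (q, v) = 1"
  shows "v \<in> tangent_space \<A> q" "F (q, v - W q) = 1" "0 < 1 + dFc c (snd c q) ((v - W q) c) (W q c)"
proof -
  \<comment> \<open>The zero vectors of the domain are excluded by \<open>v \<noteq> 0\<close>, so
    \<open>v\<close> lies on the cone over the indicatrix, and its scale \<open>r\<close> equals the
    value of the metric, which is 1.\<close>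
  obtain r v' where r: "v = r *\<^sub>R v'" "(q, v') \<in> zermelo_indicatrix M \<A> F W" "r > 0"
    using v(1,2) unfolding zermelo_domain_def by blast
  have v': "v' \<in> tangent_space \<A> q" and qM: "q \<in> topspace M" using indicatrix_tangent[OF r(2)] by auto
  show vT: "v \<in> tangent_space \<A> q" unfolding r(1) by (rule tangent_scale[OF qM v'])
  have "inverse r *\<^sub>R v c = v' c" using r(1,3) by (simp add: scaleR_fun_def)
  then have "inverse r *\<^sub>R v c \<in> minkowski_norm.wind_sphere (\<lambda>y. Fc c (snd c q, y)) (W q c)"
    using indicatrix_wind_sphere[OF c v'] r(2) by simp
  from minkowski_norm.zermelo_eq[OF minkowski_chart[OF c] r(3) this] have "r = 1"
    using v(3) zermelo_metric_coords[OF c vT] by simp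
  then have "(q, v) \<in> zermelo_indicatrix M \<A> F W" using r by simp
  then show "F (q, v - W q) = 1" "0 < 1 + dFc c (snd c q) ((v - W q) c) (W q c)"
    using indicatrix_iff[OF c vT] by auto
qed

text \<open>The last formula carries the geometry: \<open>g^Z\<close> at \<open>u + W\<close> and
  \<open>g^F\<close> at \<open>u\<close> give proportional functionals with a positive factor. Hence
  orthogonality means the same for both metrics and gradients can be converted.\<close>

lemma zermelo_unitI:
  assumes c: "c \<in> \<A>" "q \<in> fst c" and u: "u \<in> tangent_space \<A> q" "F (q, u) = 1" "0 < 1 + dFc c (snd c q) (u c) (W q c)"
  shows "(q, u + W q) \<in> zermelo_domain M \<A> F W" "u + W q \<noteq> 0" "zermelo_metric M \<A> F W (q, u + W q) = 1"
    "t \<in> tangent_space \<A> q \<Longrightarrow> fundamental_tensor (zermelo_metric M \<A> F W) q (u + W q) (u + W q) t =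
      dFc c (snd c q) (u c) (t c) / (1 + dFc c (snd c q) (u c) (W q c))"
proof -
  interpret minkowski_norm "\<lambda>y. Fc c (snd c q, y)" by (rule minkowski_chart[OF c])
  have qM: "q \<in> topspace M" by (rule mem_topspace[OF c])
  have vT: "u + W q \<in> tangent_space \<A> q" by (rule tangent_add[OF qM u(1) W_tangent[OF qM]])
  have ind: "(q, u + W q) \<in> zermelo_indicatrix M \<A> F W" using indicatrix_iff[OF c vT] u by simp
  then have ws: "(u + W q) c \<in> wind_sphere (W q c)" using indicatrix_wind_sphere[OF c vT] by simp
  have "(q, 1 *\<^sub>R (u + W q)) \<in> zermelo_domain M \<A> F W" unfolding zermelo_domain_def using ind zero_less_one by blast
  then show "(q, u + W q) \<in> zermelo_domain M \<A> F W" by simp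
  show "u + W q \<noteq> 0"
  proof
    assume "u + W q = 0"
    then show False using wind_sphere_nonzero[OF ws] by (simp only: zero_fun_apply)
  qed
  show "zermelo_metric M \<A> F W (q, u + W q) = 1"
    unfolding zermelo_metric_coords[OF c vT] by (rule zermelo_eq) (use ws in simp_all)
  have fu: "Fc c (snd c q, u c) = 1" "0 < 1 + df (u c) (W q c)"
    using u(2,3) Fc_coords[OF c u(1)] dFc_def[OF c(1)] by simp_all
  show "fundamental_tensor (zermelo_metric M \<A> F W) q (u + W q) (u + W q) t =
      dFc c (snd c q) (u c) (t c) / (1 + dFc c (snd c q) (u c) (W q c))" if t: "t \<in> tangent_space \<A> q"
    using zermelo_tensor[OF fu, of "t c"]
    unfolding tensor_coords[OF c vT vT t] zermelo_metric_coords[OF c vec_of_coords_mem[OF c]] vec_of_coords_apply[OF c] dFc_def[OF c(1)]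
    by simp
qed

lemma smooth_vector_field_subset: "smooth_vector_field \<A> U X \<Longrightarrow> V \<subseteq> U \<Longrightarrow> smooth_vector_field \<A> V X"
proof -
  assume X: "smooth_vector_field \<A> U X" and VU: "V \<subseteq> U"
  have "smooth_on (snd c ` (V \<inter> fst c)) (\<lambda>x. X (chart_inv c x) c)" if "c \<in> \<A>" for c
  proof (rule smooth_on_subset)
    show "smooth_on (snd c ` (U \<inter> fst c)) (\<lambda>x. X (chart_inv c x) c)"
      using X that unfolding smooth_vector_field_def by blast
  qed (use VU in blast)
  moreover have "X p \<in> tangent_space \<A> p" if "p \<in> V" for p
    using X VU that unfolding smooth_vector_field_def by blast
  ultimately show ?thesis unfolding smooth_vector_field_def by blast
qed

text \<open>The second conclusion is recorded along with the first because a unit normal for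
  \<open>F\<close> alone does not determine it: it is the part of admissibility for \<open>Z\<close>
  that the existence of a distance function for \<open>Z\<close> requires.\<close>

lemma unit_normal_translate:
  assumes L: "hypersurface M \<A> L" and \<xi>: "unit_normal M \<A> (zermelo_domain M \<A> F W) (zermelo_metric M \<A> F W) L \<xi>"
  shows "unit_normal M \<A> (tangent_bundle M \<A>) F L (\<lambda>q. \<xi> q - W q)"
    and "q \<in> L \<Longrightarrow> c \<in> \<A> \<Longrightarrow> q \<in> fst c \<Longrightarrow> 0 < 1 + dFc c (snd c q) ((\<xi> q - W q) c) (W q c)"
proof -
  have LM: "q \<in> topspace M" if "q \<in> L" for q using L that by (auto simp: hypersurface_def)
  have \<xi>q: "(q, \<xi> q) \<in> zermelo_domain M \<A> F W" "\<xi> q \<noteq> 0" "zermelo_metric M \<A> F W (q, \<xi> q) = 1"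
    "\<And>u. u \<in> hypersurface_tangent M \<A> L q \<Longrightarrow> fundamental_tensor (zermelo_metric M \<A> F W) q (\<xi> q) (\<xi> q) u = 0" if "q \<in> L" for q
    using \<xi> that unfolding unit_normal_def by blast+
  show "0 < 1 + dFc c (snd c q) ((\<xi> q - W q) c) (W q c)" if "q \<in> L" "c \<in> \<A>" "q \<in> fst c" for q c
    by (rule zermelo_unitD(3)[OF that(2,3) \<xi>q(1-3)[OF that(1)]])
  show "unit_normal M \<A> (tangent_bundle M \<A>) F L (\<lambda>q. \<xi> q - W q)"
    unfolding unit_normal_def
  proof (intro conjI ballI)
    show "smooth_along \<A> L (\<lambda>q. \<xi> q - W q)"
      unfolding smooth_along_def
    proof (intro conjI ballI)
      show "\<xi> q - W q \<in> tangent_space \<A> q" if "q \<in> L" for q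
        using \<xi> that tangent_diff[OF LM[OF that] _ W_tangent[OF LM[OF that]]] unfolding unit_normal_def smooth_along_def by blast
      fix c q assume c: "c \<in> \<A>" and q: "q \<in> L \<inter> fst c"
      obtain S V where S: "open S" "snd c q \<in> S" "smooth_on S V" "\<forall>x\<in>L \<inter> fst c. snd c x \<in> S \<longrightarrow> V (snd c x) = \<xi> x c"
        using \<xi> c q unfolding unit_normal_def smooth_along_def by blast
      have oS: "open (S \<inter> snd c ` fst c)" using S(1) chart(2)[OF c] by blast
      have "smooth_on (snd c ` (topspace M \<inter> fst c)) (\<lambda>x. W (chart_inv c x) c)"
        using W c by (simp add: smooth_vector_field_def)
      then have smW: "smooth_on (S \<inter> snd c ` fst c) (\<lambda>x. W (chart_inv c x) c)"
        by (rule smooth_on_subset) (use mem_topspace[OF c] in blast)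
      show "\<exists>S V. open S \<and> snd c q \<in> S \<and> smooth_on S V \<and> (\<forall>x\<in>L \<inter> fst c. snd c x \<in> S \<longrightarrow> V (snd c x) = (\<xi> x - W x) c)"
      proof (intro exI[of _ "S \<inter> snd c ` fst c"] exI[of _ "\<lambda>x. V x - W (chart_inv c x) c"] conjI ballI impI)
        show "smooth_on (S \<inter> snd c ` fst c) (\<lambda>x. V x - W (chart_inv c x) c)"
          by (rule smooth_on_diff[OF oS smooth_on_subset[OF S(3)] smW]) blast
        show "V (snd c x) - W (chart_inv c (snd c x)) c = (\<xi> x - W x) c" if "x \<in> L \<inter> fst c" "snd c x \<in> S \<inter> snd c ` fst c" for x
          using S(4) that c by simp
      qed (use oS S(2) q in blast)+
    qed
    fix q assume q: "q \<in> L"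
    note qM = LM[OF q]
    note c = chart_at[OF qM]
    note u = zermelo_unitD[OF c \<xi>q(1-3)[OF q]]
    have uT: "\<xi> q - W q \<in> tangent_space \<A> q" by (rule tangent_diff[OF qM u(1) W_tangent[OF qM]])
    show "(q, \<xi> q - W q) \<in> tangent_bundle M \<A>" using uT qM by (simp add: tangent_bundle_def)
    show une: "\<xi> q - W q \<noteq> 0" by (rule F_unit_nonzero[OF c u(2)])
    show "F (q, \<xi> q - W q) = 1" by (rule u(2))
    fix t assume t: "t \<in> hypersurface_tangent M \<A> L q"
    then have tT: "t \<in> tangent_space \<A> q" by (simp add: hypersurface_tangent_def)
    \<comment> \<open>The \<open>Z\<close>-tensor at \<open>\<xi>\<close> is the
      \<open>F\<close>-differential at \<open>\<xi> - W\<close> divided by a positive number, so if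
      one of them vanishes on \<open>t\<close>, then so does the other.\<close>
    have "\<xi> q - W q + W q = \<xi> q" by simp
    from zermelo_unitI(4)[OF c uT u(2,3) tT, unfolded this] \<xi>q(4)[OF q t] u(3)
    show "fundamental_tensor F q (\<xi> q - W q) (\<xi> q - W q) t = 0"
      unfolding tensor_F[OF c uT une tT] by simp
  qed
qed

section \<open>The Busemann-Hausdorff density and the divergence in a chart\<close>

definition density :: "('a, 'n) chart \<Rightarrow> real^'n \<Rightarrow> real" where
  "density c x = measure lborel (ball (0 :: real^'n) 1) / finsler_domain.ball_volume (Fc c) x"

lemma density:
  assumes c: "c \<in> \<A>" and x: "x \<in> snd c ` fst c"
  shows "density c x > 0" "density c differentiable (at x)"
proof -
  interpret finsler_domain "snd c ` fst c" "Fc c" by (rule finsler_domain_chart[OF c])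
  have "measure lborel (ball (0 :: real^'n) 1) > 0"
    using content_ball_pos[of 1 "0 :: real^'n"] by simp
  then show "density c x > 0" using emeasure_unit_ball(2)[OF x] by (simp add: density_def)
  show "density c differentiable (at x)"
    unfolding density_def[abs_def]
    using ball_volume_differentiable[OF x] emeasure_unit_ball(2)[OF x] by (intro differentiable_divide) auto
qed

lemma busemann_hausdorff_coords:
  assumes c: "c \<in> \<A>" "q \<in> fst c"
  shows "busemann_hausdorff \<A> F c q vs = density c (snd c q) * det (\<chi> i j. vs j c $ i)"
  unfolding busemann_hausdorff_def sum_coord_frame[OF c] Fc_apply[OF c, symmetric] density_def
    finsler_domain.ball_volume_def[OF finsler_domain_chart[OF c(1)]] ..

text \<open>The bracket of \<open>X\<close> with a field of constant coordinates \<open>v\<close> is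
  \<open>- X' v\<close>, so the sum in the Lie derivative is a sum of determinants with one column
  replaced, that is, a trace. The chart is \<open>chart_at\<close> because the definition evaluates
  the form there.\<close>

lemma divergence_coords:
  fixes X :: "'a \<Rightarrow> ('a, 'n) tvec"
  assumes p: "p \<in> topspace M"
  defines "c \<equiv> chart_at \<A> p"
  defines "X' \<equiv> frechet_derivative (\<lambda>x. X (chart_inv c x) c) (at (snd c p))"
  assumes X: "(\<lambda>x. X (chart_inv c x) c) differentiable (at (snd c p))"
  shows "divergence \<A> (busemann_hausdorff \<A> F) X p =
    frechet_derivative (density c) (at (snd c p)) (X p c) / density c (snd c p) + (\<Sum>b\<in>Basis. X' b \<bullet> b)"
proof -
  have c: "c \<in> \<A>" "p \<in> fst c" using chart_at[OF p] by (simp_all add: c_def)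
  let ?x = "snd c p" and ?\<sigma> = "density c (snd c p)" and ?\<sigma>' = "frechet_derivative (density c) (at (snd c p))"
  let ?tr = "\<Sum>b\<in>Basis. X' b \<bullet> b" and ?det = "\<lambda>vs. det (\<chi> i j. (vs j :: ('a, 'n) tvec) c $ i)"
  have xi: "?x \<in> snd c ` fst c" using c by blast
  have linX: "linear X'" unfolding X'_def using X by (rule linear_frechet_derivative)
  have lie: "lie_derivative \<A> X (busemann_hausdorff \<A> F c) p vs = (?\<sigma>' (X p c) / ?\<sigma> + ?tr) * busemann_hausdorff \<A> F c p vs" for vs
  proof -
    have "((\<lambda>x. density c x * ?det vs) has_derivative (\<lambda>v. ?\<sigma>' v * ?det vs)) (at ?x)"
      using density(2)[OF c(1) xi] by (intro has_derivative_mult_left) (simp add: frechet_derivative_works)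
    then have "(((\<lambda>q. busemann_hausdorff \<A> F c q (\<lambda>j. vec_of_coords \<A> c q (vs j c))) \<circ> chart_inv c) has_derivative (\<lambda>v. ?\<sigma>' v * ?det vs)) (at ?x)"
    proof (rule has_derivative_transform_within_open[OF _ chart(2)[OF c(1)] xi])
      fix x assume "x \<in> snd c ` fst c"
      then obtain q where q: "q \<in> fst c" "x = snd c q" by blast
      show "density c x * ?det vs = ((\<lambda>q. busemann_hausdorff \<A> F c q (\<lambda>j. vec_of_coords \<A> c q (vs j c))) \<circ> chart_inv c) x"
        using q c by (simp add: busemann_hausdorff_coords vec_of_coords_apply)
    qed
    from frechet_derivative_apply[OF this, of "X p c"]
    have 1: "differential \<A> (\<lambda>q. busemann_hausdorff \<A> F c q (\<lambda>j. vec_of_coords \<A> c q (vs j c))) p (X p) = ?\<sigma>' (X p c) * ?det vs"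
      unfolding differential_def Let_def c_def[symmetric] .
    have br: "lie_bracket \<A> X (\<lambda>q. vec_of_coords \<A> c q (vs j c)) p = vec_of_coords \<A> c p (- X' (vs j c))" for j
    proof -
      have "((\<lambda>x. vec_of_coords \<A> c (chart_inv c x) (vs j c) c) has_derivative (\<lambda>v. 0)) (at ?x)"
      proof (rule has_derivative_transform_within_open[OF has_derivative_const chart(2)[OF c(1)] xi])
        show "vs j c = vec_of_coords \<A> c (chart_inv c x) (vs j c) c" if "x \<in> snd c ` fst c" for x
          using vec_of_coords_apply[OF c(1) chart_inv_mem[OF that]] by simp
      qed
      from frechet_derivative_apply[OF this] show ?thesis
        unfolding lie_bracket_def Let_def c_def[symmetric] X'_def[symmetric] by (simp add: vec_of_coords_apply[OF c])
    qed
    have 2: "busemann_hausdorff \<A> F c p (vs(j := vec_of_coords \<A> c p (- X' (vs j c)))) =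
        ?\<sigma> * det (\<chi> i k. (if k = j then - X' (vs j c) else vs k c) $ i)" for j
    proof -
      have "(\<chi> i k. (vs(j := vec_of_coords \<A> c p (- X' (vs j c)))) k c $ i) = (\<chi> i k. (if k = j then - X' (vs j c) else vs k c) $ i)"
        by (simp add: vec_eq_iff vec_of_coords_apply[OF c])
      then show ?thesis unfolding busemann_hausdorff_coords[OF c] by simp
    qed
    have "linear (\<lambda>v. - X' v)" using linear_compose_neg[OF linX] .
    from sum_det_replace_column[OF this, of "\<lambda>k. vs k c"]
    have 3: "(\<Sum>j\<in>UNIV. det (\<chi> i k. (if k = j then - X' (vs j c) else vs k c) $ i)) = - ?tr * ?det vs"
      by (simp add: sum_negf)
    have "lie_derivative \<A> X (busemann_hausdorff \<A> F c) p vs = ?\<sigma>' (X p c) * ?det vs - ?\<sigma> * (- ?tr * ?det vs)"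
      unfolding lie_derivative_def Let_def c_def[symmetric] 1 br 2 3[symmetric] by (simp add: sum_distrib_left)
    also have "\<dots> = (?\<sigma>' (X p c) / ?\<sigma> + ?tr) * (?\<sigma> * ?det vs)"
      using density(1)[OF c(1) xi] by (simp add: field_simps)
    finally show ?thesis unfolding busemann_hausdorff_coords[OF c] .
  qed
  \<comment> \<open>Evaluation on the coordinate frame, where the determinant is 1, shows that the
    factor in the definite description is unique.\<close>
  have ne: "busemann_hausdorff \<A> F c p (coord_frame \<A> c p) \<noteq> 0"
  proof -
    have "(\<chi> i j. coord_frame \<A> c p j c $ i) = mat 1"
      by (auto simp: vec_eq_iff coord_frame_def vec_of_coords_apply[OF c] mat_def axis_def)
    then show ?thesis unfolding busemann_hausdorff_coords[OF c] using density(1)[OF c(1) xi] by simp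
  qed
  show ?thesis
    unfolding divergence_def Let_def c_def[symmetric]
  proof (rule the_equality)
    show "\<forall>vs. (\<forall>j. vs j \<in> tangent_space \<A> p) \<longrightarrow> lie_derivative \<A> X (busemann_hausdorff \<A> F c) p vs =
        (?\<sigma>' (X p c) / ?\<sigma> + ?tr) * busemann_hausdorff \<A> F c p vs" using lie by blast
    fix h assume "\<forall>vs. (\<forall>j. vs j \<in> tangent_space \<A> p) \<longrightarrow> lie_derivative \<A> X (busemann_hausdorff \<A> F c) p vs = h * busemann_hausdorff \<A> F c p vs"
    moreover have "\<forall>j. coord_frame \<A> c p j \<in> tangent_space \<A> p" using vec_of_coords_mem[OF c] by (simp add: coord_frame_def)
    ultimately have "h * busemann_hausdorff \<A> F c p (coord_frame \<A> c p) = (?\<sigma>' (X p c) / ?\<sigma> + ?tr) * busemann_hausdorff \<A> F c p (coord_frame \<A> c p)"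
      using lie[of "coord_frame \<A> c p"] by metis
    then show "h = ?\<sigma>' (X p c) / ?\<sigma> + ?tr" using ne by simp
  qed
qed

end

text \<open>Only the \<open>F\<close>-normal \<open>\<nu>\<close> is fixed. The normal for the other
  metric is recovered as \<open>\<nu>\<close> plus a drift, so both curvatures are computed in the
  same context.\<close>

locale hypersurface_point = zermelo_data M \<A> F W
  for M :: "'a topology" and \<A> :: "('a, 'n::finite) chart set" and F :: "'a \<times> ('a, 'n) tvec \<Rightarrow> real" and W :: "'a \<Rightarrow> ('a, 'n) tvec" +
  fixes L :: "'a set" and \<nu> :: "'a \<Rightarrow> ('a, 'n) tvec" and p :: 'a
  assumes L: "hypersurface M \<A> L" and \<nu>: "unit_normal M \<A> (tangent_bundle M \<A>) F L \<nu>" and p: "p \<in> L"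
begin

definition c where "c = chart_at \<A> p"

lemma L_topspace: "q \<in> L \<Longrightarrow> q \<in> topspace M"
  using L unfolding hypersurface_def by blast

lemma c: "c \<in> \<A>" "p \<in> fst c"
  unfolding c_def by (rule chart_at[OF L_topspace[OF p]])+

lemma normalD:
  assumes "q \<in> L"
  shows "\<nu> q \<in> tangent_space \<A> q" "\<nu> q \<noteq> 0" "F (q, \<nu> q) = 1"
    "u \<in> hypersurface_tangent M \<A> L q \<Longrightarrow> fundamental_tensor F q (\<nu> q) (\<nu> q) u = 0"
  using \<nu> assms unfolding unit_normal_def smooth_along_def by blast+

text \<open>Collects the hypersurface data in one chart in the shape that
  \<open>trace_unique\<close> and \<open>distance_function_exists\<close> consume. The smooth map
  \<open>n\<close> merely extends the normal; it has length 1 on \<open>L\<close> and arbitrary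
  length elsewhere.\<close>

lemma adapted_equation:
  obtains N and f :: "real^'n \<Rightarrow> real" and n :: "real^'n \<Rightarrow> real^'n" and e where "open N" "snd c p \<in> N" "N \<subseteq> snd c ` fst c" "smooth_on N f" "smooth_on N n" "f (snd c p) = 0"
    "\<And>x. x \<in> N \<Longrightarrow> f x = 0 \<longleftrightarrow> chart_inv c x \<in> L" "\<And>x. x \<in> N \<Longrightarrow> f x = 0 \<Longrightarrow> n x = \<nu> (chart_inv c x) c"
    "\<And>x v. x \<in> N \<Longrightarrow> f x = 0 \<Longrightarrow> frechet_derivative f (at x) v = 0 \<Longrightarrow> dFc c x (\<nu> (chart_inv c x) c) v = 0"
    "frechet_derivative f (at (snd c p)) e \<noteq> 0"
proof -
  obtain U h where pU: "p \<in> U" and h: "local_equation M \<A> L U h" using L p unfolding hypersurface_def by blast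
  have U: "openin M U" "smooth_fun \<A> U h" "L \<inter> U = {q \<in> U. h q = 0}" "\<forall>q\<in>L \<inter> U. regular_at \<A> h q"
    using h unfolding local_equation_def by blast+
  obtain S V where S: "open S" "snd c p \<in> S" "smooth_on S V" "\<forall>x\<in>L \<inter> fst c. snd c x \<in> S \<longrightarrow> V (snd c x) = \<nu> x c"
    using \<nu> c p unfolding unit_normal_def smooth_along_def by blast
  define f where "f = h \<circ> chart_inv c"
  let ?N = "snd c ` (U \<inter> fst c) \<inter> S"
  have smf: "smooth_on (snd c ` (U \<inter> fst c)) f" unfolding f_def by (rule smooth_funD[OF c(1) U(2)])
  have N: "chart_inv c x \<in> U" "chart_inv c x \<in> fst c" "snd c (chart_inv c x) = x" if x: "x \<in> ?N" for x
  proof -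
    obtain q where q: "q \<in> U" "q \<in> fst c" "x = snd c q" using x by blast
    then show "chart_inv c x \<in> U" "chart_inv c x \<in> fst c" "snd c (chart_inv c x) = x" using c by simp_all
  qed
  have level: "f x = 0 \<longleftrightarrow> chart_inv c x \<in> L" if x: "x \<in> ?N" for x
  proof -
    have "chart_inv c x \<in> L \<longleftrightarrow> chart_inv c x \<in> L \<inter> U" using N(1)[OF x] by blast
    also have "\<dots> \<longleftrightarrow> h (chart_inv c x) = 0" unfolding U(3) using N(1)[OF x] by blast
    finally show ?thesis by (simp add: f_def)
  qed
  have pN: "snd c p \<in> ?N" using pU S(2) c(2) by blast
  have "regular_at \<A> h p" using U(4) p pU by blast
  moreover have "(h \<circ> chart_inv c) differentiable (at (snd c p))"
    using smooth_on_differentiable[OF smf] pN unfolding f_def by blast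
  ultimately obtain e where e: "frechet_derivative f (at (snd c p)) e \<noteq> 0"
    using regular_at_iff[OF c] unfolding f_def by blast
  show ?thesis
  proof (rule that[of ?N f V e])
    show "open ?N" by (intro open_Int open_image c U S)
    show "snd c p \<in> ?N" by (rule pN)
    show "?N \<subseteq> snd c ` fst c" by blast
    show "smooth_on ?N f" by (rule smooth_on_subset[OF smf]) blast
    show "smooth_on ?N V" by (rule smooth_on_subset[OF S(3)]) blast
    show "f (snd c p) = 0" using level[OF pN] p c by simp
    show "f x = 0 \<longleftrightarrow> chart_inv c x \<in> L" if "x \<in> ?N" for x by (rule level[OF that])
    show "V x = \<nu> (chart_inv c x) c" if x: "x \<in> ?N" "f x = 0" for x
    proof -
      have "snd c (chart_inv c x) \<in> S" using N(3)[OF x(1)] x(1) by auto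
      then have "V (snd c (chart_inv c x)) = \<nu> (chart_inv c x) c" using S(4) N(2)[OF x(1)] level[OF x(1)] x(2) by blast
      then show ?thesis unfolding N(3)[OF x(1)] .
    qed
    show "dFc c x (\<nu> (chart_inv c x) c) v = 0" if x: "x \<in> ?N" "f x = 0" and v: "frechet_derivative f (at x) v = 0" for x v
    proof -
      let ?q = "chart_inv c x" and ?v = "vec_of_coords \<A> c (chart_inv c x) v"
      have q: "?q \<in> L" "?q \<in> fst c" "snd c ?q = x" using level[OF x(1)] x(2) N[OF x(1)] by auto
      note cq = c(1) q(2)
      have "?v \<in> hypersurface_tangent M \<A> L ?q"
        by (rule local_equation_tangent[OF h _ cq vec_of_coords_mem[OF cq]])
           (use q N(1)[OF x(1)] v in \<open>simp_all add: vec_of_coords_apply[OF cq] f_def\<close>)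
      from normalD(4)[OF q(1) this] show ?thesis
        unfolding tensor_F[OF cq normalD(1,2)[OF q(1)] vec_of_coords_mem[OF cq]] normalD(3)[OF q(1)] vec_of_coords_apply[OF cq] q(3) by simp
    qed
    show "frechet_derivative f (at (snd c p)) e \<noteq> 0" by (rule e)
  qed
qed

text \<open>The class of fields on which the trace term depends only through \<open>\<nu>\<close>.
  Differentiability is asked for at \<open>p\<close> alone, so that a gradient minus the drift
  qualifies at once.\<close>

definition unit_extension :: "(real^'n \<Rightarrow> real^'n) \<Rightarrow> bool" where
  "unit_extension Y \<longleftrightarrow> Y differentiable (at (snd c p)) \<and> (\<exists>N. open N \<and> snd c p \<in> N \<and> N \<subseteq> snd c ` fst c \<and>
     (\<forall>x\<in>N. Fc c (x, Y x) = 1 \<and> (chart_inv c x \<in> L \<longrightarrow> Y x = \<nu> (chart_inv c x) c)))"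

lemma unit_extension_trace:
  assumes "unit_extension X" "unit_extension Y"
  shows "(\<Sum>b\<in>Basis. frechet_derivative X (at (snd c p)) b \<bullet> b) = (\<Sum>b\<in>Basis. frechet_derivative Y (at (snd c p)) b \<bullet> b)"
proof -
  interpret finsler_domain "snd c ` fst c" "Fc c" by (rule finsler_domain_chart[OF c(1)])
  obtain N1 where N1: "open N1" "snd c p \<in> N1" "\<And>x. x \<in> N1 \<Longrightarrow> Fc c (x, X x) = 1"
    "\<And>x. x \<in> N1 \<Longrightarrow> chart_inv c x \<in> L \<Longrightarrow> X x = \<nu> (chart_inv c x) c" using assms(1) unfolding unit_extension_def by blast
  obtain N2 where N2: "open N2" "snd c p \<in> N2" "\<And>x. x \<in> N2 \<Longrightarrow> Fc c (x, Y x) = 1"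
    "\<And>x. x \<in> N2 \<Longrightarrow> chart_inv c x \<in> L \<Longrightarrow> Y x = \<nu> (chart_inv c x) c" using assms(2) unfolding unit_extension_def by blast
  obtain N and f :: "real^'n \<Rightarrow> real" and n e where N: "open N" "snd c p \<in> N" "N \<subseteq> snd c ` fst c" and f: "smooth_on N f" and "smooth_on N n" and f0: "f (snd c p) = 0"
    and level: "\<And>x. x \<in> N \<Longrightarrow> f x = 0 \<longleftrightarrow> chart_inv c x \<in> L" and "\<And>x. x \<in> N \<Longrightarrow> f x = 0 \<Longrightarrow> n x = \<nu> (chart_inv c x) c"
    and normal: "\<And>x v. x \<in> N \<Longrightarrow> f x = 0 \<Longrightarrow> frechet_derivative f (at x) v = 0 \<Longrightarrow> dFc c x (\<nu> (chart_inv c x) c) v = 0"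
    and e: "frechet_derivative f (at (snd c p)) e \<noteq> 0"
    by (rule adapted_equation) (rule that)
  let ?N = "N \<inter> N1 \<inter> N2"
  have sub: "?N \<subseteq> N" by blast
  show ?thesis
  proof (rule trace_unique[of ?N "snd c p" f e X Y])
    show "open ?N" using N(1) N1(1) N2(1) by blast
    show "snd c p \<in> ?N" using N(2) N1(2) N2(2) by blast
    show "?N \<subseteq> snd c ` fst c" using N(3) by blast
    show "smooth_on ?N f" by (rule smooth_on_subset[OF f sub])
    show "X differentiable (at (snd c p))" "Y differentiable (at (snd c p))" using assms unfolding unit_extension_def by blast+
    show "Fc c (x, X x) = 1" if "x \<in> ?N" for x by (rule N1(3)) (use that in blast)
    show "Fc c (x, Y x) = 1" if "x \<in> ?N" for x by (rule N2(3)) (use that in blast)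
    show "X x = Y x" if x: "x \<in> ?N" "f x = 0" for x
    proof -
      have "chart_inv c x \<in> L" using level[of x] x by blast
      then show ?thesis using N1(4)[of x] N2(4)[of x] x(1) by simp
    qed
    show "dF (snd c p) (X (snd c p)) v = 0" if "frechet_derivative f (at (snd c p)) v = 0" for v
      using normal[OF N(2) f0 that] N1(4)[OF N1(2)] level[OF N(2)] f0 by simp
  qed (rule f0, rule e)
qed

text \<open>A gradient is constrained at regular points only, and \<open>mean_curvature\<close>
  grants regularity just along \<open>L\<close>. As an open condition it spreads to a neighbourhood
  of \<open>p\<close>, on which the gradient is then a unit field.\<close>

lemma regular_neighbourhood:
  assumes U: "openin M U" "p \<in> U" and \<rho>: "smooth_fun \<A> U \<rho>" "regular_at \<A> \<rho> p"
  obtains N where "open N" "snd c p \<in> N" "N \<subseteq> snd c ` (U \<inter> fst c)" "\<And>x. x \<in> N \<Longrightarrow> regular_at \<A> \<rho> (chart_inv c x)"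
proof -
  let ?N = "snd c ` (U \<inter> fst c)"
  have o: "open ?N" by (rule open_image[OF c(1) U(1)])
  have sm: "smooth_on ?N (\<rho> \<circ> chart_inv c)" by (rule smooth_funD[OF c(1) \<rho>(1)])
  have pN: "snd c p \<in> ?N" using U(2) c(2) by blast
  obtain e where e: "frechet_derivative (\<rho> \<circ> chart_inv c) (at (snd c p)) e \<noteq> 0"
    using regular_at_iff[OF c smooth_on_differentiable[OF sm pN]] \<rho>(2) by blast
  let ?N' = "{x \<in> ?N. frechet_derivative (\<rho> \<circ> chart_inv c) (at x) e \<in> - {0}}"
  show ?thesis
  proof (rule that[of ?N'])
    show "open ?N'"
      using continuous_open_preimage[OF smooth_on_continuous_on[OF smooth_on_frechet_derivative[OF sm, of e]] o open_Compl[OF closed_singleton[of 0]]]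
      by (simp add: vimage_def Int_def)
    show "snd c p \<in> ?N'" using pN e by blast
    show "regular_at \<A> \<rho> (chart_inv c x)" if x: "x \<in> ?N'" for x
    proof -
      have xN: "x \<in> ?N" and ne: "frechet_derivative (\<rho> \<circ> chart_inv c) (at x) e \<noteq> 0" using x by auto
      obtain q where q: "q \<in> fst c" "x = snd c q" using xN by blast
      have "regular_at \<A> \<rho> q"
        using regular_at_iff[OF c(1) q(1), of \<rho>] smooth_on_differentiable[OF sm xN] ne unfolding q(2) by blast
      then show ?thesis using q c(1) by simp
    qed
  qed blast
qed

text \<open>Both mean curvatures are instances of this one: \<open>V\<close> is \<open>0\<close> for \<open>F\<close> and the wind for \<open>Z\<close>.\<close>

lemma mean_curvature_coords:
  assumes Y0: "unit_extension Y0" and V: "smooth_vector_field \<A> (topspace M) V"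
    and unitD: "\<And>q v. q \<in> fst c \<Longrightarrow> (q, v) \<in> A \<Longrightarrow> v \<noteq> 0 \<Longrightarrow> G (q, v) = 1 \<Longrightarrow> v \<in> tangent_space \<A> q \<Longrightarrow> F (q, v - V q) = 1"
    and unitI: "\<And>q u. q \<in> fst c \<Longrightarrow> u \<in> tangent_space \<A> q \<Longrightarrow> F (q, u) = 1 \<Longrightarrow> 0 < 1 + dFc c (snd c q) (u c) (V q c) \<Longrightarrow>
      (q, u + V q) \<in> A \<and> u + V q \<noteq> 0 \<and> G (q, u + V q) = 1 \<and> (\<forall>t\<in>tangent_space \<A> q.
      fundamental_tensor G q (u + V q) (u + V q) t = dFc c (snd c q) (u c) (t c) / (1 + dFc c (snd c q) (u c) (V q c)))"
    and wind: "0 < 1 + dFc c (snd c p) (\<nu> p c) (V p c)" and \<xi>: "\<And>q. q \<in> L \<Longrightarrow> \<xi> q = \<nu> q + V q"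
  shows "mean_curvature M \<A> A G (busemann_hausdorff \<A> F) L \<xi> p =
    frechet_derivative (density c) (at (snd c p)) (\<xi> p c) / density c (snd c p) +
    ((\<Sum>b\<in>Basis. frechet_derivative Y0 (at (snd c p)) b \<bullet> b) +
     (\<Sum>b\<in>Basis. frechet_derivative (\<lambda>x. V (chart_inv c x) c) (at (snd c p)) b \<bullet> b))"
    (is "_ = ?h")
proof -
  interpret finsler_domain "snd c ` fst c" "Fc c" by (rule finsler_domain_chart[OF c(1)])
  let ?x0 = "snd c p" and ?V = "\<lambda>x. V (chart_inv c x) c"
  have pM: "p \<in> topspace M" by (rule L_topspace[OF p])
  have VT: "V q \<in> tangent_space \<A> q" if "q \<in> topspace M" for q using V that unfolding smooth_vector_field_def by blast
  have smV: "smooth_on (snd c ` fst c) ?V"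
  proof -
    have "smooth_on (snd c ` (topspace M \<inter> fst c)) ?V" using V c(1) unfolding smooth_vector_field_def by blast
    then show ?thesis by (rule smooth_on_subset) (use mem_topspace[OF c(1)] in blast)
  qed
  have x0: "?x0 \<in> snd c ` fst c" using c(2) by blast
  have V': "?V differentiable (at ?x0)" by (rule smooth_on_differentiable[OF smV x0])
  have unique: "divergence \<A> (busemann_hausdorff \<A> F) X p = ?h"
    if pU: "p \<in> U" and dist: "distance_function M \<A> A G U \<rho> X" and LU: "L \<inter> U = {q \<in> U. \<rho> q = \<rho> p}"
      and X: "\<forall>q\<in>L \<inter> U. regular_at \<A> \<rho> q \<and> X q = \<xi> q" for U \<rho> X
  proof -
    have U: "openin M U" "smooth_fun \<A> U \<rho>" and adm: "admissible_field \<A> A {q \<in> U. regular_at \<A> \<rho> q} X"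
      and GX: "\<And>q. q \<in> U \<Longrightarrow> regular_at \<A> \<rho> q \<Longrightarrow> G (q, X q) = 1"
      using dist unfolding distance_function_def is_gradient_def by blast+
    have reg: "regular_at \<A> \<rho> p" using X p pU by blast
    obtain N where N: "open N" "?x0 \<in> N" "N \<subseteq> snd c ` (U \<inter> fst c)" "\<And>x. x \<in> N \<Longrightarrow> regular_at \<A> \<rho> (chart_inv c x)"
      by (rule regular_neighbourhood[OF U(1) pU U(2) reg]) (rule that)
    have "smooth_on (snd c ` ({q \<in> U. regular_at \<A> \<rho> q} \<inter> fst c)) (\<lambda>x. X (chart_inv c x) c)"
      using adm c(1) unfolding admissible_field_def smooth_vector_field_def by blast
    moreover have "?x0 \<in> snd c ` ({q \<in> U. regular_at \<A> \<rho> q} \<inter> fst c)" using pU reg c(2) by blast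
    ultimately have X': "(\<lambda>x. X (chart_inv c x) c) differentiable (at ?x0)" by (rule smooth_on_differentiable)
    \<comment> \<open>Removing the drift turns a \<open>G\<close>-unit gradient into an
      \<open>F\<close>-unit field that restricts to \<open>\<nu>\<close> on \<open>L\<close>, so its
      trace is the one of \<open>Y0\<close>.\<close>
    let ?Y = "\<lambda>x. X (chart_inv c x) c - ?V x"
    have "unit_extension ?Y"
      unfolding unit_extension_def
    proof (intro conjI exI[of _ N] ballI impI)
      show "?Y differentiable (at ?x0)" by (intro differentiable_diff X' V')
      show "open N" "?x0 \<in> N" by (rule N)+
      show "N \<subseteq> snd c ` fst c" using N(3) by blast
      fix x assume x: "x \<in> N"
      obtain q where q: "q \<in> U" "q \<in> fst c" "x = snd c q" using N(3) x by blast
      have inv: "chart_inv c x = q" using q c(1) by simp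
      have qM: "q \<in> topspace M" by (rule mem_topspace[OF c(1) q(2)])
      have rq: "regular_at \<A> \<rho> q" using N(4)[OF x] inv by simp
      have Xq: "X q \<in> tangent_space \<A> q" "(q, X q) \<in> A" "X q \<noteq> 0"
        using adm q(1) rq unfolding admissible_field_def smooth_vector_field_def by blast+
      have "F (q, X q - V q) = 1" by (rule unitD[OF q(2) Xq(2,3) GX[OF q(1) rq] Xq(1)])
      then show "Fc c (x, ?Y x) = 1"
        using Fc_coords[OF c(1) q(2) tangent_diff[OF qM Xq(1) VT[OF qM]]] unfolding inv by (simp add: q(3))
      show "?Y x = \<nu> (chart_inv c x) c" if "chart_inv c x \<in> L"
      proof -
        have "X q = \<nu> q + V q" using X \<xi> that q(1) inv by auto
        then show ?thesis unfolding inv by simp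
      qed
    qed
    from unit_extension_trace[OF this Y0]
    have tr: "(\<Sum>b\<in>Basis. frechet_derivative ?Y (at ?x0) b \<bullet> b) = (\<Sum>b\<in>Basis. frechet_derivative Y0 (at ?x0) b \<bullet> b)" .
    have "frechet_derivative ?Y (at ?x0) b = frechet_derivative (\<lambda>x. X (chart_inv c x) c) (at ?x0) b - frechet_derivative ?V (at ?x0) b" for b
      by (rule frechet_derivative_apply, intro has_derivative_diff) (use X' V' in \<open>simp_all only: frechet_derivative_works\<close>)
    then have "(\<Sum>b\<in>Basis. frechet_derivative (\<lambda>x. X (chart_inv c x) c) (at ?x0) b \<bullet> b) =
        (\<Sum>b\<in>Basis. frechet_derivative Y0 (at ?x0) b \<bullet> b) + (\<Sum>b\<in>Basis. frechet_derivative ?V (at ?x0) b \<bullet> b)"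
      unfolding tr[symmetric] by (simp add: inner_diff_left sum_subtractf)
    moreover have "X p = \<xi> p" using X p pU by blast
    ultimately show ?thesis
      using divergence_coords[OF pM, of X, folded c_def, OF X'] by simp
  qed
  have "\<exists>U \<rho> X. p \<in> U \<and> distance_function M \<A> A G U \<rho> X \<and> L \<inter> U = {q \<in> U. \<rho> q = \<rho> p} \<and>
        (\<forall>q\<in>L \<inter> U. regular_at \<A> \<rho> q \<and> X q = \<xi> q)"
  proof -
    obtain N and f :: "real^'n \<Rightarrow> real" and n e where N: "open N" "?x0 \<in> N" "N \<subseteq> snd c ` fst c" and f: "smooth_on N f" and n: "smooth_on N n" and f0: "f ?x0 = 0"
      and level: "\<And>x. x \<in> N \<Longrightarrow> f x = 0 \<longleftrightarrow> chart_inv c x \<in> L" and n\<nu>: "\<And>x. x \<in> N \<Longrightarrow> f x = 0 \<Longrightarrow> n x = \<nu> (chart_inv c x) c"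
      and normal: "\<And>x v. x \<in> N \<Longrightarrow> f x = 0 \<Longrightarrow> frechet_derivative f (at x) v = 0 \<Longrightarrow> dFc c x (\<nu> (chart_inv c x) c) v = 0"
      and "frechet_derivative f (at ?x0) e \<noteq> 0"
      by (rule adapted_equation) (rule that)
    have Fn: "Fc c (x, n x) = 1" if x: "x \<in> N" "f x = 0" for x
    proof -
      have xi: "x \<in> snd c ` fst c" using x(1) N(3) by blast
      have q: "chart_inv c x \<in> fst c" "snd c (chart_inv c x) = x" using chart_inv_mem[OF xi] chart_chart_inv[OF xi] by simp_all
      have qL: "chart_inv c x \<in> L" using level[OF x(1)] x(2) by simp
      show ?thesis
        using Fc_coords[OF c(1) q(1) normalD(1)[OF qL]] normalD(3)[OF qL] unfolding q(2) n\<nu>[OF x] by simp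
    qed
    have nn: "dF x (n x) v = 0" if "x \<in> N" "f x = 0" "frechet_derivative f (at x) v = 0" for x v
      using normal[OF that] n\<nu>[OF that(1,2)] by simp
    \<comment> \<open>The wind condition at \<open>p\<close> alone is needed as input: the existence
      theorem shrinks the neighbourhood and returns the condition at all its points.\<close>
    have w0: "0 < 1 + dF ?x0 (n ?x0) (?V ?x0)" using wind n\<nu>[OF N(2) f0] c by simp
    obtain N' Y \<rho> where N': "open N'" "?x0 \<in> N'" "N' \<subseteq> N" and sm: "smooth_on N' \<rho>" "smooth_on N' Y"
      and FY: "\<And>x. x \<in> N' \<Longrightarrow> Fc c (x, Y x) = 1" and windY: "\<And>x. x \<in> N' \<Longrightarrow> 0 < 1 + dF x (Y x) (?V x)"
      and \<rho>': "\<And>x v. x \<in> N' \<Longrightarrow> frechet_derivative \<rho> (at x) v = dF x (Y x) v / (1 + dF x (Y x) (?V x))"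
      and \<rho>f: "\<And>x. x \<in> N' \<Longrightarrow> \<rho> x = 0 \<longleftrightarrow> f x = 0" and Yn: "\<And>x. x \<in> N' \<Longrightarrow> f x = 0 \<Longrightarrow> Y x = n x"
      by (rule distance_function_exists[OF N f f0 smooth_on_subset[OF smV N(3)] n Fn nn w0]) (assumption+, rule that)
    have N'c: "N' \<subseteq> snd c ` fst c" using N' N by blast
    \<comment> \<open>The solution carried back to the manifold; the drift is added again, since the
      gradient with respect to \<open>G\<close> is the \<open>F\<close>-unit field \<open>Y\<close>
      plus \<open>V\<close>.\<close>
    let ?U = "chart_inv c ` N'" and ?\<rho> = "\<lambda>q. \<rho> (snd c q)" and ?X = "\<lambda>q. vec_of_coords \<A> c q (Y (snd c q) + ?V (snd c q))"
    have U: "q \<in> fst c" "snd c q \<in> N'" if q: "q \<in> ?U" for q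
    proof -
      obtain x where x: "x \<in> N'" "q = chart_inv c x" using q by blast
      then have xi: "x \<in> snd c ` fst c" using N'c by blast
      show "q \<in> fst c" "snd c q \<in> N'" using x chart_inv_mem[OF xi] chart_chart_inv[OF xi] by simp_all
    qed
    have oU: "openin M ?U" by (rule open_preimage[OF c(1) N'(1) N'c])
    have pU: "p \<in> ?U" using N'(2) chart_inv[OF c] by force
    have smX: "smooth_vector_field \<A> ?U ?X"
      by (rule smooth_transport(2)[where Y="\<lambda>x. Y x + ?V x", OF c(1) N'(1) N'c smooth_on_add[OF N'(1) sm(2) smooth_on_subset[OF smV N'c]]])
    have X: "?X q = vec_of_coords \<A> c q (Y (snd c q)) + V q" if q: "q \<in> ?U" for q
    proof -
      note cq = c(1) U(1)[OF q]
      show ?thesis using vec_of_coords_coords[OF cq VT[OF mem_topspace[OF cq]]] chart_inv[OF cq]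
        by (simp add: linear_vec_of_coords[OF cq])
    qed
    have \<rho>'q: "((?\<rho> \<circ> chart_inv c) has_derivative (\<lambda>v. dF (snd c q) (Y (snd c q)) v / (1 + dF (snd c q) (Y (snd c q)) (V q c)))) (at (snd c q))"
      if q: "q \<in> ?U" for q
    proof -
      have 1: "frechet_derivative \<rho> (at (snd c q)) = (\<lambda>v. dF (snd c q) (Y (snd c q)) v / (1 + dF (snd c q) (Y (snd c q)) (V q c)))"
        using \<rho>'[OF U(2)[OF q]] chart_inv[OF c(1) U(1)[OF q]] by auto
      have "(\<rho> has_derivative frechet_derivative \<rho> (at (snd c q))) (at (snd c q))"
        by (rule smooth_on_has_derivative[OF sm(1) U(2)[OF q]])
      then show ?thesis
        unfolding 1
      proof (rule has_derivative_transform_within_open[OF _ N'(1) U(2)[OF q]])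
        show "\<rho> x = (?\<rho> \<circ> chart_inv c) x" if "x \<in> N'" for x
          using chart_chart_inv[of x c] N'c that by (simp add: subset_iff)
      qed
    qed
    have good: "vec_of_coords \<A> c q (Y (snd c q)) \<in> tangent_space \<A> q" "F (q, vec_of_coords \<A> c q (Y (snd c q))) = 1"
      "0 < 1 + dF (snd c q) (vec_of_coords \<A> c q (Y (snd c q)) c) (V q c)" if q: "q \<in> ?U" for q
    proof -
      note cq = c(1) U(1)[OF q]
      show "vec_of_coords \<A> c q (Y (snd c q)) \<in> tangent_space \<A> q" by (rule vec_of_coords_mem[OF cq])
      show "F (q, vec_of_coords \<A> c q (Y (snd c q))) = 1" using FY[OF U(2)[OF q]] by (simp add: Fc_apply[OF cq])
      show "0 < 1 + dF (snd c q) (vec_of_coords \<A> c q (Y (snd c q)) c) (V q c)"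
        using windY[OF U(2)[OF q]] chart_inv[OF cq] by (simp add: vec_of_coords_apply[OF cq])
    qed
    have unitX: "(q, ?X q) \<in> A \<and> ?X q \<noteq> 0 \<and> G (q, ?X q) = 1" if q: "q \<in> ?U" for q
      unfolding X[OF q] using unitI[OF U(1)[OF q] good[OF q]] by blast
    have regular: "regular_at \<A> ?\<rho> q" if q: "q \<in> ?U" for q
    proof -
      note cq = c(1) U(1)[OF q]
      have d: "(?\<rho> \<circ> chart_inv c) differentiable (at (snd c q))" using \<rho>'q[OF q] unfolding differentiable_def by blast
      have xD: "snd c q \<in> snd c ` fst c" using cq by blast
      \<comment> \<open>In the direction of \<open>Y\<close> itself the differential of
        \<open>\<rho>\<close> is \<open>1 / (1 + dF (V))\<close>, hence nonzero; so all points of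
        the neighbourhood are regular.\<close>
      have "dF (snd c q) (Y (snd c q)) (Y (snd c q)) = 1"
        using dF_euler[OF xD F_one_nonzero[OF xD FY[OF U(2)[OF q]]]] FY[OF U(2)[OF q]] by simp
      then have "frechet_derivative (?\<rho> \<circ> chart_inv c) (at (snd c q)) (Y (snd c q)) \<noteq> 0"
        using good(3)[OF q] unfolding frechet_derivative_apply[OF \<rho>'q[OF q]] by (simp add: vec_of_coords_apply[OF cq])
      then show ?thesis using regular_at_iff[OF cq d] by blast
    qed
    have dist: "distance_function M \<A> A G ?U ?\<rho> ?X"
      unfolding distance_function_def is_gradient_def admissible_field_def
    proof (intro conjI ballI impI)
      show "openin M ?U" by (rule oU)
      show "smooth_fun \<A> ?U ?\<rho>" by (rule smooth_transport(1)[OF c(1) N'(1) N'c sm(1)])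
      show "smooth_vector_field \<A> {q \<in> ?U. regular_at \<A> ?\<rho> q} ?X"
        by (rule smooth_vector_field_subset[OF smX]) blast
      fix q
      show "(q, ?X q) \<in> A" "?X q \<noteq> 0" if "q \<in> {q \<in> ?U. regular_at \<A> ?\<rho> q}"
        using unitX[of q] that by blast+
      show "G (q, ?X q) = 1" if "q \<in> ?U" using unitX[of q] that by blast
      fix t assume q: "q \<in> {q \<in> ?U. regular_at \<A> ?\<rho> q}" and t: "t \<in> tangent_space \<A> q"
      have qU: "q \<in> ?U" using q by blast
      note cq = c(1) U(1)[OF qU]
      have d: "(?\<rho> \<circ> chart_inv c) differentiable (at (snd c q))" using \<rho>'q[OF qU] unfolding differentiable_def by blast
      show "fundamental_tensor G q (?X q) (?X q) t = differential \<A> ?\<rho> q t"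
        unfolding differential_eq[OF cq d t] frechet_derivative_apply[OF \<rho>'q[OF qU]] X[OF qU]
        using unitI[OF U(1)[OF qU] good[OF qU]] t by (simp add: vec_of_coords_apply[OF cq])
    qed
    have \<rho>p: "?\<rho> p = 0" using \<rho>f[OF N'(2)] f0 by simp
    have onL: "q \<in> L \<longleftrightarrow> ?\<rho> q = 0" if q: "q \<in> ?U" for q
    proof -
      have "snd c q \<in> N" using U(2)[OF q] N'(3) by blast
      from level[OF this] show ?thesis using \<rho>f[OF U(2)[OF q]] chart_inv[OF c(1) U(1)[OF q]] by simp
    qed
    have X\<xi>: "?X q = \<xi> q" if q: "q \<in> ?U" "q \<in> L" for q
    proof -
      note cq = c(1) U(1)[OF q(1)]
      have "f (snd c q) = 0" using onL[OF q(1)] q(2) \<rho>f[OF U(2)[OF q(1)]] by simp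
      moreover have "snd c q \<in> N" using U(2)[OF q(1)] N'(3) by blast
      ultimately have "Y (snd c q) = \<nu> q c" using Yn[OF U(2)[OF q(1)]] n\<nu> chart_inv[OF cq] by simp
      then show ?thesis unfolding X[OF q(1)] \<xi>[OF q(2)] using vec_of_coords_coords[OF cq normalD(1)[OF q(2)]] by simp
    qed
    show ?thesis
    proof (intro exI[of _ ?U] exI[of _ ?\<rho>] exI[of _ ?X] conjI ballI)
      show "L \<inter> ?U = {q \<in> ?U. ?\<rho> q = ?\<rho> p}" unfolding \<rho>p using onL by blast
    qed (use pU dist regular X\<xi> in blast)+
  qed
  then obtain U \<rho> X where dist: "p \<in> U" "distance_function M \<A> A G U \<rho> X" "L \<inter> U = {q \<in> U. \<rho> q = \<rho> p}"
      "\<forall>q\<in>L \<inter> U. regular_at \<A> \<rho> q \<and> X q = \<xi> q"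
    by (elim exE conjE) (rule that)
  show ?thesis
    unfolding mean_curvature_def
  proof (rule the_equality)
    show "\<exists>U \<rho> X. p \<in> U \<and> distance_function M \<A> A G U \<rho> X \<and> L \<inter> U = {q \<in> U. \<rho> q = \<rho> p} \<and>
        (\<forall>q\<in>L \<inter> U. regular_at \<A> \<rho> q \<and> X q = \<xi> q) \<and> ?h = divergence \<A> (busemann_hausdorff \<A> F) X p"
      by (intro exI conjI) (rule dist(1), rule dist(2), rule dist(3), rule dist(4), rule unique[OF dist, symmetric])
  qed (elim exE conjE, simp only: unique)
qed

end

theorem corollary1p3:
  fixes M :: "'a topology" and \<A> :: "('a, 'n::finite) chart set"
    and F :: "'a \<times> ('a, 'n) tvec \<Rightarrow> real"
    and W \<xi> :: "'a \<Rightarrow> ('a, 'n) tvec"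
    and L :: "'a set"
  assumes "smooth_manifold M \<A>" and "connected_space M"
    and "finsler M \<A> F"
    and "smooth_vector_field \<A> (topspace M) W"
    and "hypersurface M \<A> L"
    and "unit_normal M \<A> (zermelo_domain M \<A> F W) (zermelo_metric M \<A> F W) L \<xi>"
  shows "unit_normal M \<A> (tangent_bundle M \<A>) F L (\<lambda>q. \<xi> q - W q) \<and>
    (\<forall>p\<in>L. mean_curvature M \<A> (zermelo_domain M \<A> F W) (zermelo_metric M \<A> F W)
               (zermelo_busemann_hausdorff \<A> F W) L \<xi> p =
             mean_curvature M \<A> (tangent_bundle M \<A>) F
               (zermelo_busemann_hausdorff \<A> F W) L (\<lambda>q. \<xi> q - W q) p
             + divergence \<A> (zermelo_busemann_hausdorff \<A> F W) W p)"
proof (intro conjI ballI)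
  interpret zermelo_data M \<A> F W by unfold_locales (use assms in auto)
  let ?\<nu> = "\<lambda>q. \<xi> q - W q"
  show UN: "unit_normal M \<A> (tangent_bundle M \<A>) F L ?\<nu>" by (rule unit_normal_translate(1)[OF assms(5,6)])
  fix p assume p: "p \<in> L"
  interpret hypersurface_point M \<A> F W L ?\<nu> p by unfold_locales (use assms UN p in auto)
  interpret finsler_domain "snd c ` fst c" "Fc c" by (rule finsler_domain_chart[OF c(1)])
  have pM: "p \<in> topspace M" by (rule L_topspace[OF p])
  have x0: "snd c p \<in> snd c ` fst c" using c(2) by blast
  \<comment> \<open>One explicit unit extension, the extended normal divided by its
    \<open>F\<close>-length, fixes the trace value that the two curvature formulas share.\<close>
  have Y0: "\<exists>Y. unit_extension Y"
  proof -
    obtain N and f :: "real^'n \<Rightarrow> real" and n e where N: "open N" "snd c p \<in> N" "N \<subseteq> snd c ` fst c" and f: "smooth_on N f" and n: "smooth_on N n" and f0: "f (snd c p) = 0"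
      and level: "\<And>x. x \<in> N \<Longrightarrow> f x = 0 \<longleftrightarrow> chart_inv c x \<in> L" and n\<nu>: "\<And>x. x \<in> N \<Longrightarrow> f x = 0 \<Longrightarrow> n x = ?\<nu> (chart_inv c x) c"
      and "\<And>x v. x \<in> N \<Longrightarrow> f x = 0 \<Longrightarrow> frechet_derivative f (at x) v = 0 \<Longrightarrow> dFc c x (?\<nu> (chart_inv c x) c) v = 0"
      and "frechet_derivative f (at (snd c p)) e \<noteq> 0"
      by (rule adapted_equation) (rule that)
    let ?N = "{x \<in> N. n x \<in> - {0}}"
    have oN: "open ?N"
      using continuous_open_preimage[OF smooth_on_continuous_on[OF n] N(1) open_Compl[OF closed_singleton[of 0]]]
      by (simp add: vimage_def Int_def)
    have Fn: "Fc c (x, n x) = 1" if x: "x \<in> N" "f x = 0" for x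
    proof -
      have xi: "x \<in> snd c ` fst c" using x(1) N(3) by blast
      have q: "chart_inv c x \<in> fst c" "snd c (chart_inv c x) = x" using chart_inv_mem[OF xi] chart_chart_inv[OF xi] by simp_all
      have qL: "chart_inv c x \<in> L" using level[OF x(1)] x(2) by simp
      show ?thesis
        using Fc_coords[OF c(1) q(1) normalD(1)[OF qL]] normalD(3)[OF qL] unfolding q(2) n\<nu>[OF x] by simp
    qed
    have n0: "n (snd c p) \<noteq> 0" by (rule F_one_nonzero[OF x0 Fn[OF N(2) f0]])
    let ?Y = "\<lambda>x. inverse (Fc c (x, n x)) *\<^sub>R n x"
    have smn: "smooth_on ?N n" by (rule smooth_on_subset[OF n]) blast
    have smFn: "smooth_on ?N (\<lambda>x. Fc c (x, n x))"
      by (rule smooth_on_compose[OF oN open_slit smooth_on_Pair[OF oN smooth_on_ident[OF oN] smn] smooth_F]) (use N(3) in blast)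
    have pos: "0 < Fc c (x, n x)" if "x \<in> ?N" for x by (rule F_pos) (use that N(3) in blast)+
    have smY: "smooth_on ?N ?Y"
      by (intro smooth_on_scaleR smooth_on_inverse oN smFn smn) (drule pos, simp)
    have x0N: "snd c p \<in> ?N" using N(2) n0 by blast
    have "unit_extension ?Y"
      unfolding unit_extension_def
    proof (intro conjI exI[of _ ?N] ballI impI)
      show "?Y differentiable (at (snd c p))" by (rule smooth_on_differentiable[OF smY x0N])
      show "?N \<subseteq> snd c ` fst c" using N(3) by blast
      fix x assume x: "x \<in> ?N"
      have xD: "x \<in> snd c ` fst c" using x N(3) by blast
      show "Fc c (x, ?Y x) = 1" using F_scale[OF xD, of "inverse (Fc c (x, n x))" "n x"] pos[OF x] by simp
      show "?Y x = ?\<nu> (chart_inv c x) c" if "chart_inv c x \<in> L"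
      proof -
        have xN: "x \<in> N" using x by blast
        have fx: "f x = 0" using level[OF xN] that by simp
        show ?thesis using Fn[OF xN fx] n\<nu>[OF xN fx] by simp
      qed
    qed (use oN x0N in blast)+
    then show ?thesis by blast
  qed
  then obtain Y0 where Y0: "unit_extension Y0" by blast
  have Z: "mean_curvature M \<A> (zermelo_domain M \<A> F W) (zermelo_metric M \<A> F W) (busemann_hausdorff \<A> F) L \<xi> p =
    frechet_derivative (density c) (at (snd c p)) (\<xi> p c) / density c (snd c p) +
    ((\<Sum>b\<in>Basis. frechet_derivative Y0 (at (snd c p)) b \<bullet> b) +
     (\<Sum>b\<in>Basis. frechet_derivative (\<lambda>x. W (chart_inv c x) c) (at (snd c p)) b \<bullet> b))"
  proof (rule mean_curvature_coords[OF Y0 W])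
    show "F (q, v - W q) = 1" if "q \<in> fst c" "(q, v) \<in> zermelo_domain M \<A> F W" "v \<noteq> 0" "zermelo_metric M \<A> F W (q, v) = 1" for q v
      by (rule zermelo_unitD(2)[OF c(1) that])
    show "(q, u + W q) \<in> zermelo_domain M \<A> F W \<and> u + W q \<noteq> 0 \<and> zermelo_metric M \<A> F W (q, u + W q) = 1 \<and> (\<forall>t\<in>tangent_space \<A> q.
      fundamental_tensor (zermelo_metric M \<A> F W) q (u + W q) (u + W q) t = dFc c (snd c q) (u c) (t c) / (1 + dFc c (snd c q) (u c) (W q c)))"
      if u: "q \<in> fst c" "u \<in> tangent_space \<A> q" "F (q, u) = 1" "0 < 1 + dFc c (snd c q) (u c) (W q c)" for q u
      using zermelo_unitI[OF c(1) u] by blast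
    show "0 < 1 + dFc c (snd c p) (?\<nu> p c) (W p c)" by (rule unit_normal_translate(2)[OF assms(5,6) p c])
  qed simp
  have V0: "smooth_vector_field \<A> (topspace M) (\<lambda>q. 0)"
    unfolding smooth_vector_field_def
  proof (intro conjI ballI)
    show "0 \<in> tangent_space \<A> q" if "q \<in> topspace M" for q
      using vec_of_coords_mem[OF chart_at[OF that], of 0] linear_vec_of_coords(4)[OF chart_at[OF that]] by simp
    show "smooth_on (snd d ` (topspace M \<inter> fst d)) (\<lambda>x. (0 :: ('a, 'n) tvec) d)" if "d \<in> \<A>" for d
      unfolding zero_fun_apply by (rule smooth_on_const[OF open_image[OF that openin_topspace]])
  qed
  \<comment> \<open>For \<open>F\<close> itself the drift is \<open>0\<close>, so the denominator
    \<open>1 + dF (V)\<close> is 1 and the conditions on the tensor reduce to the formula for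
    \<open>F\<close>.\<close>
  have lin0: "dFc c (snd c q) (u c) 0 = 0" if "q \<in> fst c" "u \<in> tangent_space \<A> q" "F (q, u) = 1" for q u
  proof -
    have "u c \<noteq> 0" using tangent_eq_0[OF c(1) that(1,2)] F_unit_nonzero[OF c(1) that(1,3)] by simp
    then show ?thesis using linear_0[OF linear_dF] that(1) by blast
  qed
  have FF: "mean_curvature M \<A> (tangent_bundle M \<A>) F (busemann_hausdorff \<A> F) L ?\<nu> p =
    frechet_derivative (density c) (at (snd c p)) (?\<nu> p c) / density c (snd c p) +
    ((\<Sum>b\<in>Basis. frechet_derivative Y0 (at (snd c p)) b \<bullet> b) +
     (\<Sum>b\<in>Basis. frechet_derivative (\<lambda>x. (0 :: ('a, 'n) tvec) c) (at (snd c p)) b \<bullet> b))"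
  proof (rule mean_curvature_coords[OF Y0 V0])
    show "(q, u + 0) \<in> tangent_bundle M \<A> \<and> u + 0 \<noteq> 0 \<and> F (q, u + 0) = 1 \<and> (\<forall>t\<in>tangent_space \<A> q.
      fundamental_tensor F q (u + 0) (u + 0) t = dFc c (snd c q) (u c) (t c) / (1 + dFc c (snd c q) (u c) ((0 :: ('a, 'n) tvec) c)))"
      if u: "q \<in> fst c" "u \<in> tangent_space \<A> q" "F (q, u) = 1" for q u
    proof -
      have "u \<noteq> 0" by (rule F_unit_nonzero[OF c(1) u(1,3)])
      moreover have "(q, u) \<in> tangent_bundle M \<A>" using u(2) mem_topspace[OF c(1) u(1)] by (simp add: tangent_bundle_def)
      ultimately show ?thesis
        using tensor_F[OF c(1) u(1,2)] u(3) lin0[OF u] by simp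
    qed
    show "0 < 1 + dFc c (snd c p) (?\<nu> p c) ((0 :: ('a, 'n) tvec) c)"
      unfolding zero_fun_apply lin0[OF c(2) normalD(1,3)[OF p]] by simp
  qed simp_all
  have smW: "smooth_on (snd c ` (topspace M \<inter> fst c)) (\<lambda>x. W (chart_inv c x) c)"
    using W c(1) unfolding smooth_vector_field_def by blast
  have W': "(\<lambda>x. W (chart_inv c x) c) differentiable (at (snd c p))"
    by (rule smooth_on_differentiable[OF smW]) (use pM c(2) in blast)
  have linD: "linear (frechet_derivative (density c) (at (snd c p)))"
    by (rule linear_frechet_derivative[OF density(2)[OF c(1) x0]])
  \<comment> \<open>The density terms differ by the derivative along \<open>W\<close> and the trace
    terms by the trace of the derivative of \<open>W\<close>; together they are the coordinate
    expression of \<open>div W\<close>.\<close>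
  have "frechet_derivative (density c) (at (snd c p)) (?\<nu> p c) =
      frechet_derivative (density c) (at (snd c p)) (\<xi> p c) - frechet_derivative (density c) (at (snd c p)) (W p c)"
    using linear_diff[OF linD] by simp
  moreover have "frechet_derivative (\<lambda>x. (0 :: ('a, 'n) tvec) c) (at (snd c p)) b = 0" for b
    unfolding zero_fun_apply by (rule frechet_derivative_apply) (rule has_derivative_const)
  ultimately show "mean_curvature M \<A> (zermelo_domain M \<A> F W) (zermelo_metric M \<A> F W) (zermelo_busemann_hausdorff \<A> F W) L \<xi> p =
      mean_curvature M \<A> (tangent_bundle M \<A>) F (zermelo_busemann_hausdorff \<A> F W) L ?\<nu> p
      + divergence \<A> (zermelo_busemann_hausdorff \<A> F W) W p"
    unfolding zermelo_busemann_hausdorff_def Z FF divergence_coords[OF pM, of W, folded c_def, OF W']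
    by (simp add: diff_divide_distrib)
qed

end
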